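(* For every $m\in\mathbb{N}$, the operator $\Delta_{\overline{\mathcal{O}(m)}_\infty}:A^{(0,0)}(\mathbb{P}^1,\mathcal{O}(m))\to\mathcal{H}^{(m)}$ admits a maximal self-adjoint and positive extension (as an unbounded operator on the Hilbert space $\mathcal{H}^{(m)}$).
   Context: $\mathbb{N}=\{0,1,2,\dots\}$. $\mathbb{P}^1$ is the complex projective line with homogeneous coordinates $[x_0:x_1]$ and affine coordinate $z=x_1/x_0$; $\mathbb{S}^1=\{|z|=1\}$. $A^{(0,0)}(\mathbb{P}^1)$ is the space of $C^\infty$ complex functions on $\mathbb{P}^1$ and $A^{(0,0)}(\mathbb{P}^1,\mathcal{O}(m))$ the space of $C^\infty$ global sections of $\mathcal{O}(m)$. The holomorphic global sections of $\mathcal{O}(m)$ have basis $1,z,\dots,z^m$ ($z^k$ corresponds to $x_0^{m-k}x_1^k$); $f\otimes z^k$ denotes the section $f\cdot z^k$. Every element of $A^{(0,0)}(\mathbb{P}^1,\mathcal{O}(m))$ is of the form $\sum_{k=0}^m f_k\otimes z^k$ with $f_k\in A^{(0,0)}(\mathbb{P}^1)$. Canonical metric on $\mathcal{O}(m)$: $h_m(z^k,z^l)(z)=z^k\bar z^l/\max(1,|z|)^{2m}$. Canonical Kähler form: $\omega_\infty=\frac{i}{2\pi}\frac{dz\wedge d\bar z}{\max(1,|z|)^4}$, with corresponding metric $h_T(\partial_z,\partial_z)=\max(1,|z|)^{-4}$ on $T\mathbb{P}^1$. Hermitian product: $(\xi,\xi')_{L^2,\infty}=\int_{\mathbb{P}^1}h_m(\xi,\xi')\,\omega_\infty$;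 $\mathcal{H}^{(m)}$ is the Hilbert completion of $A^{(0,0)}(\mathbb{P}^1,\mathcal{O}(m))$ for it. $\Delta_{\overline{\mathcal{O}(m)}_\infty}$ is defined on $\mathbb{P}^1\setminus\mathbb{S}^1$ (hence almost everywhere) by $$\Delta_{\overline{\mathcal{O}(m)}_\infty}(f\otimes z^k)=-h_T(\partial_z,\partial_z)^{-1}h_m(z^k,z^k)^{-1}\frac{\partial}{\partial z}\Bigl(h_m(z^k,z^k)\frac{\partial f}{\partial\bar z}\Bigr)\otimes z^k,\qquad f\in A^{(0,0)}(\mathbb{P}^1),\ 0\le k\le m,$$ extended by linearity; it takes values in $\mathcal{H}^{(m)}$. A self-adjoint extension is called maximal if it has no proper self-adjoint extension; positive means $(Q\xi,\xi)_{L^2,\infty}\ge0$ on its domain. *)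

theory Defs
  imports "HOL-Analysis.Analysis"
begin

section \<open>Smooth functions on the complex plane\<close>

text \<open>\<open>C_k n f\<close>: \<open>f\<close> is of class \<open>C\<^sup>n\<close> on \<open>\<complex> = \<real>\<^sup>2\<close> (real differentiability).\<close>

primrec C_k :: "nat \<Rightarrow> (complex \<Rightarrow> complex) \<Rightarrow> bool" where
  "C_k 0 f \<longleftrightarrow> continuous_on UNIV f"
| "C_k (Suc n) f \<longleftrightarrow> (\<forall>z. f differentiable (at z)) \<and>
     (\<forall>v. C_k n (\<lambda>z. frechet_derivative f (at z) v))"

definition C_inf :: "(complex \<Rightarrow> complex) \<Rightarrow> bool" where
  "C_inf f \<longleftrightarrow> (\<forall>n. C_k n f)"

definition dd_z :: "(complex \<Rightarrow> complex) \<Rightarrow> complex \<Rightarrow> complex" where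
  "dd_z f z = (frechet_derivative f (at z) 1 - \<i> * frechet_derivative f (at z) \<i>) / 2"

definition dd_zbar :: "(complex \<Rightarrow> complex) \<Rightarrow> complex \<Rightarrow> complex" where
  "dd_zbar f z = (frechet_derivative f (at z) 1 + \<i> * frechet_derivative f (at z) \<i>) / 2"


section \<open>The complex projective line\<close>

definition scale_pair :: "complex \<Rightarrow> complex \<times> complex \<Rightarrow> complex \<times> complex" where
  "scale_pair c x = (c * fst x, c * snd x)"

definition proportional :: "complex \<times> complex \<Rightarrow> complex \<times> complex \<Rightarrow> bool" where
  "proportional x y \<longleftrightarrow> x \<noteq> 0 \<and> y \<noteq> 0 \<and> (\<exists>c. c \<noteq> 0 \<and> y = scale_pair c x)"

lemma part_equivp_proportional: "part_equivp proportional"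
proof (rule part_equivpI)
  have "proportional (1, 0) (1, 0)"
    by (auto simp: proportional_def scale_pair_def zero_prod_def intro!: exI[of _ 1])
  then show "\<exists>x. proportional x x" by blast
  show "symp proportional"
  proof (rule sympI)
    fix x y assume "proportional x y"
    then obtain c where c: "x \<noteq> 0" "y \<noteq> 0" "c \<noteq> 0" "y = scale_pair c x"
      by (auto simp: proportional_def)
    then have "x = scale_pair (inverse c) y"
      by (simp add: scale_pair_def prod_eq_iff flip: mult.assoc)
    with c show "proportional y x"
      unfolding proportional_def by (metis inverse_zero_imp_zero)
  qed
  show "transp proportional"
  proof (rule transpI)
    fix x y z assume "proportional x y" "proportional y z"
    then obtain c d where c: "x \<noteq> 0" "z \<noteq> 0" "c \<noteq> 0" "d \<noteq> 0"
        "y = scale_pair c x" "z = scale_pair d y"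
      by (auto simp: proportional_def)
    then have "z = scale_pair (d * c) x" "d * c \<noteq> 0"
      by (auto simp: scale_pair_def)
    with c show "proportional x z"
      unfolding proportional_def by blast
  qed
qed

quotient_type cproj = "complex \<times> complex" / partial: proportional
  by (rule part_equivp_proportional)

text \<open>\<open>hpoint (x0, x1)\<close> is the point \<open>[x0 : x1]\<close>; it is only meaningful for
  \<open>(x0, x1) \<noteq> 0\<close>.\<close>

definition hpoint :: "complex \<times> complex \<Rightarrow> cproj" where
  "hpoint x = abs_cproj x"

text \<open>At the point \<open>[0 : 1]\<close>, where the affine coordinate is infinite, the value is \<open>0\<close>
  by the convention \<open>x / 0 = 0\<close>.\<close>

lift_definition affine_coord :: "cproj \<Rightarrow> complex" is "\<lambda>x. snd x / fst x"
  by (auto simp: proportional_def scale_pair_def)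

text \<open>Smoothness on the projective line, tested in the two standard charts.\<close>

definition smooth_function :: "(cproj \<Rightarrow> complex) \<Rightarrow> bool" where
  "smooth_function f \<longleftrightarrow>
     C_inf (\<lambda>z. f (hpoint (1, z))) \<and> C_inf (\<lambda>w. f (hpoint (w, 1)))"


section \<open>Sections of \<open>O(m)\<close>\<close>

text \<open>The fibre of \<open>O(m)\<close> over a line \<open>l\<close> in \<open>\<complex>\<^sup>2\<close> consists of the functions on
  \<open>l - {0}\<close> that are homogeneous of degree \<open>m\<close>. Hence a section is a function on
  \<open>\<complex>\<^sup>2 - {0}\<close> that is homogeneous of degree \<open>m\<close>; its value at \<open>0\<close> is irrelevant.
  Its expression in the trivialization \<open>x0\<^sup>m\<close> over the affine chart is
  \<open>z \<mapsto> \<xi> (1, z)\<close>, and in the trivialization \<open>x1\<^sup>m\<close> it is \<open>w \<mapsto> \<xi> (w, 1)\<close>.\<close>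

type_synonym csection = "complex \<times> complex \<Rightarrow> complex"

definition is_section :: "nat \<Rightarrow> csection \<Rightarrow> bool" where
  "is_section m \<xi> \<longleftrightarrow>
     (\<forall>c x. c \<noteq> 0 \<longrightarrow> x \<noteq> 0 \<longrightarrow> \<xi> (scale_pair c x) = c ^ m * \<xi> x)"

definition smooth_sections :: "nat \<Rightarrow> csection set" where
  "smooth_sections m =
     {\<xi>. is_section m \<xi> \<and> C_inf (\<lambda>z. \<xi> (1, z)) \<and> C_inf (\<lambda>w. \<xi> (w, 1))}"

text \<open>\<open>tensor_mono m k f\<close> is \<open>f \<otimes> z\<^sup>k\<close>, for \<open>k \<le> m\<close>.\<close>

definition tensor_mono :: "nat \<Rightarrow> nat \<Rightarrow> (cproj \<Rightarrow> complex) \<Rightarrow> csection" where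
  "tensor_mono m k f = (\<lambda>x. f (hpoint x) * (fst x ^ (m - k) * snd x ^ k))"


section \<open>Canonical metrics and the \<open>L\<^sup>2\<close> product\<close>

text \<open>\<open>herm m \<xi> \<xi>' z\<close> is \<open>h\<^sub>m(\<xi>, \<xi>')\<close> at the point with affine coordinate \<open>z\<close>.\<close>

definition herm :: "nat \<Rightarrow> csection \<Rightarrow> csection \<Rightarrow> complex \<Rightarrow> complex" where
  "herm m \<xi> \<xi>' z = \<xi> (1, z) * cnj (\<xi>' (1, z)) / of_real (max 1 (cmod z) ^ (2 * m))"

definition mono_section :: "nat \<Rightarrow> nat \<Rightarrow> csection" where
  "mono_section m k = tensor_mono m k (\<lambda>_. 1)"

definition herm_T :: "complex \<Rightarrow> complex" where
  "herm_T z = of_real (1 / max 1 (cmod z) ^ 4)"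

text \<open>The measure given by the canonical Kaehler form on the affine chart, whose complement
  is one point. Since \<open>\<i> dz \<and> d\<bar>z = 2 dx \<and> dy\<close>, the form is
  \<open>dx \<and> dy / (\<pi> max(1, |z|)\<^sup>4)\<close>.\<close>

definition omega_inf :: "complex measure" where
  "omega_inf = density lborel (\<lambda>z. ennreal (1 / (pi * max 1 (cmod z) ^ 4)))"

definition L2_inner :: "nat \<Rightarrow> csection \<Rightarrow> csection \<Rightarrow> complex" where
  "L2_inner m \<xi> \<xi>' = (\<integral>z. herm m \<xi> \<xi>' z \<partial>omega_inf)"

definition L2_sections :: "nat \<Rightarrow> csection set" where
  "L2_sections m =
     {\<xi>. is_section m \<xi> \<and> (\<lambda>z. \<xi> (1, z)) \<in> borel_measurable borel \<and>
         integrable omega_inf (herm m \<xi> \<xi>)}"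

definition ae_class :: "nat \<Rightarrow> csection \<Rightarrow> csection set" where
  "ae_class m \<xi> = {\<xi>' \<in> L2_sections m. AE z in omega_inf. \<xi>' (1, z) = \<xi> (1, z)}"

definition repr :: "csection set \<Rightarrow> csection" where
  "repr X = (SOME \<xi>. \<xi> \<in> X)"


section \<open>Unbounded operators on a complex Hilbert space\<close>

text \<open>The space \<open>H\<^sup>(\<^sup>m\<^sup>)\<close> depends on the number \<open>m\<close>, so Hilbert spaces are given by explicit
  carriers. The inner product is linear in the first argument. An operator is represented by
  its graph.\<close>

record 'v ip_space =
  carr :: "'v set"
  vadd :: "'v \<Rightarrow> 'v \<Rightarrow> 'v"
  vscale :: "complex \<Rightarrow> 'v \<Rightarrow> 'v"
  inn :: "'v \<Rightarrow> 'v \<Rightarrow> complex"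

definition vdist :: "'v ip_space \<Rightarrow> 'v \<Rightarrow> 'v \<Rightarrow> real" where
  "vdist H x y = (let d = vadd H x (vscale H (-1) y) in sqrt (Re (inn H d d)))"

definition linear_operator :: "'v ip_space \<Rightarrow> ('v \<times> 'v) set \<Rightarrow> bool" where
  "linear_operator H T \<longleftrightarrow>
     T \<subseteq> carr H \<times> carr H \<and> T \<noteq> {} \<and> single_valued T \<and>
     (\<forall>(x, v) \<in> T. \<forall>(y, w) \<in> T. (vadd H x y, vadd H v w) \<in> T) \<and>
     (\<forall>c. \<forall>(x, v) \<in> T. (vscale H c x, vscale H c v) \<in> T)"

definition densely_defined :: "'v ip_space \<Rightarrow> ('v \<times> 'v) set \<Rightarrow> bool" where
  "densely_defined H T \<longleftrightarrow>
     (\<forall>x \<in> carr H. \<forall>e > 0. \<exists>y \<in> Domain T. vdist H x y < e)"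

definition adjoint_graph :: "'v ip_space \<Rightarrow> ('v \<times> 'v) set \<Rightarrow> ('v \<times> 'v) set" where
  "adjoint_graph H T =
     {(y, w) \<in> carr H \<times> carr H. \<forall>(x, v) \<in> T. inn H v y = inn H x w}"

definition self_adjoint :: "'v ip_space \<Rightarrow> ('v \<times> 'v) set \<Rightarrow> bool" where
  "self_adjoint H T \<longleftrightarrow>
     linear_operator H T \<and> densely_defined H T \<and> adjoint_graph H T = T"

definition maximal_self_adjoint :: "'v ip_space \<Rightarrow> ('v \<times> 'v) set \<Rightarrow> bool" where
  "maximal_self_adjoint H T \<longleftrightarrow>
     self_adjoint H T \<and> (\<forall>S. self_adjoint H S \<longrightarrow> T \<subseteq> S \<longrightarrow> S = T)"

definition positive_operator :: "'v ip_space \<Rightarrow> ('v \<times> 'v) set \<Rightarrow> bool" where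
  "positive_operator H T \<longleftrightarrow> (\<forall>(x, v) \<in> T. inn H v x \<in> \<real> \<and> Re (inn H v x) \<ge> 0)"


section \<open>The Hilbert space \<open>H\<^sup>(\<^sup>m\<^sup>)\<close> and the Laplacian\<close>

text \<open>The completion of the smooth sections is realized as their closure in the space of
  square integrable sections modulo equality almost everywhere, which is complete.\<close>

definition Hilb :: "nat \<Rightarrow> csection set ip_space" where
  "Hilb m = \<lparr>
     carr = {ae_class m \<xi> |\<xi>. \<xi> \<in> L2_sections m \<and>
        (\<exists>s. (\<forall>n. s n \<in> smooth_sections m) \<and>
             (\<lambda>n::nat. L2_inner m (\<lambda>x. \<xi> x - s n x) (\<lambda>x. \<xi> x - s n x)) \<longlonglongrightarrow> 0)},
     vadd = (\<lambda>X Y. ae_class m (\<lambda>x. repr X x + repr Y x)),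
     vscale = (\<lambda>c X. ae_class m (\<lambda>x. c * repr X x)),
     inn = (\<lambda>X Y. L2_inner m (repr X) (repr Y)) \<rparr>"

text \<open>The coefficient of \<open>z\<^sup>k\<close> in the image of \<open>f \<otimes> z\<^sup>k\<close>. It is defined off the unit circle
  and set to \<open>0\<close> there; the values at the null set \<open>z = 0, \<infinity>\<close> are irrelevant.\<close>

definition laplace_coeff :: "nat \<Rightarrow> nat \<Rightarrow> (cproj \<Rightarrow> complex) \<Rightarrow> cproj \<Rightarrow> complex" where
  "laplace_coeff m k f p =
     (let z = affine_coord p;
          h = herm m (mono_section m k) (mono_section m k);
          g = (\<lambda>z. f (hpoint (1, z)))
      in if cmod z = 1 then 0
         else - inverse (herm_T z) * inverse (h z) * dd_z (\<lambda>u. h u * dd_zbar g u) z)"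

text \<open>The graph of the Laplacian with domain the smooth sections. The decomposition
  \<open>\<xi> = \<Sum> f\<^sub>k \<otimes> z\<^sup>k\<close> is not unique, so all decompositions are admitted.\<close>

definition laplacian :: "nat \<Rightarrow> (csection set \<times> csection set) set" where
  "laplacian m =
     {(ae_class m \<xi>, ae_class m \<eta>) |\<xi> \<eta>. \<xi> \<in> smooth_sections m \<and>
        (\<exists>f. (\<forall>k\<le>m. smooth_function (f k)) \<and>
             (\<forall>x. x \<noteq> 0 \<longrightarrow> \<xi> x = (\<Sum>k\<le>m. tensor_mono m k (f k) x)) \<and>
             \<eta> = (\<lambda>x. \<Sum>k\<le>m. tensor_mono m k (laplace_coeff m k (f k)) x))}"

subsection \<open>The domain of the Laplacian is the space of smooth sections\<close>

lemma C_k_Suc_imp: "C_k (Suc n) f \<Longrightarrow> C_k n f"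
proof (induction n arbitrary: f)
  case 0
  then show ?case
    by (auto intro!: differentiable_imp_continuous_on simp: differentiable_on_def
        intro: differentiable_at_withinI)
next
  case (Suc n)
  then show ?case by (metis C_k.simps(2))
qed

lemma C_k_add: "C_k n f \<Longrightarrow> C_k n g \<Longrightarrow> C_k n (\<lambda>z. f z + g z)"
proof (induction n arbitrary: f g)
  case 0
  then show ?case by (auto intro: continuous_intros)
next
  case (Suc n)
  then have d: "f differentiable (at z)" "g differentiable (at z)" for z
    by auto
  have "frechet_derivative (\<lambda>z. f z + g z) (at z) v =
        frechet_derivative f (at z) v + frechet_derivative g (at z) v" for z v
    by (rule fun_cong[OF frechet_derivative_at[symmetric]])
       (intro has_derivative_add d[unfolded frechet_derivative_works])
  with Suc d show ?case by (auto intro!: differentiable_add)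
qed

lemma C_k_mult: "C_k n f \<Longrightarrow> C_k n g \<Longrightarrow> C_k n (\<lambda>z. f z * g z)"
proof (induction n arbitrary: f g)
  case 0
  then show ?case by (auto intro: continuous_intros)
next
  case (Suc n)
  then have d: "f differentiable (at z)" "g differentiable (at z)" for z
    by auto
  have e: "frechet_derivative (\<lambda>z. f z * g z) (at z) v =
        f z * frechet_derivative g (at z) v + frechet_derivative f (at z) v * g z" for z v
    by (rule fun_cong[OF frechet_derivative_at[symmetric]])
       (intro has_derivative_mult d[unfolded frechet_derivative_works])
  have "C_k n f" "C_k n g" using Suc.prems by (auto dest: C_k_Suc_imp simp del: C_k.simps)
  with Suc d show ?case by (auto simp: e intro!: differentiable_mult C_k_add)
qed

lemma C_k_inverse: "C_k n f \<Longrightarrow> (\<And>z. f z \<noteq> 0) \<Longrightarrow> C_k n (\<lambda>z. inverse (f z))"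
proof (induction n arbitrary: f)
  case 0
  then show ?case by (auto intro!: continuous_intros)
next
  case (Suc n)
  then have d: "f differentiable (at z)" for z
    by auto
  have h: "((\<lambda>z. inverse (f z)) has_derivative
      (\<lambda>v. - (inverse (f z) * frechet_derivative f (at z) v * inverse (f z)))) (at z)" for z
    by (rule Deriv.has_derivative_inverse[OF Suc.prems(2) d[unfolded frechet_derivative_works]])
  have e: "frechet_derivative (\<lambda>z. inverse (f z)) (at z) v =
      (-1) * (inverse (f z) * frechet_derivative f (at z) v * inverse (f z))" for z v
    using fun_cong[OF frechet_derivative_at[OF h, of z, symmetric], of v] by simp
  have c: "C_k n (\<lambda>_. a)" for a :: complex
    by (induction n arbitrary: a) auto
  have "C_k n f" using Suc.prems by (auto dest: C_k_Suc_imp simp del: C_k.simps)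
  then have "C_k n (\<lambda>z. inverse (f z))" using Suc by blast
  with Suc.prems c have "C_k n (\<lambda>z. frechet_derivative (\<lambda>z. inverse (f z)) (at z) v)" for v
    unfolding e by (intro C_k_mult) auto
  moreover have "(\<lambda>z. inverse (f z)) differentiable (at z)" for z
    using h unfolding differentiable_def by blast
  ultimately show ?case by simp
qed

lemma C_inf_const: "C_inf (\<lambda>_. a)"
proof -
  have "C_k n (\<lambda>_. a)" for n
    by (induction n arbitrary: a) auto
  then show ?thesis by (simp add: C_inf_def)
qed

lemma C_inf_bounded_linear:
  assumes "bounded_linear f"
  shows "C_inf f"
proof -
  have h: "(f has_derivative f) (at z)" for z
    using assms by (rule bounded_linear_imp_has_derivative)
  have "frechet_derivative f (at z) v = f v" for z v
    using frechet_derivative_at[OF h] by metis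
  moreover have "f differentiable (at z)" for z
    using assms by (rule bounded_linear_imp_differentiable)
  ultimately have "C_k n f" for n
    using C_inf_const assms
    by (cases n) (simp_all add: C_inf_def linear_continuous_on)
  then show ?thesis by (simp add: C_inf_def)
qed

lemma C_inf_add: "C_inf f \<Longrightarrow> C_inf g \<Longrightarrow> C_inf (\<lambda>z. f z + g z)"
  by (simp add: C_inf_def C_k_add)

lemma C_inf_mult: "C_inf f \<Longrightarrow> C_inf g \<Longrightarrow> C_inf (\<lambda>z. f z * g z)"
  by (simp add: C_inf_def C_k_mult)

lemma C_inf_inverse: "C_inf f \<Longrightarrow> (\<And>z. f z \<noteq> 0) \<Longrightarrow> C_inf (\<lambda>z. inverse (f z))"
  by (simp add: C_inf_def C_k_inverse)

lemma C_inf_power: "C_inf f \<Longrightarrow> C_inf (\<lambda>z. f z ^ n)"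
  by (induction n) (simp_all add: C_inf_mult C_inf_const)

lemma laplacian_domain: "Domain (laplacian m) = ae_class m ` smooth_sections m"
proof -
  have "\<exists>f. (\<forall>k\<le>m. smooth_function (f k)) \<and>
            (\<forall>x. x \<noteq> 0 \<longrightarrow> \<xi> x = (\<Sum>k\<le>m. tensor_mono m k (f k) x))"
    if \<xi>: "\<xi> \<in> smooth_sections m" for \<xi>
  proof -
    define N where "N x = fst x * cnj (fst x) + snd x * cnj (snd x)"
      for x :: "complex \<times> complex"
    define F where "F k x = \<xi> x * (of_nat (m choose k) *
        (cnj (fst x) ^ (m - k) * cnj (snd x) ^ k)) * inverse (N x ^ m)" for k x
    define f where "f k p = F k (rep_cproj p)" for k p
    have N_eq: "N x = of_real ((cmod (fst x))\<^sup>2 + (cmod (snd x))\<^sup>2)" for x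
      unfolding N_def of_real_add complex_norm_square by (rule refl)
    have N0: "N x \<noteq> 0" if "x \<noteq> 0" for x
      using that unfolding N_eq of_real_eq_0_iff
      by (simp add: sum_power2_eq_zero_iff prod_eq_iff)
    have inv: "F k y = F k x" if "proportional x y" "k \<le> m" for k x y
    proof -
      from that obtain c where c: "x \<noteq> 0" "y \<noteq> 0" "c \<noteq> 0" "y = scale_pair c x"
        by (auto simp: proportional_def)
      have "\<xi> y = c ^ m * \<xi> x"
        using \<xi> c unfolding smooth_sections_def is_section_def by blast
      moreover have "N y = (c * cnj c) * N x"
        by (simp add: c N_def scale_pair_def algebra_simps)
      moreover have "cnj (fst y) ^ (m - k) * cnj (snd y) ^ k =
          cnj c ^ m * (cnj (fst x) ^ (m - k) * cnj (snd x) ^ k)"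
      proof -
        have "cnj c ^ m = cnj c ^ (m - k) * cnj c ^ k"
          using \<open>k \<le> m\<close> by (simp flip: power_add)
        then show ?thesis
          by (simp add: c scale_pair_def power_mult_distrib algebra_simps)
      qed
      ultimately show ?thesis
        using c N0[of x] by (simp add: F_def power_mult_distrib field_simps)
    qed
    have f_eq: "f k (hpoint x) = F k x" if "x \<noteq> 0" "k \<le> m" for k x
    proof -
      have "proportional x x"
        using that by (auto simp: proportional_def scale_pair_def intro!: exI[of _ 1])
      then have "proportional x (rep_cproj (hpoint x))"
        unfolding hpoint_def by (rule rep_abs_rsp[OF Quotient3_cproj])
      then show ?thesis using inv that unfolding f_def by blast
    qed
    have cnj_smooth: "C_inf cnj" and id_smooth: "C_inf (\<lambda>z. z)"
      by (intro C_inf_bounded_linear bounded_linear_cnj bounded_linear_ident)+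
    have "smooth_function (f k)" if k: "k \<le> m" for k
    proof -
      have nz: "(1, z) \<noteq> (0 :: complex \<times> complex)" "(z, 1) \<noteq> (0 :: complex \<times> complex)"
        for z :: complex
        by (auto simp: zero_prod_def)
      have "C_inf (\<lambda>z. F k (1, z))" "C_inf (\<lambda>w. F k (w, 1))"
        unfolding F_def N_def fst_conv snd_conv complex_cnj_one
        using \<xi> N0[OF nz(1)] N0[OF nz(2)]
        unfolding smooth_sections_def mem_Collect_eq N_def fst_conv snd_conv complex_cnj_one
        by (intro C_inf_mult C_inf_inverse C_inf_power C_inf_const C_inf_add
              cnj_smooth id_smooth power_not_zero; blast)+
      then show ?thesis
        unfolding smooth_function_def by (simp add: f_eq nz k)
    qed
    moreover have "\<xi> x = (\<Sum>k\<le>m. tensor_mono m k (f k) x)" if x: "x \<noteq> 0" for x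
    proof -
      have "(\<Sum>k\<le>m. tensor_mono m k (f k) x) =
            (\<Sum>k\<le>m. \<xi> x * inverse (N x ^ m) * (of_nat (m choose k) *
               (snd x * cnj (snd x)) ^ k * (fst x * cnj (fst x)) ^ (m - k)))"
        by (rule sum.cong)
           (simp_all add: tensor_mono_def f_eq x F_def power_mult_distrib mult_ac)
      also have "\<dots> = \<xi> x * inverse (N x ^ m) * N x ^ m"
        unfolding sum_distrib_left[symmetric] binomial_ring[symmetric]
        by (simp add: N_def add.commute)
      also have "\<dots> = \<xi> x" using N0[OF x] by simp
      finally show ?thesis by simp
    qed
    ultimately show ?thesis by blast
  qed
  then have dec: "\<exists>\<eta> f. (\<forall>k\<le>m. smooth_function (f k)) \<and>
        (\<forall>x. x \<noteq> 0 \<longrightarrow> \<xi> x = (\<Sum>k\<le>m. tensor_mono m k (f k) x)) \<and>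
        \<eta> = (\<lambda>x. \<Sum>k\<le>m. tensor_mono m k (laplace_coeff m k (f k)) x)"
    if "\<xi> \<in> smooth_sections m" for \<xi>
    using that by simp
  show ?thesis
  proof (intro equalityI subsetI)
    fix X assume "X \<in> Domain (laplacian m)"
    then obtain Y where "(X, Y) \<in> laplacian m" by (rule DomainE)
    then obtain \<xi> where "X = ae_class m \<xi>" "\<xi> \<in> smooth_sections m"
      unfolding laplacian_def mem_Collect_eq prod.inject by (elim exE conjE)
    then show "X \<in> ae_class m ` smooth_sections m" by (rule image_eqI)
  next
    fix X assume "X \<in> ae_class m ` smooth_sections m"
    then obtain \<xi> where X: "X = ae_class m \<xi>" and \<xi>: "\<xi> \<in> smooth_sections m"
      by (rule imageE)
    from dec[OF \<xi>] obtain \<eta> f where f: "\<forall>k\<le>m. smooth_function (f k)"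
        "\<forall>x. x \<noteq> 0 \<longrightarrow> \<xi> x = (\<Sum>k\<le>m. tensor_mono m k (f k) x)"
        "\<eta> = (\<lambda>x. \<Sum>k\<le>m. tensor_mono m k (laplace_coeff m k (f k)) x)"
      by (elim exE conjE)
    have "(X, ae_class m \<eta>) \<in> laplacian m"
      unfolding laplacian_def mem_Collect_eq X
      by (intro exI conjI) (rule refl \<xi> f)+
    then show "X \<in> Domain (laplacian m)" by (rule DomainI)
  qed
qed

end

theory Submission
  imports Defs "HOL-Probability.Sinc_Integral"
begin

text \<open>
  The Laplacian is a densely defined, symmetric and positive operator, so it has a
  Friedrichs extension, which is self-adjoint and positive; and self-adjoint operators are
  always maximal (lemma \<open>self_adjoint_imp_maximal\<close>).

  Symmetry and positivity are the point, because the metrics are not smooth along the unit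
  circle and the Laplacian is only defined off it. The metrics are flat on the two discs that
  the circle bounds. There the Laplacian of a smooth section is
  \<open>- \<partial>\<^sup>2/\<partial>z \<partial>(cnj z)\<close> in the trivialization of the respective chart
  (\<open>lap\<close>, \<open>laplacian_subset\<close>), whatever decomposition \<open>\<Sum> f\<^sub>k \<otimes> z ^ k\<close> is used. It jumps
  across the circle, but the metrics themselves are continuous. So the (0,1)-form that pairs
  the antiholomorphic derivative of one section with another section is continuous, and
  Stokes' theorem on the sphere (\<open>stokes_sphere\<close>) has no contribution from the circle. This
  gives \<open>(\<Delta> \<xi>, \<eta>) = (1/\<pi>) \<integral> energy_density \<xi> \<eta>\<close> (\<open>L2_inner_lap\<close>), a form that is
  visibly hermitian and positive.

  Two facts about \<open>H\<^sup>(\<^sup>m\<^sup>)\<close> remain. It is a Hilbert space (\<open>Hilb_complex_hilbert\<close>), by the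
  Riesz-Fischer theorem for the finite measure of the canonical form. And the discontinuous
  sections \<open>lap m \<xi>\<close> are limits of smooth sections (\<open>lap_L2_closure\<close>), so the operator takes
  its values in \<open>H\<^sup>(\<^sup>m\<^sup>)\<close>.

  The Friedrichs extension is built without completing the form domain as a space of its own:
  it is the adjoint restricted to the limits of sequences that are Cauchy for the form. Solving
  \<open>(1 + Q) x = f\<close> by minimizing a quadratic functional (\<open>friedrichs_surj\<close>) shows that it is
  self-adjoint.
\<close>

section \<open>The Friedrichs extension\<close>

lemma cmod_sq: "(cmod c)\<^sup>2 = Re c * Re c + Im c * Im c"
  unfolding cmod_power2 by (simp add: power2_eq_square)

text \<open>Every Cauchy-Schwarz argument below, and the Euler-Lagrange equation of the variational
  problem, reduces to this discriminant estimate: minimize over the phase and the modulus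
  of \<open>c\<close>.\<close>

lemma cmod_sq_le_of_quadratic:
  fixes A C :: real and b :: complex
  assumes nonneg: "\<And>c. 0 \<le> A + 2 * Re (c * b) + (cmod c)\<^sup>2 * C" and C: "0 \<le> C"
  shows "(cmod b)\<^sup>2 \<le> A * C"
proof (cases "C = 0")
  case True
  have "0 \<le> A - 2 * t * (cmod b)\<^sup>2" for t
    using nonneg[of "- of_real t * cnj b"] True
    by (simp add: cmod_sq algebra_simps)
  from this[of "(A + 1) / (2 * (cmod b)\<^sup>2)"] have "b = 0"
    by (cases "b = 0") auto
  with True show ?thesis by simp
next
  case False
  have "Re (- cnj b / of_real C * b) = - ((cmod b)\<^sup>2 / C)"
    using cmod_sq[of b] by (simp add: add_divide_distrib diff_divide_distrib)
  moreover have "(cmod (- cnj b / of_real C))\<^sup>2 * C = (cmod b)\<^sup>2 / C"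
    using False C by (simp add: norm_divide power_divide power2_eq_square)
  ultimately have "0 \<le> A - (cmod b)\<^sup>2 / C"
    using nonneg[of "- cnj b / of_real C"] by linarith
  then show ?thesis using False C by (simp add: field_simps)
qed

text \<open>Linearity and hermitian symmetry of the inner product, together with definiteness of the
  distance, already force all vector space laws: two vectors with the same inner products
  are equal. So the laws of addition and scaling do not appear among the axioms, and an
  instance has to verify nothing about its addition except how the inner product sees it.\<close>

locale complex_hilbert =
  fixes H :: "'v ip_space"
  assumes add_closed [simp]: "\<lbrakk>x \<in> carr H; y \<in> carr H\<rbrakk> \<Longrightarrow> vadd H x y \<in> carr H"
    and scale_closed [simp]: "x \<in> carr H \<Longrightarrow> vscale H c x \<in> carr H"
    and inn_add [simp]: "\<lbrakk>x \<in> carr H; y \<in> carr H; z \<in> carr H\<rbrakk>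
      \<Longrightarrow> inn H (vadd H x y) z = inn H x z + inn H y z"
    and inn_scale [simp]: "\<lbrakk>x \<in> carr H; z \<in> carr H\<rbrakk> \<Longrightarrow> inn H (vscale H c x) z = c * inn H x z"
    and inn_sym: "\<lbrakk>x \<in> carr H; y \<in> carr H\<rbrakk> \<Longrightarrow> inn H y x = cnj (inn H x y)"
    and inn_nonneg: "x \<in> carr H \<Longrightarrow> 0 \<le> Re (inn H x x)"
    and definite: "\<lbrakk>x \<in> carr H; y \<in> carr H;
      Re (inn H (vadd H x (vscale H (-1) y)) (vadd H x (vscale H (-1) y))) = 0\<rbrakk> \<Longrightarrow> x = y"
    and complete: "\<And>s. \<lbrakk>\<And>n::nat. s n \<in> carr H;
      \<And>e. e > 0 \<Longrightarrow> \<exists>N. \<forall>i\<ge>N. \<forall>j\<ge>N.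
         Re (inn H (vadd H (s i) (vscale H (-1) (s j))) (vadd H (s i) (vscale H (-1) (s j)))) < e\<rbrakk>
      \<Longrightarrow> \<exists>x\<in>carr H. (\<lambda>n. Re (inn H (vadd H (s n) (vscale H (-1) x))
             (vadd H (s n) (vscale H (-1) x)))) \<longlonglongrightarrow> 0"
begin

abbreviation ip :: "'v \<Rightarrow> 'v \<Rightarrow> complex" (infixl "\<sqdot>" 70) where "x \<sqdot> y \<equiv> inn H x y"
abbreviation plus_H :: "'v \<Rightarrow> 'v \<Rightarrow> 'v" (infixl "\<oplus>" 65) where "x \<oplus> y \<equiv> vadd H x y"
abbreviation scale_H :: "complex \<Rightarrow> 'v \<Rightarrow> 'v" (infixr "\<odot>" 75) where "c \<odot> x \<equiv> vscale H c x"
abbreviation minus_H :: "'v \<Rightarrow> 'v \<Rightarrow> 'v" (infixl "\<ominus>" 65) where "x \<ominus> y \<equiv> x \<oplus> (-1) \<odot> y"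
abbreviation sq_norm :: "'v \<Rightarrow> real" where "sq_norm x \<equiv> Re (x \<sqdot> x)"

lemma inn_add_right [simp]:
  "\<lbrakk>x \<in> carr H; y \<in> carr H; z \<in> carr H\<rbrakk> \<Longrightarrow> z \<sqdot> (x \<oplus> y) = z \<sqdot> x + z \<sqdot> y"
  by (subst (1 2 3) inn_sym) auto

lemma inn_scale_right [simp]:
  "\<lbrakk>x \<in> carr H; z \<in> carr H\<rbrakk> \<Longrightarrow> z \<sqdot> (c \<odot> x) = cnj c * (z \<sqdot> x)"
  by (subst (1 2) inn_sym) auto

lemma Re_inn_sym: "\<lbrakk>x \<in> carr H; y \<in> carr H\<rbrakk> \<Longrightarrow> Re (y \<sqdot> x) = Re (x \<sqdot> y)"
  by (subst inn_sym) auto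

lemma Im_inn_self [simp]: "x \<in> carr H \<Longrightarrow> Im (x \<sqdot> x) = 0"
  using arg_cong[OF inn_sym[of x x], of Im] by simp

lemma inn_separates:
  assumes "x \<in> carr H" "y \<in> carr H" "\<And>z. z \<in> carr H \<Longrightarrow> x \<sqdot> z = y \<sqdot> z"
  shows "x = y"
  by (rule definite) (use assms in simp_all)

lemma cauchy_schwarz:
  assumes "x \<in> carr H" "y \<in> carr H"
  shows "(cmod (x \<sqdot> y))\<^sup>2 \<le> sq_norm x * sq_norm y"
proof (rule cmod_sq_le_of_quadratic)
  fix c
  have "sq_norm (x \<oplus> cnj c \<odot> y) = sq_norm x + 2 * Re (c * (x \<sqdot> y)) + (cmod c)\<^sup>2 * sq_norm y"
    using assms inn_sym[of x y]
    by (simp add: cmod_sq algebra_simps)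
  then show "0 \<le> sq_norm x + 2 * Re (c * (x \<sqdot> y)) + (cmod c)\<^sup>2 * sq_norm y"
    using inn_nonneg[of "x \<oplus> cnj c \<odot> y"] assms by simp
qed (use assms inn_nonneg in auto)

definition converges :: "(nat \<Rightarrow> 'v) \<Rightarrow> 'v \<Rightarrow> bool" where
  "converges s x \<longleftrightarrow> x \<in> carr H \<and> (\<forall>n. s n \<in> carr H) \<and> (\<lambda>n. sq_norm (s n \<ominus> x)) \<longlonglongrightarrow> 0"

lemma converges_inn:
  assumes s: "converges s x" and y: "y \<in> carr H"
  shows "(\<lambda>n. s n \<sqdot> y) \<longlonglongrightarrow> x \<sqdot> y"
proof -
  have c: "x \<in> carr H" "s n \<in> carr H" for n using s by (auto simp: converges_def)
  have sq: "(\<lambda>n. (cmod ((s n \<ominus> x) \<sqdot> y))\<^sup>2) \<longlonglongrightarrow> 0"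
  proof (rule tendsto_sandwich[OF _ _ tendsto_const])
    show "(\<lambda>n. sq_norm (s n \<ominus> x) * sq_norm y) \<longlonglongrightarrow> 0"
      using s unfolding converges_def by (intro tendsto_mult_left_zero) blast
    show "\<forall>\<^sub>F n in sequentially. (cmod ((s n \<ominus> x) \<sqdot> y))\<^sup>2 \<le> sq_norm (s n \<ominus> x) * sq_norm y"
      by (intro always_eventually allI cauchy_schwarz add_closed scale_closed c y)
  qed simp
  have eq: "(s n \<ominus> x) \<sqdot> y = s n \<sqdot> y - x \<sqdot> y" for n by (simp add: c y)
  from tendsto_real_sqrt[OF sq] have "(\<lambda>n. cmod (s n \<sqdot> y - x \<sqdot> y)) \<longlonglongrightarrow> 0"
    unfolding eq by simp
  then have "(\<lambda>n. s n \<sqdot> y - x \<sqdot> y) \<longlonglongrightarrow> 0"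
    by (rule tendsto_norm_zero_cancel)
  then show ?thesis by (rule LIM_zero_cancel)
qed

lemma converges_inn_right:
  assumes "converges s x" "y \<in> carr H"
  shows "(\<lambda>n. y \<sqdot> s n) \<longlonglongrightarrow> y \<sqdot> x"
proof -
  have "(\<lambda>n. cnj (s n \<sqdot> y)) \<longlonglongrightarrow> cnj (x \<sqdot> y)"
    using converges_inn[OF assms] by (rule tendsto_cnj)
  moreover have "cnj (s n \<sqdot> y) = y \<sqdot> s n" for n
    by (rule inn_sym[symmetric]) (use assms in \<open>auto simp: converges_def\<close>)
  moreover have "cnj (x \<sqdot> y) = y \<sqdot> x"
    by (rule inn_sym[symmetric]) (use assms in \<open>auto simp: converges_def\<close>)
  ultimately show ?thesis by simp
qed

text \<open>The difference of the two vectors is orthogonal to a dense set, so to itself.\<close>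

lemma orthogonal_dense:
  assumes dense: "densely_defined H T" "Domain T \<subseteq> carr H"
    and x: "x \<in> carr H" "y \<in> carr H" "\<And>z. z \<in> Domain T \<Longrightarrow> z \<sqdot> x = z \<sqdot> y"
  shows "x = y"
proof -
  let ?d = "x \<ominus> y"
  have d: "?d \<in> carr H" using x by simp
  have "\<exists>z\<in>Domain T. sq_norm (?d \<ominus> z) < inverse (real (Suc n))" for n
  proof -
    have "0 < sqrt (inverse (real (Suc n)))" by simp
    then obtain z where z: "z \<in> Domain T" "vdist H ?d z < sqrt (inverse (real (Suc n)))"
      using dense(1) d unfolding densely_defined_def by blast
    from z(2) have "sq_norm (?d \<ominus> z) < inverse (real (Suc n))"
      unfolding vdist_def Let_def real_sqrt_less_iff .
    with z(1) show ?thesis by blast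
  qed
  then obtain s where s: "\<And>n. s n \<in> Domain T" "\<And>n. sq_norm (?d \<ominus> s n) < inverse (real (Suc n))"
    by metis
  have sc: "s n \<in> carr H" for n using s dense by auto
  have eq: "sq_norm (s n \<ominus> ?d) = sq_norm (?d \<ominus> s n)" for n
    by (simp add: sc x(1,2))
  have "converges s ?d"
    unfolding converges_def eq
  proof (intro conjI allI sc d real_tendsto_sandwich[OF _ _ tendsto_const LIMSEQ_inverse_real_of_nat]
      eventuallyI less_imp_le[OF s(2)])
    show "0 \<le> sq_norm (?d \<ominus> s n)" for n
      by (intro inn_nonneg add_closed scale_closed d sc)
  qed
  from converges_inn[OF this d] have "(\<lambda>n. s n \<sqdot> ?d) \<longlonglongrightarrow> ?d \<sqdot> ?d" .
  moreover have "s n \<sqdot> ?d = 0" for n by (simp add: x(1,2) sc x(3)[OF s(1)])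
  ultimately have "?d \<sqdot> ?d = 0" by (simp only: LIMSEQ_const_iff)
  then have "sq_norm ?d = 0" by (simp only: zero_complex.sel)
  then show ?thesis by (rule definite[OF x(1,2)])
qed

end

locale positive_symmetric = complex_hilbert +
  fixes T
  assumes T_carr: "T \<subseteq> carr H \<times> carr H"
    and T_nonempty: "T \<noteq> {}"
    and T_add: "\<lbrakk>(x, v) \<in> T; (y, w) \<in> T\<rbrakk> \<Longrightarrow> (x \<oplus> y, v \<oplus> w) \<in> T"
    and T_scale: "(x, v) \<in> T \<Longrightarrow> (c \<odot> x, c \<odot> v) \<in> T"
    and T_dense: "densely_defined H T"
    and T_sym: "\<lbrakk>(x, v) \<in> T; (y, w) \<in> T\<rbrakk> \<Longrightarrow> v \<sqdot> y = x \<sqdot> w"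
    and T_pos: "(x, v) \<in> T \<Longrightarrow> 0 \<le> Re (v \<sqdot> x)"
begin

lemma T_mem [simp]: "(x, v) \<in> T \<Longrightarrow> x \<in> carr H" "(x, v) \<in> T \<Longrightarrow> v \<in> carr H"
  using T_carr by auto

lemma T_diff: "\<lbrakk>(x, v) \<in> T; (y, w) \<in> T\<rbrakk> \<Longrightarrow> (x \<ominus> y, v \<ominus> w) \<in> T"
  by (intro T_add T_scale)

lemma form_cauchy_schwarz:
  assumes "(x, v) \<in> T" "(y, w) \<in> T"
  shows "(cmod (v \<sqdot> y))\<^sup>2 \<le> Re (v \<sqdot> x) * Re (w \<sqdot> y)"
proof (rule cmod_sq_le_of_quadratic)
  fix c
  have "w \<sqdot> x = cnj (v \<sqdot> y)"
    using T_sym[OF assms] inn_sym[of x w] assms by auto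
  moreover have "w \<sqdot> y = cnj (w \<sqdot> y)"
    using T_sym[OF assms(2) assms(2)] inn_sym[of w y] assms by auto
  then have "Im (w \<sqdot> y) = 0" by (simp add: complex_eq_iff)
  ultimately have "Re ((v \<oplus> cnj c \<odot> w) \<sqdot> (x \<oplus> cnj c \<odot> y)) =
      Re (v \<sqdot> x) + 2 * Re (c * (v \<sqdot> y)) + (cmod c)\<^sup>2 * Re (w \<sqdot> y)"
    using assms T_mem[OF assms(1)] T_mem[OF assms(2)]
    by (simp add: cmod_sq algebra_simps)
  then show "0 \<le> Re (v \<sqdot> x) + 2 * Re (c * (v \<sqdot> y)) + (cmod c)\<^sup>2 * Re (w \<sqdot> y)"
    using T_pos[OF T_add[OF assms(1) T_scale[OF assms(2)]], of "cnj c"] by simp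
qed (use assms T_pos in auto)

text \<open>A vector with an approximating sequence lies in the closure of the domain of \<open>T\<close> for the
  form norm; the form is kept as the pairing of the values \<open>t\<close> of \<open>T\<close> with the arguments
  \<open>s\<close>, so that its closure never has to be constructed as a space.\<close>

definition approximates :: "(nat \<Rightarrow> 'a) \<Rightarrow> (nat \<Rightarrow> 'a) \<Rightarrow> 'a \<Rightarrow> bool" where
  "approximates s t x \<longleftrightarrow> (\<forall>n. (s n, t n) \<in> T) \<and> converges s x \<and>
     (\<forall>e>0. \<exists>N. \<forall>i\<ge>N. \<forall>j\<ge>N. Re ((t i \<ominus> t j) \<sqdot> (s i \<ominus> s j)) < e)"

text \<open>The domain of the Friedrichs extension is the intersection of the form domain with the
  domain of the adjoint, and the operator is the restriction of the adjoint.\<close>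

definition friedrichs :: "('a \<times> 'a) set" where
  "friedrichs = {(x, w) \<in> adjoint_graph H T. \<exists>s t. approximates s t x}"

lemma approximates_energy_bounded:
  assumes "approximates s t x"
  obtains B where "B > 0" "\<And>n. Re (t n \<sqdot> s n) \<le> B"
proof -
  have m: "(s n, t n) \<in> T" for n using assms by (auto simp: approximates_def)
  obtain N where N: "\<And>i j. \<lbrakk>i \<ge> N; j \<ge> N\<rbrakk> \<Longrightarrow> Re ((t i \<ominus> t j) \<sqdot> (s i \<ominus> s j)) < 1"
    using assms unfolding approximates_def by (metis zero_less_one)
  have two: "Re (t n \<sqdot> s n) \<le> 2 * Re ((t n \<ominus> t N) \<sqdot> (s n \<ominus> s N)) + 2 * Re (t N \<sqdot> s N)" for n
  proof -
    have "0 \<le> Re ((t n \<ominus> 2 \<odot> t N) \<sqdot> (s n \<ominus> 2 \<odot> s N))"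
      by (intro T_pos T_diff T_scale m)
    then show ?thesis using T_mem[OF m[of n]] T_mem[OF m[of N]] by (simp add: algebra_simps)
  qed
  define B where "B = 2 + 2 * Re (t N \<sqdot> s N) + (\<Sum>n<N. Re (t n \<sqdot> s n))"
  have sum0: "0 \<le> (\<Sum>n<N. Re (t n \<sqdot> s n))" by (intro sum_nonneg T_pos m)
  have "B > 0" using sum0 T_pos[OF m[of N]] by (simp add: B_def)
  moreover have "Re (t n \<sqdot> s n) \<le> B" for n
  proof (cases "n < N")
    case True
    then have "Re (t n \<sqdot> s n) \<le> (\<Sum>n<N. Re (t n \<sqdot> s n))"
      by (intro member_le_sum T_pos m) auto
    then show ?thesis using T_pos[OF m[of N]] by (simp add: B_def)
  next
    case False
    then show ?thesis using two[of n] N[of n N] sum0 by (simp add: B_def)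
  qed
  ultimately show ?thesis by (rule that)
qed

text \<open>On the form domain the adjoint is given by the form. The error
  \<open>w \<sqdot> s' n - t n \<sqdot> s' n\<close> equals \<open>(x - s n) \<sqdot> t' n\<close>, the limit in \<open>i\<close> of the form of
  \<open>s i - s n\<close> and \<open>s' n\<close>. Cauchy-Schwarz for the form bounds it by a Cauchy tail times
  a bounded energy. Symmetry and positivity of the extension follow, since both hold along
  the approximating sequences.\<close>

lemma adjoint_form_limit:
  assumes xw: "(x, w) \<in> adjoint_graph H T"
    and x: "approximates s t x" and y: "approximates s' t' y"
  shows "(\<lambda>n. t n \<sqdot> s' n) \<longlonglongrightarrow> w \<sqdot> y"
proof -
  have m: "(s n, t n) \<in> T" "(s' n, t' n) \<in> T" for n using x y by (auto simp: approximates_def)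
  note c = T_mem[OF m(1)] T_mem[OF m(2)]
  have conv: "converges s x" "converges s' y" using x y by (auto simp: approximates_def)
  have w: "w \<in> carr H" "x \<in> carr H" using xw by (auto simp: adjoint_graph_def)
  obtain B where B: "B > 0" "\<And>n. Re (t' n \<sqdot> s' n) \<le> B"
    by (rule approximates_energy_bounded[OF y]) blast
  have eq: "w \<sqdot> s' n - t n \<sqdot> s' n = x \<sqdot> t' n - s n \<sqdot> t' n" for n
  proof -
    have "t' n \<sqdot> x = s' n \<sqdot> w" using xw m(2)[of n] by (auto simp: adjoint_graph_def)
    then have "w \<sqdot> s' n = x \<sqdot> t' n"
      using inn_sym[of "t' n" x] inn_sym[of "s' n" w] w c by auto
    moreover have "t n \<sqdot> s' n = s n \<sqdot> t' n" by (rule T_sym[OF m])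
    ultimately show ?thesis by simp
  qed
  have "(\<lambda>n. w \<sqdot> s' n - t n \<sqdot> s' n) \<longlonglongrightarrow> 0"
  proof (rule LIMSEQ_I)
    fix r :: real assume r: "r > 0"
    define e where "e = r\<^sup>2 / (4 * B)"
    have e: "e > 0" using r B by (simp add: e_def)
    then obtain N where N: "\<And>i j. \<lbrakk>i \<ge> N; j \<ge> N\<rbrakk> \<Longrightarrow> Re ((t i \<ominus> t j) \<sqdot> (s i \<ominus> s j)) < e"
      using x unfolding approximates_def by meson
    have "norm (w \<sqdot> s' n - t n \<sqdot> s' n - 0) < r" if n: "n \<ge> N" for n
    proof -
      have bd: "(cmod (s i \<sqdot> t' n - s n \<sqdot> t' n))\<^sup>2 \<le> e * B" if i: "i \<ge> N" for i
      proof -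
        have "s i \<sqdot> t' n - s n \<sqdot> t' n = (t i \<ominus> t n) \<sqdot> s' n"
          using T_sym[OF T_diff[OF m(1)[of i] m(1)[of n]] m(2)[of n]] c by simp
        also have "(cmod \<dots>)\<^sup>2 \<le> Re ((t i \<ominus> t n) \<sqdot> (s i \<ominus> s n)) * Re (t' n \<sqdot> s' n)"
          by (rule form_cauchy_schwarz[OF T_diff[OF m(1) m(1)] m(2)])
        also have "\<dots> \<le> e * B"
          using N[OF i n] B(2)[of n] T_pos[OF m(2)[of n]] e by (intro mult_mono) auto
        finally show ?thesis .
      qed
      have "(\<lambda>i. (cmod (s i \<sqdot> t' n - s n \<sqdot> t' n))\<^sup>2) \<longlonglongrightarrow> (cmod (x \<sqdot> t' n - s n \<sqdot> t' n))\<^sup>2"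
        by (intro tendsto_intros converges_inn conv c)
      then have "(cmod (x \<sqdot> t' n - s n \<sqdot> t' n))\<^sup>2 \<le> e * B"
        by (rule LIMSEQ_le_const2) (use bd in blast)
      also have "e * B = (r / 2)\<^sup>2" using B by (simp add: e_def power2_eq_square)
      finally have "cmod (x \<sqdot> t' n - s n \<sqdot> t' n) \<le> r / 2"
        by (rule power2_le_imp_le) (use r in simp)
      then show ?thesis using r by (simp add: eq)
    qed
    then show "\<exists>N. \<forall>n\<ge>N. norm (w \<sqdot> s' n - t n \<sqdot> s' n - 0) < r" by blast
  qed
  from tendsto_diff[OF converges_inn_right[OF conv(2) w(1)] this] show ?thesis by simp
qed

lemma friedrichs_symmetric:
  assumes "(x, v) \<in> friedrichs" "(y, w) \<in> friedrichs"
  shows "v \<sqdot> y = x \<sqdot> w"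
proof -
  from assms obtain s t s' t' where
    a: "(x, v) \<in> adjoint_graph H T" "approximates s t x"
       "(y, w) \<in> adjoint_graph H T" "approximates s' t' y"
    unfolding friedrichs_def by blast
  have m: "(s n, t n) \<in> T" "(s' n, t' n) \<in> T" for n using a by (auto simp: approximates_def)
  have "(\<lambda>n. t n \<sqdot> s' n) \<longlonglongrightarrow> v \<sqdot> y" by (rule adjoint_form_limit[OF a(1,2,4)])
  moreover have "(\<lambda>n. cnj (t' n \<sqdot> s n)) \<longlonglongrightarrow> cnj (w \<sqdot> x)"
    by (intro tendsto_cnj adjoint_form_limit[OF a(3,4,2)])
  moreover have "cnj (t' n \<sqdot> s n) = t n \<sqdot> s' n" for n
    using T_sym[OF m(1)[of n] m(2)[of n]] inn_sym[of "t' n" "s n"] T_mem[OF m(1)[of n]] T_mem[OF m(2)[of n]]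
    by auto
  moreover have "cnj (w \<sqdot> x) = x \<sqdot> w"
    using a inn_sym[of w x] by (auto simp: adjoint_graph_def)
  ultimately show ?thesis using LIMSEQ_unique by force
qed

lemma friedrichs_positive:
  assumes "(x, v) \<in> friedrichs"
  shows "0 \<le> Re (v \<sqdot> x)"
proof -
  from assms obtain s t where a: "(x, v) \<in> adjoint_graph H T" "approximates s t x"
    unfolding friedrichs_def by blast
  have "(\<lambda>n. Re (t n \<sqdot> s n)) \<longlonglongrightarrow> Re (v \<sqdot> x)"
    by (intro tendsto_Re adjoint_form_limit[OF a(1,2,2)])
  then show ?thesis
    by (rule LIMSEQ_le_const) (use a T_pos in \<open>auto simp: approximates_def\<close>)
qed

lemma extends: "T \<subseteq> friedrichs"
proof clarify
  fix x v assume xv: "(x, v) \<in> T"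
  have "(x, v) \<in> adjoint_graph H T"
    unfolding adjoint_graph_def using xv T_sym[OF _ xv] by auto
  moreover have "approximates (\<lambda>_. x) (\<lambda>_. v) x"
    using xv unfolding approximates_def converges_def by auto
  ultimately show "(x, v) \<in> friedrichs" unfolding friedrichs_def by blast
qed

text \<open>\<open>1 + friedrichs\<close> is onto: a solution of \<open>w + x = f\<close> minimizes
  \<open>|x|\<^sup>2 + (T x, x) - 2 Re (x, f)\<close>. The parallelogram law makes every minimizing sequence
  Cauchy in the form norm, so its limit lies in the form domain; the vanishing of the first
  variation along the domain of \<open>T\<close> says that the limit lies in the domain of the adjoint and
  has the image \<open>f - x\<close>.\<close>

lemma friedrichs_surj:
  assumes f: "f \<in> carr H"
  obtains x w where "(x, w) \<in> friedrichs" "f = w \<oplus> x"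
proof -
  define J where "J = (\<lambda>(x, v). sq_norm x + Re (v \<sqdot> x) - 2 * Re (x \<sqdot> f))"
  have J_lower: "- sq_norm f \<le> J p" if "p \<in> T" for p
  proof -
    obtain x v where p: "p = (x, v)" by (cases p)
    have "0 \<le> sq_norm (x \<ominus> f)" using that p f by (intro inn_nonneg) auto
    also have "\<dots> = sq_norm x - 2 * Re (x \<sqdot> f) + sq_norm f"
      using that p f Re_inn_sym[of x f] by (auto simp: algebra_simps)
    finally show ?thesis using that p T_pos[of x v] by (simp add: J_def)
  qed
  define I where "I = Inf (J ` T)"
  have bdd: "bdd_below (J ` T)" using J_lower by (intro bdd_belowI2)
  have I: "I \<le> J p" if "p \<in> T" for p
    unfolding I_def using that by (intro cInf_lower bdd imageI)
  have "\<exists>p\<in>T. J p < I + inverse (real (Suc n))" for n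
  proof -
    have "Inf (J ` T) < I + inverse (real (Suc n))" by (simp add: I_def)
    then show ?thesis using T_nonempty by (subst (asm) cInf_less_iff) (auto simp: bdd)
  qed
  then obtain p where p: "\<And>n. p n \<in> T" "\<And>n. J (p n) < I + inverse (real (Suc n))"
    by metis
  define s t where "s n = fst (p n)" and "t n = snd (p n)" for n
  have m: "(s n, t n) \<in> T" and Jst: "J (s n, t n) < I + inverse (real (Suc n))" for n
    using p[of n] by (auto simp: s_def t_def)
  note c = T_mem[OF m]
  \<comment> \<open>The midpoint of two nearly minimizing points cannot go below the infimum.\<close>
  have par: "sq_norm (s i \<ominus> s j) + Re ((t i \<ominus> t j) \<sqdot> (s i \<ominus> s j)) \<le>
      2 * inverse (real (Suc i)) + 2 * inverse (real (Suc j))" for i j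
  proof -
    have "((1/2) \<odot> (s i \<oplus> s j), (1/2) \<odot> (t i \<oplus> t j)) \<in> T"
      by (intro T_scale T_add m)
    from I[OF this] have "4 * I \<le> sq_norm (s i \<oplus> s j) + Re ((t i \<oplus> t j) \<sqdot> (s i \<oplus> s j))
        - 4 * Re ((s i \<oplus> s j) \<sqdot> f)"
      using c f by (simp add: J_def algebra_simps)
    moreover have "sq_norm (s i \<ominus> s j) + Re ((t i \<ominus> t j) \<sqdot> (s i \<ominus> s j)) =
       2 * J (s i, t i) + 2 * J (s j, t j) - (sq_norm (s i \<oplus> s j) + Re ((t i \<oplus> t j) \<sqdot> (s i \<oplus> s j))
        - 4 * Re ((s i \<oplus> s j) \<sqdot> f))"
      using c f by (simp add: J_def algebra_simps)
    ultimately show ?thesis using Jst[of i] Jst[of j] by simp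
  qed
  have small: "\<exists>N. \<forall>i\<ge>N. \<forall>j\<ge>N. 2 * inverse (real (Suc i)) + 2 * inverse (real (Suc j)) < e"
    if e: "e > 0" for e
  proof -
    obtain N where N: "inverse (real (Suc N)) < e / 4"
      using reals_Archimedean[of "e / 4"] e by auto
    have *: "inverse (real (Suc i)) < e / 4" if "i \<ge> N" for i
      using that N by (smt (verit) inverse_le_iff_le of_nat_0_less_iff of_nat_le_iff zero_less_Suc Suc_le_mono)
    have "2 * inverse (real (Suc i)) + 2 * inverse (real (Suc j)) < e" if "i \<ge> N" "j \<ge> N" for i j
      using *[OF that(1)] *[OF that(2)] by linarith
    then show ?thesis by blast
  qed
  have cauchy_form: "\<exists>N. \<forall>i\<ge>N. \<forall>j\<ge>N. Re ((t i \<ominus> t j) \<sqdot> (s i \<ominus> s j)) < e" if "e > 0" for e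
    using small[OF that] par inn_nonneg[OF add_closed[OF c(1) scale_closed[OF c(1)]]]
    by (smt (verit))
  have "\<exists>N. \<forall>i\<ge>N. \<forall>j\<ge>N. sq_norm (s i \<ominus> s j) < e" if "e > 0" for e
    using small[OF that] par T_pos[OF T_diff[OF m m]] by (smt (verit))
  then obtain x where x: "converges s x"
    using complete[of s] c unfolding converges_def by blast
  then have xc: "x \<in> carr H" by (simp add: converges_def)
  have app: "approximates s t x"
    unfolding approximates_def using x m cauchy_form by blast
  \<comment> \<open>\<open>2 Re (a * b n)\<close> is the first variation of \<open>J\<close> at \<open>s n\<close> in the direction \<open>cnj a \<odot> y\<close>.\<close>
  have euler: "w \<sqdot> x = y \<sqdot> (f \<ominus> x)" if yw: "(y, w) \<in> T" for y w
  proof -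
    note yc = T_mem[OF yw]
    define b where "b n = s n \<sqdot> y + s n \<sqdot> w - f \<sqdot> y" for n
    define N where "N = sq_norm y + Re (w \<sqdot> y)"
    have N0: "0 \<le> N" using inn_nonneg yc T_pos[OF yw] by (simp add: N_def)
    have bn: "(cmod (b n))\<^sup>2 \<le> inverse (real (Suc n)) * N" for n
    proof (rule cmod_sq_le_of_quadratic[OF _ N0])
      fix a
      have mem: "(s n \<oplus> cnj a \<odot> y, t n \<oplus> cnj a \<odot> w) \<in> T" by (intro T_add T_scale m yw)
      have ims: "Im (w \<sqdot> y) = 0"
        using T_sym[OF yw yw] inn_sym[of w y] yc by (auto simp: complex_eq_iff)
      have "J (s n \<oplus> cnj a \<odot> y, t n \<oplus> cnj a \<odot> w) =
          J (s n, t n) + 2 * Re (a * b n) + (cmod a)\<^sup>2 * N"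
        using c[of n] yc f T_sym[OF m[of n] yw] inn_sym[of "s n" y] inn_sym[of "s n" w]
          inn_sym[of f y] ims
        by (simp add: J_def b_def N_def cmod_sq algebra_simps)
      then show "0 \<le> inverse (real (Suc n)) + 2 * Re (a * b n) + (cmod a)\<^sup>2 * N"
        using I[OF mem] Jst[of n] by simp
    qed
    have sq: "(\<lambda>n. (cmod (b n))\<^sup>2) \<longlonglongrightarrow> 0"
      by (rule tendsto_sandwich[OF _ _ tendsto_const
            tendsto_mult_left_zero[OF LIMSEQ_inverse_real_of_nat, of N]]) (use bn in auto)
    have "b \<longlonglongrightarrow> 0"
      using tendsto_real_sqrt[OF sq] by (simp add: tendsto_norm_zero_iff)
    moreover have "b \<longlonglongrightarrow> x \<sqdot> y + x \<sqdot> w - f \<sqdot> y"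
      unfolding b_def by (intro tendsto_intros converges_inn x yc)
    ultimately have "x \<sqdot> y + x \<sqdot> w - f \<sqdot> y = 0" using LIMSEQ_unique by blast
    then have "x \<sqdot> w = f \<sqdot> y - x \<sqdot> y" by (simp add: algebra_simps)
    then have "cnj (x \<sqdot> w) = cnj (f \<sqdot> y - x \<sqdot> y)" by (rule arg_cong)
    then show ?thesis
      using inn_sym[of x w] inn_sym[of f y] inn_sym[of x y] xc yc f by simp
  qed
  have "(x, f \<ominus> x) \<in> friedrichs"
    unfolding friedrichs_def adjoint_graph_def using euler app xc f by auto
  moreover have "f = (f \<ominus> x) \<oplus> x"
    by (rule inn_separates) (use f xc in auto)
  ultimately show ?thesis by (rule that)
qed

lemma friedrichs_carr: "friedrichs \<subseteq> carr H \<times> carr H"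
  by (auto simp: friedrichs_def adjoint_graph_def)

lemma friedrichs_dense: "densely_defined H friedrichs"
  using T_dense extends unfolding densely_defined_def by (meson Domain_mono subsetD)

text \<open>A symmetric operator \<open>Q\<close> with \<open>1 + Q\<close> onto is self-adjoint: if \<open>y\<close> lies in the domain of
  the adjoint with image \<open>w\<close>, choose \<open>x\<close> with \<open>(1 + Q) x = w + y\<close>; then \<open>y\<close> and \<open>x\<close> have the
  same inner products with the range of \<open>1 + Q\<close>.\<close>

lemma adjoint_friedrichs: "adjoint_graph H friedrichs = friedrichs"
proof (intro equalityI subsetI)
  fix p assume "p \<in> friedrichs"
  then show "p \<in> adjoint_graph H friedrichs"
    using friedrichs_symmetric friedrichs_carr unfolding adjoint_graph_def
    by (cases p) blast
next
  fix p assume p: "p \<in> adjoint_graph H friedrichs"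
  then obtain y w where yw: "p = (y, w)" "y \<in> carr H" "w \<in> carr H"
      "\<And>u v. (u, v) \<in> friedrichs \<Longrightarrow> v \<sqdot> y = u \<sqdot> w"
    unfolding adjoint_graph_def by blast
  obtain x z where xz: "(x, z) \<in> friedrichs" "w \<oplus> y = z \<oplus> x"
    using friedrichs_surj[of "w \<oplus> y"] yw by auto
  have xzc: "x \<in> carr H" "z \<in> carr H" using xz friedrichs_carr by auto
  have "y = x"
  proof (rule inn_separates)
    fix g assume g: "g \<in> carr H"
    then obtain u v where uv: "(u, v) \<in> friedrichs" "g = v \<oplus> u" by (rule friedrichs_surj)
    have uvc: "u \<in> carr H" "v \<in> carr H" using uv friedrichs_carr by auto
    have "g \<sqdot> y = u \<sqdot> (w \<oplus> y)" using uv uvc yw by simp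
    also have "\<dots> = g \<sqdot> x"
      unfolding xz(2) using uv uvc xzc friedrichs_symmetric[OF uv(1) xz(1)] by simp
    finally have "cnj (g \<sqdot> y) = cnj (g \<sqdot> x)" by simp
    then show "y \<sqdot> g = x \<sqdot> g" using inn_sym[of g y] inn_sym[of g x] g yw xzc by simp
  qed (use yw xzc in auto)
  moreover have "w = z"
  proof (rule inn_separates)
    fix g assume g: "g \<in> carr H"
    have "(w \<oplus> y) \<sqdot> g = (z \<oplus> x) \<sqdot> g" using xz(2) by simp
    then show "w \<sqdot> g = z \<sqdot> g" using yw xzc g \<open>y = x\<close> by simp
  qed (use yw xzc in auto)
  ultimately show "p \<in> friedrichs" using xz yw by simp
qed

end

text \<open>An adjoint graph is closed under linear combinations, and it is single valued when the
  domain is dense. So linearity of the extension comes from \<open>Q\<^sup>* = Q\<close>, and the form domain is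
  never shown to be a subspace.\<close>

lemma (in complex_hilbert) self_adjointI:
  assumes Q: "Q \<subseteq> carr H \<times> carr H" "Q \<noteq> {}" "densely_defined H Q" "adjoint_graph H Q = Q"
  shows "self_adjoint H Q"
proof -
  have Qc: "Domain Q \<subseteq> carr H" using Q by auto
  have adjI: "(y, w) \<in> Q"
    if "y \<in> carr H" "w \<in> carr H" "\<And>x v. (x, v) \<in> Q \<Longrightarrow> v \<sqdot> y = x \<sqdot> w" for y w
  proof -
    have "(y, w) \<in> adjoint_graph H Q" using that unfolding adjoint_graph_def by blast
    then show ?thesis by (simp only: Q(4))
  qed
  have adjD: "v \<sqdot> y = x \<sqdot> w" if "(y, w) \<in> Q" "(x, v) \<in> Q" for x v y w
  proof -
    have "(y, w) \<in> adjoint_graph H Q" using that(1) by (simp only: Q(4))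
    then show ?thesis using that(2) unfolding adjoint_graph_def by blast
  qed
  have mem: "x \<in> carr H" "v \<in> carr H" if "(x, v) \<in> Q" for x v using that Q(1) by auto
  have "single_valued Q"
  proof (rule single_valuedI)
    fix y w w' assume *: "(y, w) \<in> Q" "(y, w') \<in> Q"
    show "w = w'"
    proof (rule orthogonal_dense[OF Q(3) Qc])
      fix z assume "z \<in> Domain Q"
      then obtain v where "(z, v) \<in> Q" by blast
      then show "z \<sqdot> w = z \<sqdot> w'" using adjD[OF *(1)] adjD[OF *(2)] by simp
    qed (use * mem in auto)
  qed
  moreover have "(x \<oplus> y, v \<oplus> w) \<in> Q" if "(x, v) \<in> Q" "(y, w) \<in> Q" for x y v w
    by (rule adjI) (simp_all add: mem that mem[OF that(1)] mem[OF that(2)] adjD[OF that(1)] adjD[OF that(2)])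
  moreover have "(c \<odot> x, c \<odot> v) \<in> Q" if "(x, v) \<in> Q" for c x v
    by (rule adjI) (simp_all add: mem mem[OF that] adjD[OF that])
  ultimately have "linear_operator H Q"
    using Q(1,2) unfolding linear_operator_def by blast
  with Q show ?thesis unfolding self_adjoint_def by blast
qed

text \<open>Passing to adjoints reverses inclusions, so self-adjoint operators cannot be properly
  nested.\<close>

lemma self_adjoint_imp_maximal:
  assumes "self_adjoint H Q"
  shows "maximal_self_adjoint H Q"
  unfolding maximal_self_adjoint_def
proof (intro conjI allI impI)
  fix S assume S: "self_adjoint H S" "Q \<subseteq> S"
  then have "adjoint_graph H S \<subseteq> adjoint_graph H Q"
    unfolding adjoint_graph_def by blast
  with S assms show "S = Q" unfolding self_adjoint_def by blast
qed (rule assms)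

theorem (in positive_symmetric) friedrichs_extension:
  "maximal_self_adjoint H friedrichs \<and> positive_operator H friedrichs \<and> T \<subseteq> friedrichs"
proof (intro conjI extends self_adjoint_imp_maximal self_adjointI friedrichs_carr
    friedrichs_dense adjoint_friedrichs)
  show "friedrichs \<noteq> {}" using T_nonempty extends by blast
  show "positive_operator H friedrichs"
    unfolding positive_operator_def
  proof clarify
    fix x v assume xv: "(x, v) \<in> friedrichs"
    have "x \<sqdot> v = cnj (v \<sqdot> x)" using inn_sym[of v x] xv friedrichs_carr by auto
    with friedrichs_symmetric[OF xv xv] have "v \<sqdot> x \<in> \<real>"
      by (simp add: complex_eq_iff complex_is_Real_iff)
    with friedrichs_positive[OF xv] show "v \<sqdot> x \<in> \<real> \<and> 0 \<le> Re (v \<sqdot> x)" by simp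
  qed
qed

section \<open>Completeness of the space of square integrable functions\<close>

lemma borel_measurable_cnj [measurable (raw)]:
  "f \<in> borel_measurable M \<Longrightarrow> (\<lambda>x. cnj (f x)) \<in> borel_measurable M"
  by (rule borel_measurable_continuous_on) (auto intro: continuous_intros)

definition square_integrable :: "'a measure \<Rightarrow> ('a \<Rightarrow> complex) \<Rightarrow> bool" where
  "square_integrable M f \<longleftrightarrow> f \<in> borel_measurable M \<and> integrable M (\<lambda>x. (cmod (f x))\<^sup>2)"

lemma cmod_add_sq_le: "(cmod (a + b))\<^sup>2 \<le> 2 * (cmod a)\<^sup>2 + 2 * (cmod b)\<^sup>2"
proof -
  have "(cmod (a + b))\<^sup>2 \<le> (cmod a + cmod b)\<^sup>2"
    by (intro power_mono norm_triangle_ineq) auto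
  also have "\<dots> \<le> 2 * (cmod a)\<^sup>2 + 2 * (cmod b)\<^sup>2"
    using zero_le_power2[of "cmod a - cmod b"] by (simp add: power2_eq_square algebra_simps)
  finally show ?thesis .
qed

lemma square_integrable_add:
  assumes "square_integrable M f" "square_integrable M g"
  shows "square_integrable M (\<lambda>x. f x + g x)"
  unfolding square_integrable_def
proof
  show "integrable M (\<lambda>x. (cmod (f x + g x))\<^sup>2)"
  proof (rule Bochner_Integration.integrable_bound
      [where f = "\<lambda>x. 2 * (cmod (f x))\<^sup>2 + 2 * (cmod (g x))\<^sup>2"])
    show "AE x in M. norm ((cmod (f x + g x))\<^sup>2) \<le> norm (2 * (cmod (f x))\<^sup>2 + 2 * (cmod (g x))\<^sup>2)"
      using cmod_add_sq_le by simp
  qed (use assms in \<open>auto simp: square_integrable_def\<close>)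
qed (use assms in \<open>auto simp: square_integrable_def\<close>)

lemma square_integrable_scale:
  assumes "square_integrable M f"
  shows "square_integrable M (\<lambda>x. c * f x)"
  using assms unfolding square_integrable_def by (auto simp: norm_mult power_mult_distrib)

lemma square_integrable_diff:
  assumes "square_integrable M f" "square_integrable M g"
  shows "square_integrable M (\<lambda>x. f x - g x)"
  using square_integrable_add[OF assms(1) square_integrable_scale[OF assms(2), of "-1"]] by simp

lemma square_integrable_inner:
  assumes "square_integrable M f" "square_integrable M g"
  shows "integrable M (\<lambda>x. f x * cnj (g x))"
proof (rule Bochner_Integration.integrable_bound
    [where f = "\<lambda>x. (cmod (f x))\<^sup>2 + (cmod (g x))\<^sup>2"])
  show "AE x in M. norm (f x * cnj (g x)) \<le> norm ((cmod (f x))\<^sup>2 + (cmod (g x))\<^sup>2)"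
  proof (rule AE_I2)
    fix x
    have "cmod (f x) * cmod (g x) \<le> (cmod (f x))\<^sup>2 + (cmod (g x))\<^sup>2"
      using sum_squares_bound[of "cmod (f x)" "cmod (g x)"]
        mult_nonneg_nonneg[OF norm_ge_zero[of "f x"] norm_ge_zero[of "g x"]] by linarith
    then show "norm (f x * cnj (g x)) \<le> norm ((cmod (f x))\<^sup>2 + (cmod (g x))\<^sup>2)"
      by (simp add: norm_mult)
  qed
qed (use assms in \<open>auto simp: square_integrable_def intro!: borel_measurable_cnj borel_measurable_times\<close>)

text \<open>The Riesz-Fischer theorem. Along a subsequence with consecutive distances below \<open>2 ^ - k\<close> the
  increments are summable almost everywhere; because the measure is finite this follows from
  the bound \<open>d \<le> (1/2) ^ k + 2 ^ k * d\<^sup>2\<close> without the triangle inequality in \<open>L\<^sup>2\<close>. Fatou's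
  lemma turns the pointwise limit into a limit in \<open>L\<^sup>2\<close>.\<close>

lemma (in finite_measure) square_integrable_complete:
  assumes f: "\<And>n::nat. square_integrable M (f n)"
    and cauchy: "\<And>e. e > 0 \<Longrightarrow> \<exists>N. \<forall>i\<ge>N. \<forall>j\<ge>N. (\<integral>x. (cmod (f i x - f j x))\<^sup>2 \<partial>M) < e"
  obtains g where "square_integrable M g" "(\<lambda>n. \<integral>x. (cmod (f n x - g x))\<^sup>2 \<partial>M) \<longlonglongrightarrow> 0"
proof -
  have fm [measurable]: "f n \<in> borel_measurable M" for n using f by (auto simp: square_integrable_def)
  have fi: "integrable M (\<lambda>x. (cmod (f i x - f j x))\<^sup>2)" for i j
    using square_integrable_diff[OF f f] by (auto simp: square_integrable_def)
  have nn: "(\<integral>\<^sup>+x. ennreal ((cmod (f i x - f j x))\<^sup>2) \<partial>M) = ennreal (\<integral>x. (cmod (f i x - f j x))\<^sup>2 \<partial>M)"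
    for i j by (rule nn_integral_eq_integral[OF fi]) auto
  have "\<forall>k. \<exists>N. \<forall>i\<ge>N. \<forall>j\<ge>N. (\<integral>x. (cmod (f i x - f j x))\<^sup>2 \<partial>M) < (1/4)^k"
    by (intro allI cauchy) auto
  then obtain N where N: "\<And>k i j. \<lbrakk>i \<ge> N k; j \<ge> N k\<rbrakk> \<Longrightarrow> (\<integral>x. (cmod (f i x - f j x))\<^sup>2 \<partial>M) < (1/4)^k"
    by metis
  \<comment> \<open>The sum makes \<open>r k\<close> and \<open>r (Suc k)\<close> both exceed \<open>N k\<close>; the summand \<open>k\<close> makes \<open>r\<close> unbounded.\<close>
  define r where "r k = (\<Sum>i\<le>k. N i) + k" for k
  have rN: "r k \<ge> N k" "r (Suc k) \<ge> N k" "r k \<ge> k" for k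
    unfolding r_def by (auto intro: order_trans[OF member_le_sum[of k "{..k}" N]])
  define d where "d k x = cmod (f (r (Suc k)) x - f (r k) x)" for k x
  have [measurable]: "d k \<in> borel_measurable M" for k unfolding d_def by measurable
  define \<mu> where "\<mu> = measure M (space M)"
  have dk: "(\<integral>\<^sup>+x. ennreal (d k x) \<partial>M) \<le> ennreal ((1/2)^k * (\<mu> + 1))" for k
  proof -
    have "d k x \<le> (1/2)^k + 2^k * (d k x)\<^sup>2" for x
    proof -
      have "0 \<le> 2^k * (d k x - (1/2)^k)\<^sup>2 + d k x" unfolding d_def by simp
      also have "\<dots> = 2^k * (d k x)\<^sup>2 - 2 * (2^k * (1/2)^k) * d k x + 2^k * (1/2)^k * (1/2)^k + d k x"
        by (simp add: power2_eq_square algebra_simps)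
      also have "2^k * (1/2)^k = (1::real)" by (simp flip: power_mult_distrib)
      finally show ?thesis by simp
    qed
    then have "(\<integral>\<^sup>+x. ennreal (d k x) \<partial>M) \<le> (\<integral>\<^sup>+x. ennreal ((1/2)^k + 2^k * (d k x)\<^sup>2) \<partial>M)"
      by (intro nn_integral_mono ennreal_leI)
    also have "\<dots> = ennreal (\<integral>x. (1/2)^k + 2^k * (d k x)\<^sup>2 \<partial>M)"
      by (rule nn_integral_eq_integral) (use fi in \<open>auto simp: d_def\<close>)
    also have "(\<integral>x. (1/2)^k + 2^k * (d k x)\<^sup>2 \<partial>M) = (1/2)^k * \<mu> + 2^k * (\<integral>x. (d k x)\<^sup>2 \<partial>M)"
      using fi by (simp add: d_def \<mu>_def)
    also have "2^k * (\<integral>x. (d k x)\<^sup>2 \<partial>M) \<le> 2^k * (1/4)^k"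
      unfolding d_def by (intro mult_left_mono less_imp_le N rN) auto
    also have "2^k * (1/4)^k = (1/2::real)^k" by (simp flip: power_mult_distrib)
    finally show ?thesis by (simp add: algebra_simps ennreal_leI)
  qed
  have "(\<integral>\<^sup>+x. (\<Sum>k. ennreal (d k x)) \<partial>M) = (\<Sum>k. \<integral>\<^sup>+x. ennreal (d k x) \<partial>M)"
    by (intro nn_integral_suminf) auto
  also have "\<dots> \<le> (\<Sum>k. ennreal ((1/2)^k * (\<mu> + 1)))" by (intro suminf_le dk) auto
  also have "\<dots> = ennreal (\<Sum>k. (1/2)^k * (\<mu> + 1))"
    by (intro suminf_ennreal2 summable_mult2 summable_geometric) (auto simp: \<mu>_def)
  also have "\<dots> < \<infinity>" by simp
  finally have "AE x in M. (\<Sum>k. ennreal (d k x)) \<noteq> \<infinity>"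
    by (intro nn_integral_PInf_AE) auto
  then have conv: "AE x in M. (\<lambda>k. f (r k) x) \<longlonglongrightarrow> lim (\<lambda>k. f (r k) x)"
  proof eventually_elim
    case (elim x)
    then have "summable (\<lambda>k. d k x)"
      by (intro summable_suminf_not_top) (auto simp: d_def)
    then have "summable (\<lambda>k. f (r (Suc k)) x - f (r k) x)"
      unfolding d_def by (rule summable_norm_cancel)
    then have "convergent (\<lambda>n. (\<Sum>k<n. f (r (Suc k)) x - f (r k) x) + f (r 0) x)"
      by (intro convergent_add convergent_const) (simp add: summable_iff_convergent)
    then have "convergent (\<lambda>n. f (r n) x)"
      using sum_lessThan_telescope[of "\<lambda>k. f (r k) x"] by simp
    then show ?case by (simp add: convergent_LIMSEQ_iff)
  qed
  define g where "g x = lim (\<lambda>k. f (r k) x)" for x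
  have gm [measurable]: "g \<in> borel_measurable M" unfolding g_def by measurable
  have fatou: "(\<integral>\<^sup>+x. ennreal ((cmod (f n x - g x))\<^sup>2) \<partial>M) \<le> ennreal e"
    if n: "n \<ge> K" and K: "\<forall>i\<ge>K. \<forall>j\<ge>K. (\<integral>x. (cmod (f i x - f j x))\<^sup>2 \<partial>M) < e" for n K e
  proof -
    have "(\<integral>\<^sup>+x. ennreal ((cmod (f n x - g x))\<^sup>2) \<partial>M) =
        (\<integral>\<^sup>+x. liminf (\<lambda>k. ennreal ((cmod (f n x - f (r k) x))\<^sup>2)) \<partial>M)"
    proof (rule nn_integral_cong_AE, use conv in eventually_elim)
      case (elim x)
      have "(\<lambda>k. ennreal ((cmod (f n x - f (r k) x))\<^sup>2)) \<longlonglongrightarrow> ennreal ((cmod (f n x - g x))\<^sup>2)"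
        unfolding g_def by (intro tendsto_intros tendsto_ennrealI elim)
      then show ?case by (intro lim_imp_Liminf[symmetric]) auto
    qed
    also have "\<dots> \<le> liminf (\<lambda>k. \<integral>\<^sup>+x. ennreal ((cmod (f n x - f (r k) x))\<^sup>2) \<partial>M)"
      by (rule nn_integral_liminf) auto
    also have "\<dots> \<le> limsup (\<lambda>k. \<integral>\<^sup>+x. ennreal ((cmod (f n x - f (r k) x))\<^sup>2) \<partial>M)"
      by (rule Liminf_le_Limsup) auto
    also have "\<dots> \<le> ennreal e"
    proof (rule Limsup_bounded)
      show "\<forall>\<^sub>F k in sequentially. (\<integral>\<^sup>+x. ennreal ((cmod (f n x - f (r k) x))\<^sup>2) \<partial>M) \<le> ennreal e"
        unfolding nn eventually_sequentially
        using K n rN(3) by (intro exI[of _ K] allI impI ennreal_leI less_imp_le) (meson order_trans)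
    qed
    finally show ?thesis .
  qed
  have int: "integrable M (\<lambda>x. (cmod (f n x - g x))\<^sup>2) \<and> (\<integral>x. (cmod (f n x - g x))\<^sup>2 \<partial>M) \<le> e"
    if "n \<ge> K" "\<forall>i\<ge>K. \<forall>j\<ge>K. (\<integral>x. (cmod (f i x - f j x))\<^sup>2 \<partial>M) < e" "e > 0" for n K e
  proof
    show "integrable M (\<lambda>x. (cmod (f n x - g x))\<^sup>2)"
      using fatou[OF that(1,2)] by (intro integrableI_bounded) (auto simp: less_top[symmetric] top_unique)
    then show "(\<integral>x. (cmod (f n x - g x))\<^sup>2 \<partial>M) \<le> e"
      using fatou[OF that(1,2)] that(3) by (simp add: nn_integral_eq_integral)
  qed
  show ?thesis
  proof (rule that)
    obtain K where K: "\<forall>i\<ge>K. \<forall>j\<ge>K. (\<integral>x. (cmod (f i x - f j x))\<^sup>2 \<partial>M) < 1"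
      using cauchy[of 1] by auto
    have "square_integrable M (\<lambda>x. f K x - g x)"
      using int[OF order_refl K] by (auto simp: square_integrable_def)
    from square_integrable_diff[OF f[of K] this] show "square_integrable M g" by simp
    show "(\<lambda>n. \<integral>x. (cmod (f n x - g x))\<^sup>2 \<partial>M) \<longlonglongrightarrow> 0"
    proof (rule LIMSEQ_I)
      fix e :: real assume e: "e > 0"
      then obtain K where K: "\<forall>i\<ge>K. \<forall>j\<ge>K. (\<integral>x. (cmod (f i x - f j x))\<^sup>2 \<partial>M) < e / 2"
        using cauchy[of "e / 2"] by auto
      have "norm ((\<integral>x. (cmod (f n x - g x))\<^sup>2 \<partial>M) - 0) < e" if "n \<ge> K" for n
        using int[OF that K] e by simp
      then show "\<exists>K. \<forall>n\<ge>K. norm ((\<integral>x. (cmod (f n x - g x))\<^sup>2 \<partial>M) - 0) < e" by blast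
    qed
  qed
qed

section \<open>The canonical measure\<close>

lemma one_plus_sq_le: "1 + (Re z)\<^sup>2 \<le> 2 * (max 1 (cmod z))\<^sup>2" "1 + (Im z)\<^sup>2 \<le> 2 * (max 1 (cmod z))\<^sup>2"
proof -
  have "(cmod z)\<^sup>2 \<le> (max 1 (cmod z))\<^sup>2" "1 \<le> (max 1 (cmod z))\<^sup>2"
    by (auto intro!: power_mono)
  moreover have "(Re z)\<^sup>2 \<le> (cmod z)\<^sup>2" "(Im z)\<^sup>2 \<le> (cmod z)\<^sup>2"
    by (simp_all add: cmod_power2)
  ultimately show "1 + (Re z)\<^sup>2 \<le> 2 * (max 1 (cmod z))\<^sup>2" "1 + (Im z)\<^sup>2 \<le> 2 * (max 1 (cmod z))\<^sup>2"
    by linarith+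
qed

text \<open>The product \<open>(1 + x\<^sup>2) * (1 + y\<^sup>2)\<close> is at most \<open>4 * max(1, |z|) ^ 4\<close>, so two integrals of
  \<open>1 / (1 + t\<^sup>2)\<close> bound the integral.\<close>

lemma integrable_max_pow4: "integrable lborel (\<lambda>z. 1 / max 1 (cmod z) ^ 4)"
proof (rule integrableI_bounded)
  define I where "I = (\<integral>\<^sup>+t. ennreal (inverse (1 + t\<^sup>2)) \<partial>lborel)"
  have "integrable lborel (\<lambda>t::real. inverse (1 + t\<^sup>2))"
    using integrable_inverse_1_plus_square by (simp add: set_integrable_def)
  then have I: "I < \<infinity>" unfolding I_def by (subst nn_integral_eq_integral) auto
  have "(\<integral>\<^sup>+z. ennreal (norm (1 / max 1 (cmod z) ^ 4)) \<partial>lborel)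
      \<le> (\<integral>\<^sup>+z. 4 * (\<Prod>b\<in>Basis. ennreal (inverse (1 + (z \<bullet> b)\<^sup>2))) \<partial>(lborel::complex measure))"
  proof (rule nn_integral_mono)
    fix z :: complex
    have "(1 + (Re z)\<^sup>2) * (1 + (Im z)\<^sup>2) \<le> (2 * (max 1 (cmod z))\<^sup>2) * (2 * (max 1 (cmod z))\<^sup>2)"
      by (intro mult_mono one_plus_sq_le) auto
    also have "\<dots> = 4 * max 1 (cmod z) ^ 4" by (simp add: power4_eq_xxxx power2_eq_square)
    finally have le: "(1 + (Re z)\<^sup>2) * (1 + (Im z)\<^sup>2) \<le> 4 * max 1 (cmod z) ^ 4" .
    have "0 < (1 + (Re z)\<^sup>2) * (1 + (Im z)\<^sup>2)"
      by (intro mult_pos_pos add_pos_nonneg zero_less_one zero_le_power2)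
    with le have "4 / (4 * max 1 (cmod z) ^ 4) \<le> 4 / ((1 + (Re z)\<^sup>2) * (1 + (Im z)\<^sup>2))"
      by (intro frac_le) auto
    then have "1 / max 1 (cmod z) ^ 4 \<le> 4 * (inverse (1 + (Re z)\<^sup>2) * inverse (1 + (Im z)\<^sup>2))"
      unfolding divide_inverse inverse_mult_distrib by (simp only: mult_1 mult.assoc[symmetric]) simp
    moreover have "(\<Prod>b\<in>Basis. ennreal (inverse (1 + (z \<bullet> b)\<^sup>2))) =
        ennreal (inverse (1 + (Re z)\<^sup>2) * inverse (1 + (Im z)\<^sup>2))"
      by (simp add: Basis_complex_def inner_complex_def ennreal_mult')
    then have "4 * (\<Prod>b\<in>Basis. ennreal (inverse (1 + (z \<bullet> b)\<^sup>2))) =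
        ennreal (4 * (inverse (1 + (Re z)\<^sup>2) * inverse (1 + (Im z)\<^sup>2)))"
      by (simp add: ennreal_mult')
    ultimately show "ennreal (norm (1 / max 1 (cmod z) ^ 4)) \<le> 4 * (\<Prod>b\<in>Basis. ennreal (inverse (1 + (z \<bullet> b)\<^sup>2)))"
      by (simp only: ennreal_leI real_norm_def) (simp add: ennreal_leI)
  qed
  also have "\<dots> = 4 * (\<integral>\<^sup>+z. (\<Prod>b\<in>Basis. ennreal (inverse (1 + (z \<bullet> b)\<^sup>2))) \<partial>(lborel::complex measure))"
    by (rule nn_integral_cmult) simp
  also have "\<dots> = 4 * (I * I)"
  proof -
    have "(\<integral>\<^sup>+z. (\<Prod>b\<in>Basis. ennreal (inverse (1 + (z \<bullet> b)\<^sup>2))) \<partial>(lborel::complex measure)) =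
        (\<Prod>b\<in>(Basis::complex set). I)"
      unfolding I_def by (subst nn_integral_lborel_prod[symmetric]) (auto simp: prod_ennreal)
    then show ?thesis by (simp add: power2_eq_square)
  qed
  also have "\<dots> < \<infinity>" using I by (simp add: ennreal_mult_less_top ennreal_mult_eq_top_iff less_top)
  finally show "(\<integral>\<^sup>+z. ennreal (norm (1 / max 1 (cmod z) ^ 4)) \<partial>lborel) < \<infinity>" .
qed simp

lemma sets_omega_inf [measurable_cong, simp]: "sets omega_inf = sets borel"
  by (simp add: omega_inf_def)

lemma space_omega_inf [simp]: "space omega_inf = UNIV"
  by (simp add: omega_inf_def)

lemma finite_measure_omega_inf: "finite_measure omega_inf"
proof (rule finite_measureI)
  have "integrable lborel (\<lambda>z. 1 / pi * (1 / max 1 (cmod z) ^ 4))"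
    by (intro integrable_mult_right integrable_max_pow4)
  then have "(\<integral>\<^sup>+z. ennreal (1 / (pi * max 1 (cmod z) ^ 4)) \<partial>lborel) < \<infinity>"
    by (subst nn_integral_eq_integral) auto
  then show "emeasure omega_inf (space omega_inf) \<noteq> \<infinity>"
    unfolding omega_inf_def by (subst emeasure_density) auto
qed

lemma AE_omega_inf: "(AE z in omega_inf. P z) \<longleftrightarrow> (AE z in lborel. P z)"
  unfolding omega_inf_def by (subst AE_density) (auto simp: less_max_iff_disj)

lemma integral_omega_inf:
  fixes f :: "complex \<Rightarrow> complex"
  assumes "f \<in> borel_measurable borel"
  shows "(\<integral>z. f z \<partial>omega_inf) = (\<integral>z. f z / (pi * max 1 (cmod z) ^ 4) \<partial>lborel)"
  unfolding omega_inf_def using assms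
  by (subst integral_density) (auto simp: scaleR_conv_of_real intro!: Bochner_Integration.integral_cong)

lemma AE_not_circle: "AE z in lborel. cmod z \<noteq> 1"
proof -
  have "negligible (sphere (0::complex) 1)" by (rule negligible_sphere)
  then have "sphere (0::complex) 1 \<in> null_sets lborel"
    by (simp add: negligible_iff_null_sets null_sets_completion_iff)
  then show ?thesis by (rule AE_I') auto
qed

section \<open>The Hilbert space of sections\<close>

text \<open>The coefficient of a section with respect to a frame of length 1 for \<open>h\<^sub>m\<close>. It turns
  square integrable sections into ordinary square integrable functions for the measure
  \<open>omega_inf\<close>.\<close>

definition unit_coord :: "nat \<Rightarrow> csection \<Rightarrow> complex \<Rightarrow> complex" where
  "unit_coord m \<xi> z = \<xi> (1, z) / of_real (max 1 (cmod z) ^ m)"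

lemma max_pow_ne_0: "complex_of_real (max 1 (cmod z) ^ m) \<noteq> 0"
proof -
  have "0 < max 1 (cmod z)" by (simp add: less_max_iff_disj)
  then show ?thesis by (simp del: of_real_power)
qed

lemma herm_eq_nrm: "herm m \<xi> \<eta> z = unit_coord m \<xi> z * cnj (unit_coord m \<eta> z)"
  by (simp add: herm_def unit_coord_def mult_2 power_add)

lemma unit_coord_add: "unit_coord m (\<lambda>x. \<xi> x + \<eta> x) z = unit_coord m \<xi> z + unit_coord m \<eta> z"
  and unit_coord_diff: "unit_coord m (\<lambda>x. \<xi> x - \<eta> x) z = unit_coord m \<xi> z - unit_coord m \<eta> z"
  and unit_coord_scale: "unit_coord m (\<lambda>x. c * \<xi> x) z = c * unit_coord m \<xi> z"
  by (simp_all add: unit_coord_def add_divide_distrib diff_divide_distrib)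

lemma is_section_add: "is_section m \<xi> \<Longrightarrow> is_section m \<eta> \<Longrightarrow> is_section m (\<lambda>x. \<xi> x + \<eta> x)"
  and is_section_diff: "is_section m \<xi> \<Longrightarrow> is_section m \<eta> \<Longrightarrow> is_section m (\<lambda>x. \<xi> x - \<eta> x)"
  and is_section_scale: "is_section m \<xi> \<Longrightarrow> is_section m (\<lambda>x. c * \<xi> x)"
  by (simp_all add: is_section_def algebra_simps)

lemma L2_sections_iff:
  "\<xi> \<in> L2_sections m \<longleftrightarrow> is_section m \<xi> \<and> square_integrable omega_inf (unit_coord m \<xi>)"
proof -
  have meas: "(\<lambda>z. \<xi> (1, z)) \<in> borel_measurable borel \<longleftrightarrow> unit_coord m \<xi> \<in> borel_measurable borel"
  proof
    assume *[measurable]: "unit_coord m \<xi> \<in> borel_measurable borel"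
    have "(\<lambda>z. \<xi> (1, z)) = (\<lambda>z. unit_coord m \<xi> z * of_real (max 1 (cmod z) ^ m))"
      using max_pow_ne_0 by (auto simp: unit_coord_def)
    then show "(\<lambda>z. \<xi> (1, z)) \<in> borel_measurable borel" by simp
  next
    assume [measurable]: "(\<lambda>z. \<xi> (1, z)) \<in> borel_measurable borel"
    show "unit_coord m \<xi> \<in> borel_measurable borel" unfolding unit_coord_def by measurable
  qed
  have "herm m \<xi> \<xi> = (\<lambda>z. of_real ((cmod (unit_coord m \<xi> z))\<^sup>2))"
    unfolding fun_eq_iff herm_eq_nrm complex_norm_square by simp
  then have "integrable omega_inf (herm m \<xi> \<xi>) \<longleftrightarrow> integrable omega_inf (\<lambda>z. (cmod (unit_coord m \<xi> z))\<^sup>2)"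
    by (simp only: complex_of_real_integrable_eq)
  with meas show ?thesis
    by (auto simp: L2_sections_def square_integrable_def cong: measurable_cong_sets)
qed

lemma L2_inner_eq: "L2_inner m \<xi> \<eta> = (\<integral>z. unit_coord m \<xi> z * cnj (unit_coord m \<eta> z) \<partial>omega_inf)"
  by (simp add: L2_inner_def herm_eq_nrm)

lemma L2_inner_self: "L2_inner m \<xi> \<xi> = of_real (\<integral>z. (cmod (unit_coord m \<xi> z))\<^sup>2 \<partial>omega_inf)"
  unfolding L2_inner_eq complex_norm_square[symmetric] by (rule integral_complex_of_real)

lemma unit_coord_integrable:
  "\<lbrakk>\<xi> \<in> L2_sections m; \<eta> \<in> L2_sections m\<rbrakk>
    \<Longrightarrow> integrable omega_inf (\<lambda>z. unit_coord m \<xi> z * cnj (unit_coord m \<eta> z))"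
  by (intro square_integrable_inner) (auto simp: L2_sections_iff)

lemma L2_sections_add: "\<lbrakk>\<xi> \<in> L2_sections m; \<eta> \<in> L2_sections m\<rbrakk> \<Longrightarrow> (\<lambda>x. \<xi> x + \<eta> x) \<in> L2_sections m"
  and L2_sections_diff: "\<lbrakk>\<xi> \<in> L2_sections m; \<eta> \<in> L2_sections m\<rbrakk> \<Longrightarrow> (\<lambda>x. \<xi> x - \<eta> x) \<in> L2_sections m"
  and L2_sections_scale: "\<xi> \<in> L2_sections m \<Longrightarrow> (\<lambda>x. c * \<xi> x) \<in> L2_sections m"
  by (auto simp: L2_sections_iff is_section_add is_section_diff is_section_scale unit_coord_add[abs_def]
      unit_coord_diff[abs_def] unit_coord_scale[abs_def] square_integrable_add square_integrable_diff
      square_integrable_scale)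

lemma L2_inner_cong_AE:
  assumes "\<xi> \<in> L2_sections m" "\<xi>' \<in> L2_sections m" "\<eta> \<in> L2_sections m" "\<eta>' \<in> L2_sections m"
    and ae: "AE z in omega_inf. \<xi> (1, z) = \<xi>' (1, z)" "AE z in omega_inf. \<eta> (1, z) = \<eta>' (1, z)"
  shows "L2_inner m \<xi> \<eta> = L2_inner m \<xi>' \<eta>'"
  unfolding L2_inner_eq
proof (rule integral_cong_AE)
  show "AE z in omega_inf. unit_coord m \<xi> z * cnj (unit_coord m \<eta> z) = unit_coord m \<xi>' z * cnj (unit_coord m \<eta>' z)"
    using ae by eventually_elim (simp add: unit_coord_def)
qed (intro borel_measurable_integrable unit_coord_integrable assms)+

lemma ae_class_eqI:
  assumes "AE z in omega_inf. \<xi> (1, z) = \<eta> (1, z)"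
  shows "ae_class m \<xi> = ae_class m \<eta>"
proof -
  have *: "(AE z in omega_inf. \<zeta> (1, z) = \<xi> (1, z)) \<longleftrightarrow> (AE z in omega_inf. \<zeta> (1, z) = \<eta> (1, z))" for \<zeta>
  proof
    assume "AE z in omega_inf. \<zeta> (1, z) = \<xi> (1, z)"
    with assms show "AE z in omega_inf. \<zeta> (1, z) = \<eta> (1, z)" by eventually_elim simp
  next
    assume "AE z in omega_inf. \<zeta> (1, z) = \<eta> (1, z)"
    with assms show "AE z in omega_inf. \<zeta> (1, z) = \<xi> (1, z)" by eventually_elim simp
  qed
  show ?thesis by (simp only: ae_class_def *)
qed

lemma mem_ae_class:
  "\<eta> \<in> ae_class m \<xi> \<longleftrightarrow> \<eta> \<in> L2_sections m \<and> (AE z in omega_inf. \<eta> (1, z) = \<xi> (1, z))"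
  by (simp add: ae_class_def)

lemma repr_ae_class:
  assumes "\<xi> \<in> L2_sections m"
  shows "repr (ae_class m \<xi>) \<in> L2_sections m"
    and "AE z in omega_inf. repr (ae_class m \<xi>) (1, z) = \<xi> (1, z)"
proof -
  have "\<xi> \<in> ae_class m \<xi>" using assms by (simp add: mem_ae_class)
  then have "repr (ae_class m \<xi>) \<in> ae_class m \<xi>" unfolding repr_def
    by (rule someI[where P = "\<lambda>\<eta>. \<eta> \<in> ae_class m \<xi>"])
  then show "repr (ae_class m \<xi>) \<in> L2_sections m"
    "AE z in omega_inf. repr (ae_class m \<xi>) (1, z) = \<xi> (1, z)"
    unfolding mem_ae_class by blast+
qed

text \<open>The representatives of the elements of \<open>H\<^sup>(\<^sup>m\<^sup>)\<close>.\<close>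

definition L2_closure :: "nat \<Rightarrow> csection set" where
  "L2_closure m = {\<xi> \<in> L2_sections m. \<exists>s. (\<forall>n::nat. s n \<in> smooth_sections m) \<and>
     (\<lambda>n. \<integral>z. (cmod (unit_coord m \<xi> z - unit_coord m (s n) z))\<^sup>2 \<partial>omega_inf) \<longlonglongrightarrow> 0}"

lemma carr_Hilb: "carr (Hilb m) = ae_class m ` L2_closure m"
proof -
  have *: "(\<lambda>n. L2_inner m (\<lambda>x. \<xi> x - s n x) (\<lambda>x. \<xi> x - s n x)) \<longlonglongrightarrow> 0 \<longleftrightarrow>
      (\<lambda>n::nat. \<integral>z. (cmod (unit_coord m \<xi> z - unit_coord m (s n) z))\<^sup>2 \<partial>omega_inf) \<longlonglongrightarrow> 0" for \<xi> s
    unfolding L2_inner_self unit_coord_diff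
    by (rule tendsto_of_real_iff[where c = 0 and 'a = complex, unfolded of_real_0])
  show ?thesis by (simp only: Hilb_def L2_closure_def ip_space.simps *) blast
qed

lemma smooth_sections_add:
  "\<lbrakk>\<xi> \<in> smooth_sections m; \<eta> \<in> smooth_sections m\<rbrakk> \<Longrightarrow> (\<lambda>x. \<xi> x + \<eta> x) \<in> smooth_sections m"
  by (simp add: smooth_sections_def is_section_add C_inf_add)

lemma smooth_sections_scale:
  "\<xi> \<in> smooth_sections m \<Longrightarrow> (\<lambda>x. c * \<xi> x) \<in> smooth_sections m"
  by (simp add: smooth_sections_def is_section_scale C_inf_mult C_inf_const)

text \<open>The transition function of \<open>O(m)\<close>.\<close>

lemma section_chart:
  assumes "is_section m \<xi>" "z \<noteq> 0"
  shows "\<xi> (1, z) = z ^ m * \<xi> (inverse z, 1)"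
proof -
  have "(inverse z, 1) \<noteq> (0 :: complex \<times> complex)" by (simp add: zero_prod_def)
  then have "\<xi> (scale_pair z (inverse z, 1)) = z ^ m * \<xi> (inverse z, 1)"
    using assms unfolding is_section_def by blast
  then show ?thesis using assms by (simp add: scale_pair_def)
qed

lemma C_inf_continuous: "C_inf f \<Longrightarrow> continuous_on A f"
  unfolding C_inf_def using C_k.simps(1) continuous_on_subset by blast

text \<open>The two closed unit discs of the charts cover the projective line, and \<open>z ^ m\<close> has length 1
  in the part outside the first disc.\<close>

lemma smooth_section_bounded:
  assumes "\<xi> \<in> smooth_sections m"
  obtains C where "\<And>z. cmod (unit_coord m \<xi> z) \<le> C"
proof -
  have sec: "is_section m \<xi>" and c: "C_inf (\<lambda>z. \<xi> (1, z))" "C_inf (\<lambda>w. \<xi> (w, 1))"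
    using assms by (auto simp: smooth_sections_def)
  have "bounded ((\<lambda>z. \<xi> (1, z)) ` cball 0 1)" "bounded ((\<lambda>w. \<xi> (w, 1)) ` cball 0 1)"
    by (intro compact_imp_bounded compact_continuous_image C_inf_continuous c compact_cball)+
  then obtain C1 C2 where "\<forall>z\<in>cball 0 1. cmod (\<xi> (1, z)) \<le> C1"
      "\<forall>z\<in>cball 0 1. cmod (\<xi> (z, 1)) \<le> C2"
    unfolding bounded_iff by auto
  then have C: "\<And>z. cmod z \<le> 1 \<Longrightarrow> cmod (\<xi> (1, z)) \<le> C1"
      "\<And>z. cmod z \<le> 1 \<Longrightarrow> cmod (\<xi> (z, 1)) \<le> C2"
    by simp_all
  have "cmod (unit_coord m \<xi> z) \<le> max C1 C2" for z
  proof (cases "cmod z \<le> 1")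
    case True
    then show ?thesis using C(1)[OF True] by (simp add: unit_coord_def)
  next
    case False
    then have "z \<noteq> 0" by auto
    have "cmod (unit_coord m \<xi> z) = cmod (\<xi> (inverse z, 1))"
      using False \<open>z \<noteq> 0\<close>
      by (simp add: unit_coord_def section_chart[OF sec \<open>z \<noteq> 0\<close>] norm_mult norm_divide norm_power max_def)
    also have "\<dots> \<le> C2" using False by (intro C(2)) (simp add: norm_inverse inverse_le_1_iff)
    finally show ?thesis by simp
  qed
  then show ?thesis by (rule that)
qed

lemma square_integrable_bounded:
  assumes [measurable]: "f \<in> borel_measurable borel" and "\<And>z. cmod (f z) \<le> C"
  shows "square_integrable omega_inf f"
  unfolding square_integrable_def
proof
  interpret finite_measure omega_inf by (rule finite_measure_omega_inf)
  show "integrable omega_inf (\<lambda>z. (cmod (f z))\<^sup>2)"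
    by (rule integrable_const_bound[where B = "C\<^sup>2"]) (use assms(2) in \<open>auto intro!: power_mono\<close>)
qed simp

lemma smooth_sections_L2: "\<xi> \<in> smooth_sections m \<Longrightarrow> \<xi> \<in> L2_sections m"
  unfolding L2_sections_iff
proof
  assume \<xi>: "\<xi> \<in> smooth_sections m"
  then have [measurable]: "(\<lambda>z. \<xi> (1, z)) \<in> borel_measurable borel"
    by (auto simp: smooth_sections_def intro!: borel_measurable_continuous_onI C_inf_continuous)
  obtain C where "\<And>z. cmod (unit_coord m \<xi> z) \<le> C" by (rule smooth_section_bounded[OF \<xi>]) blast
  then show "square_integrable omega_inf (unit_coord m \<xi>)"
    by (rule square_integrable_bounded[rotated]) (unfold unit_coord_def, measurable)
qed (simp add: smooth_sections_def)

lemma smooth_sections_closure: "\<xi> \<in> smooth_sections m \<Longrightarrow> \<xi> \<in> L2_closure m"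
  by (auto simp: L2_closure_def smooth_sections_L2 intro!: exI[of _ "\<lambda>_. \<xi>"])

lemma tendsto_integral_sq_add:
  assumes "\<And>n. square_integrable M (f n)" "\<And>n. square_integrable M (g n)"
    and "(\<lambda>n::nat. \<integral>x. (cmod (f n x))\<^sup>2 \<partial>M) \<longlonglongrightarrow> 0" "(\<lambda>n. \<integral>x. (cmod (g n x))\<^sup>2 \<partial>M) \<longlonglongrightarrow> 0"
  shows "(\<lambda>n. \<integral>x. (cmod (f n x + g n x))\<^sup>2 \<partial>M) \<longlonglongrightarrow> 0"
proof (rule real_tendsto_sandwich[OF _ _ tendsto_const])
  have "(\<lambda>n. 2 * (\<integral>x. (cmod (f n x))\<^sup>2 \<partial>M) + 2 * (\<integral>x. (cmod (g n x))\<^sup>2 \<partial>M)) \<longlonglongrightarrow> 2 * 0 + 2 * 0"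
    by (intro tendsto_intros assms)
  then show "(\<lambda>n. 2 * (\<integral>x. (cmod (f n x))\<^sup>2 \<partial>M) + 2 * (\<integral>x. (cmod (g n x))\<^sup>2 \<partial>M)) \<longlonglongrightarrow> 0" by simp
  have int: "integrable M (\<lambda>x. (cmod (f n x))\<^sup>2)" "integrable M (\<lambda>x. (cmod (g n x))\<^sup>2)"
      "integrable M (\<lambda>x. (cmod (f n x + g n x))\<^sup>2)" for n
    using assms(1,2)[of n] square_integrable_add[OF assms(1)[of n] assms(2)[of n]]
    by (auto simp: square_integrable_def)
  have "(\<integral>x. (cmod (f n x + g n x))\<^sup>2 \<partial>M) \<le> (\<integral>x. 2 * (cmod (f n x))\<^sup>2 + 2 * (cmod (g n x))\<^sup>2 \<partial>M)" for n
    using int by (intro integral_mono) (auto intro: cmod_add_sq_le)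
  then show "\<forall>\<^sub>F n in sequentially. (\<integral>x. (cmod (f n x + g n x))\<^sup>2 \<partial>M) \<le>
      2 * (\<integral>x. (cmod (f n x))\<^sup>2 \<partial>M) + 2 * (\<integral>x. (cmod (g n x))\<^sup>2 \<partial>M)"
    using int by simp
qed simp

lemma L2_closure_add:
  assumes "\<xi> \<in> L2_closure m" "\<eta> \<in> L2_closure m"
  shows "(\<lambda>x. \<xi> x + \<eta> x) \<in> L2_closure m"
proof -
  obtain s t where st: "\<And>n::nat. s n \<in> smooth_sections m" "\<And>n::nat. t n \<in> smooth_sections m"
      "(\<lambda>n. \<integral>z. (cmod (unit_coord m \<xi> z - unit_coord m (s n) z))\<^sup>2 \<partial>omega_inf) \<longlonglongrightarrow> 0"
      "(\<lambda>n. \<integral>z. (cmod (unit_coord m \<eta> z - unit_coord m (t n) z))\<^sup>2 \<partial>omega_inf) \<longlonglongrightarrow> 0"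
    using assms by (auto simp: L2_closure_def)
  have L: "\<xi> \<in> L2_sections m" "\<eta> \<in> L2_sections m" using assms by (auto simp: L2_closure_def)
  have "(\<lambda>n. \<integral>z. (cmod ((unit_coord m \<xi> z - unit_coord m (s n) z) + (unit_coord m \<eta> z - unit_coord m (t n) z)))\<^sup>2 \<partial>omega_inf) \<longlonglongrightarrow> 0"
    by (rule tendsto_integral_sq_add[OF _ _ st(3,4)])
       (use L smooth_sections_L2[OF st(1)] smooth_sections_L2[OF st(2)] in
         \<open>auto intro!: square_integrable_diff simp: L2_sections_iff\<close>)
  then have "(\<lambda>n. \<integral>z. (cmod (unit_coord m (\<lambda>x. \<xi> x + \<eta> x) z - unit_coord m (\<lambda>x. s n x + t n x) z))\<^sup>2 \<partial>omega_inf) \<longlonglongrightarrow> 0"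
    by (simp add: unit_coord_add algebra_simps)
  with L st smooth_sections_add show ?thesis
    unfolding L2_closure_def by (auto intro!: L2_sections_add exI[of _ "\<lambda>n x. s n x + t n x"])
qed

lemma L2_closure_scale:
  assumes "\<xi> \<in> L2_closure m"
  shows "(\<lambda>x. c * \<xi> x) \<in> L2_closure m"
proof -
  obtain s where s: "\<And>n::nat. s n \<in> smooth_sections m"
      "(\<lambda>n. \<integral>z. (cmod (unit_coord m \<xi> z - unit_coord m (s n) z))\<^sup>2 \<partial>omega_inf) \<longlonglongrightarrow> 0"
    using assms by (auto simp: L2_closure_def)
  have "(\<lambda>n. (cmod c)\<^sup>2 * (\<integral>z. (cmod (unit_coord m \<xi> z - unit_coord m (s n) z))\<^sup>2 \<partial>omega_inf)) \<longlonglongrightarrow> 0"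
    by (intro tendsto_mult_right_zero s)
  then have "(\<lambda>n. \<integral>z. (cmod (unit_coord m (\<lambda>x. c * \<xi> x) z - unit_coord m (\<lambda>x. c * s n x) z))\<^sup>2 \<partial>omega_inf) \<longlonglongrightarrow> 0"
    by (simp add: unit_coord_scale norm_mult power_mult_distrib flip: right_diff_distrib)
  with assms s smooth_sections_scale show ?thesis
    unfolding L2_closure_def by (auto intro!: L2_sections_scale exI[of _ "\<lambda>n x. c * s n x"])
qed

lemma L2_closure_L2: "\<xi> \<in> L2_closure m \<Longrightarrow> \<xi> \<in> L2_sections m"
  by (simp add: L2_closure_def)

lemma Hilb_add:
  assumes "\<xi> \<in> L2_sections m" "\<eta> \<in> L2_sections m"
  shows "vadd (Hilb m) (ae_class m \<xi>) (ae_class m \<eta>) = ae_class m (\<lambda>x. \<xi> x + \<eta> x)"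
proof -
  have "AE z in omega_inf. repr (ae_class m \<xi>) (1, z) + repr (ae_class m \<eta>) (1, z) = \<xi> (1, z) + \<eta> (1, z)"
    using repr_ae_class(2)[OF assms(1)] repr_ae_class(2)[OF assms(2)] by eventually_elim simp
  then show ?thesis by (simp add: Hilb_def ae_class_eqI)
qed

lemma Hilb_scale:
  assumes "\<xi> \<in> L2_sections m"
  shows "vscale (Hilb m) c (ae_class m \<xi>) = ae_class m (\<lambda>x. c * \<xi> x)"
proof -
  have "AE z in omega_inf. c * repr (ae_class m \<xi>) (1, z) = c * \<xi> (1, z)"
    using repr_ae_class(2)[OF assms(1)] by eventually_elim simp
  then show ?thesis by (simp add: Hilb_def ae_class_eqI)
qed

lemma Hilb_diff:
  assumes "\<xi> \<in> L2_sections m" "\<eta> \<in> L2_sections m"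
  shows "vadd (Hilb m) (ae_class m \<xi>) (vscale (Hilb m) (-1) (ae_class m \<eta>)) =
    ae_class m (\<lambda>x. \<xi> x - \<eta> x)"
  by (simp only: Hilb_scale[OF assms(2)] Hilb_add[OF assms(1) L2_sections_scale[OF assms(2)]]) simp

lemma Hilb_inn:
  assumes "\<xi> \<in> L2_sections m" "\<eta> \<in> L2_sections m"
  shows "inn (Hilb m) (ae_class m \<xi>) (ae_class m \<eta>) = L2_inner m \<xi> \<eta>"
  unfolding Hilb_def ip_space.simps by (intro L2_inner_cong_AE repr_ae_class assms)

lemma Hilb_nsq_diff:
  assumes "\<xi> \<in> L2_sections m" "\<eta> \<in> L2_sections m"
  shows "Re (inn (Hilb m) (vadd (Hilb m) (ae_class m \<xi>) (vscale (Hilb m) (-1) (ae_class m \<eta>)))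
      (vadd (Hilb m) (ae_class m \<xi>) (vscale (Hilb m) (-1) (ae_class m \<eta>)))) =
    (\<integral>z. (cmod (unit_coord m \<xi> z - unit_coord m \<eta> z))\<^sup>2 \<partial>omega_inf)"
  unfolding Hilb_diff[OF assms] Hilb_inn[OF L2_sections_diff[OF assms] L2_sections_diff[OF assms]]
    L2_inner_self unit_coord_diff by (rule Re_complex_of_real)

lemma unit_coord_surj:
  fixes g :: "complex \<Rightarrow> complex"
  obtains \<xi> where "is_section m \<xi>" "unit_coord m \<xi> = g"
proof (rule that)
  define \<xi> :: csection where
    "\<xi> x = fst x ^ m * (of_real (max 1 (cmod (snd x / fst x)) ^ m) * g (snd x / fst x))" for x
  show "is_section m \<xi>" unfolding is_section_def \<xi>_def scale_pair_def
    by (auto simp: power_mult_distrib)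
  show "unit_coord m \<xi> = g" using max_pow_ne_0 by (auto simp: unit_coord_def \<xi>_def fun_eq_iff)
qed

text \<open>The limit exists among all square integrable sections by Riesz-Fischer, and a diagonal
  sequence of smooth sections converges to it.\<close>

lemma L2_closure_complete:
  assumes s: "\<And>n::nat. \<xi> n \<in> L2_closure m"
    and cauchy: "\<And>e. e > 0 \<Longrightarrow> \<exists>N. \<forall>i\<ge>N. \<forall>j\<ge>N.
      (\<integral>z. (cmod (unit_coord m (\<xi> i) z - unit_coord m (\<xi> j) z))\<^sup>2 \<partial>omega_inf) < e"
  obtains \<zeta> where "\<zeta> \<in> L2_closure m"
    "(\<lambda>n. \<integral>z. (cmod (unit_coord m (\<xi> n) z - unit_coord m \<zeta> z))\<^sup>2 \<partial>omega_inf) \<longlonglongrightarrow> 0"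
proof -
  interpret finite_measure omega_inf by (rule finite_measure_omega_inf)
  have sq: "square_integrable omega_inf (unit_coord m (\<xi> n))" for n
    using L2_closure_L2[OF s] by (simp add: L2_sections_iff)
  obtain g where g: "square_integrable omega_inf g"
      "(\<lambda>n. \<integral>z. (cmod (unit_coord m (\<xi> n) z - g z))\<^sup>2 \<partial>omega_inf) \<longlonglongrightarrow> 0"
    by (rule square_integrable_complete[of "\<lambda>n. unit_coord m (\<xi> n)", OF sq cauchy])
  obtain \<zeta> where \<zeta>: "is_section m \<zeta>" "unit_coord m \<zeta> = g" by (rule unit_coord_surj)
  have "\<exists>t\<in>smooth_sections m. (\<integral>z. (cmod (unit_coord m (\<xi> n) z - unit_coord m t z))\<^sup>2 \<partial>omega_inf) < inverse (real (Suc n))" for n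
  proof -
    obtain u where u: "\<And>k::nat. u k \<in> smooth_sections m"
        "(\<lambda>k. \<integral>z. (cmod (unit_coord m (\<xi> n) z - unit_coord m (u k) z))\<^sup>2 \<partial>omega_inf) \<longlonglongrightarrow> 0"
      using s[of n] by (auto simp: L2_closure_def)
    have "\<forall>\<^sub>F k in sequentially. (\<integral>z. (cmod (unit_coord m (\<xi> n) z - unit_coord m (u k) z))\<^sup>2 \<partial>omega_inf) < inverse (real (Suc n))"
      by (rule order_tendstoD(2)[OF u(2)]) simp
    then show ?thesis using u(1) by (auto simp: eventually_sequentially)
  qed
  then obtain t where t: "\<And>n. t n \<in> smooth_sections m"
      "\<And>n. (\<integral>z. (cmod (unit_coord m (\<xi> n) z - unit_coord m (t n) z))\<^sup>2 \<partial>omega_inf) < inverse (real (Suc n))"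
    by metis
  have tsq: "square_integrable omega_inf (unit_coord m (t n))" for n
    using smooth_sections_L2[OF t(1)] by (simp add: L2_sections_iff)
  have t0: "(\<lambda>n. \<integral>z. (cmod (unit_coord m (\<xi> n) z - unit_coord m (t n) z))\<^sup>2 \<partial>omega_inf) \<longlonglongrightarrow> 0"
    by (rule real_tendsto_sandwich[OF _ _ tendsto_const LIMSEQ_inverse_real_of_nat])
       (auto intro!: always_eventually less_imp_le[OF t(2)] simp del: of_nat_Suc)
  have g': "(\<lambda>n. \<integral>z. (cmod (g z - unit_coord m (\<xi> n) z))\<^sup>2 \<partial>omega_inf) \<longlonglongrightarrow> 0"
    using g(2) by (simp only: norm_minus_commute)
  have "(\<lambda>n. \<integral>z. (cmod ((g z - unit_coord m (\<xi> n) z) + (unit_coord m (\<xi> n) z - unit_coord m (t n) z)))\<^sup>2 \<partial>omega_inf) \<longlonglongrightarrow> 0"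
    by (intro tendsto_integral_sq_add square_integrable_diff sq tsq g(1) g' t0)
  then have "\<zeta> \<in> L2_closure m"
    unfolding L2_closure_def using \<zeta> g(1) t(1) by (auto simp: L2_sections_iff)
  with \<zeta>(2) g(2) show ?thesis by (intro that[of \<zeta>]) simp_all
qed

lemma Hilb_complex_hilbert: "complex_hilbert (Hilb m)"
proof
  note [simp] = Hilb_add Hilb_scale Hilb_inn L2_sections_add L2_sections_scale L2_closure_L2
    L2_closure_add L2_closure_scale
  fix X Y assume X: "X \<in> carr (Hilb m)"
  then obtain \<xi> where \<xi>: "X = ae_class m \<xi>" "\<xi> \<in> L2_closure m" by (auto simp: carr_Hilb)
  show "vscale (Hilb m) c X \<in> carr (Hilb m)" for c
    using \<xi> by (simp add: carr_Hilb)
  show "0 \<le> Re (inn (Hilb m) X X)" using \<xi> by (simp add: L2_inner_self)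
  assume Y: "Y \<in> carr (Hilb m)"
  then obtain \<eta> where \<eta>: "Y = ae_class m \<eta>" "\<eta> \<in> L2_closure m" by (auto simp: carr_Hilb)
  show "vadd (Hilb m) X Y \<in> carr (Hilb m)" using \<xi> \<eta> by (simp add: carr_Hilb)
  show "inn (Hilb m) (vscale (Hilb m) c X) Y = c * inn (Hilb m) X Y" for c
    using \<xi> \<eta> by (simp add: L2_inner_eq unit_coord_scale mult.assoc)
  show "inn (Hilb m) Y X = cnj (inn (Hilb m) X Y)"
    using \<xi> \<eta> Bochner_Integration.integral_cnj[of omega_inf "\<lambda>z. unit_coord m \<xi> z * cnj (unit_coord m \<eta> z)"]
    by (simp add: L2_inner_eq mult.commute)
  show "inn (Hilb m) (vadd (Hilb m) X Y) Z = inn (Hilb m) X Z + inn (Hilb m) Y Z"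
    if "Z \<in> carr (Hilb m)" for Z
  proof -
    from that obtain \<zeta> where \<zeta>: "Z = ae_class m \<zeta>" "\<zeta> \<in> L2_closure m" by (auto simp: carr_Hilb)
    then show ?thesis using \<xi> \<eta>
      by (simp add: L2_inner_eq unit_coord_add distrib_right unit_coord_integrable)
  qed
  show "X = Y" if "Re (inn (Hilb m) (vadd (Hilb m) X (vscale (Hilb m) (- 1) Y))
      (vadd (Hilb m) X (vscale (Hilb m) (- 1) Y))) = 0"
  proof -
    have L: "\<xi> \<in> L2_sections m" "\<eta> \<in> L2_sections m" using \<xi> \<eta> by auto
    have "(\<integral>z. (cmod (unit_coord m \<xi> z - unit_coord m \<eta> z))\<^sup>2 \<partial>omega_inf) = 0"
      using that unfolding \<xi>(1) \<eta>(1) Hilb_nsq_diff[OF L] .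
    moreover have "integrable omega_inf (\<lambda>z. (cmod (unit_coord m \<xi> z - unit_coord m \<eta> z))\<^sup>2)"
      using L square_integrable_diff by (auto simp: L2_sections_iff square_integrable_def)
    ultimately have "AE z in omega_inf. (cmod (unit_coord m \<xi> z - unit_coord m \<eta> z))\<^sup>2 = 0"
      by (subst integral_nonneg_eq_0_iff_AE[symmetric]) auto
    then have "AE z in omega_inf. \<xi> (1, z) = \<eta> (1, z)"
      by eventually_elim (use max_pow_ne_0 in \<open>simp add: unit_coord_def\<close>)
    then show ?thesis unfolding \<xi>(1) \<eta>(1) by (rule ae_class_eqI)
  qed
next
  fix s :: "nat \<Rightarrow> csection set"
  assume s: "\<And>n. s n \<in> carr (Hilb m)" and cauchy: "\<And>e. e > 0 \<Longrightarrow> \<exists>N. \<forall>i\<ge>N. \<forall>j\<ge>N.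
     Re (inn (Hilb m) (vadd (Hilb m) (s i) (vscale (Hilb m) (-1) (s j)))
       (vadd (Hilb m) (s i) (vscale (Hilb m) (-1) (s j)))) < e"
  from s have "\<forall>n. \<exists>\<xi>\<in>L2_closure m. s n = ae_class m \<xi>" by (auto simp: carr_Hilb)
  then obtain \<xi> where \<xi>: "\<And>n. \<xi> n \<in> L2_closure m" "\<And>n. s n = ae_class m (\<xi> n)" by metis
  have L: "\<xi> n \<in> L2_sections m" for n using \<xi>(1) by (rule L2_closure_L2)
  obtain \<zeta> where \<zeta>: "\<zeta> \<in> L2_closure m"
    "(\<lambda>n. \<integral>z. (cmod (unit_coord m (\<xi> n) z - unit_coord m \<zeta> z))\<^sup>2 \<partial>omega_inf) \<longlonglongrightarrow> 0"
    by (rule L2_closure_complete[OF \<xi>(1) cauchy[unfolded \<xi>(2) Hilb_nsq_diff[OF L L]]])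
  show "\<exists>x\<in>carr (Hilb m). (\<lambda>n. Re (inn (Hilb m) (vadd (Hilb m) (s n) (vscale (Hilb m) (-1) x))
     (vadd (Hilb m) (s n) (vscale (Hilb m) (-1) x)))) \<longlonglongrightarrow> 0"
  proof (rule bexI[of _ "ae_class m \<zeta>"])
    show "ae_class m \<zeta> \<in> carr (Hilb m)" using \<zeta> by (simp add: carr_Hilb)
  qed (use \<zeta>(2) in \<open>simp only: \<xi>(2) Hilb_nsq_diff[OF L L2_closure_L2[OF \<zeta>(1)]]\<close>)
qed

section \<open>Wirtinger derivatives\<close>

text \<open>The complex coordinates of a real derivative: \<open>a\<close> is \<open>\<partial>f/\<partial>z\<close> and \<open>b\<close> is
  \<open>\<partial>f/\<partial>(cnj z)\<close>.\<close>

definition has_wirtinger :: "(complex \<Rightarrow> complex) \<Rightarrow> complex \<Rightarrow> complex \<Rightarrow> complex \<Rightarrow> bool" where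
  "has_wirtinger f a b z \<longleftrightarrow> (f has_derivative (\<lambda>h. a * h + b * cnj h)) (at z)"

lemma has_wirtinger_imp_eq:
  assumes "has_wirtinger f a b z"
  shows "dd_z f z = a" "dd_zbar f z = b"
proof -
  have "frechet_derivative f (at z) = (\<lambda>h. a * h + b * cnj h)"
    using assms unfolding has_wirtinger_def by (rule frechet_derivative_at[symmetric])
  then show "dd_z f z = a" "dd_zbar f z = b"
    by (simp_all add: dd_z_def dd_zbar_def algebra_simps)
qed

lemma C_inf_differentiable: "C_inf f \<Longrightarrow> f differentiable (at z)"
  unfolding C_inf_def by (metis C_k.simps(2))

lemma C_inf_has_wirtinger:
  assumes "C_inf f"
  shows "has_wirtinger f (dd_z f z) (dd_zbar f z) z"
proof -
  let ?D = "frechet_derivative f (at z)"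
  have D: "(f has_derivative ?D) (at z)"
    using C_inf_differentiable[OF assms] by (simp add: frechet_derivative_works)
  then have lin: "linear ?D" by (rule has_derivative_linear)
  have "?D h = dd_z f z * h + dd_zbar f z * cnj h" for h
  proof -
    have "h = Re h *\<^sub>R 1 + Im h *\<^sub>R \<i>" by (simp add: complex_eq_iff)
    then have "?D h = ?D (Re h *\<^sub>R 1 + Im h *\<^sub>R \<i>)" by (rule arg_cong)
    also have "\<dots> = Re h *\<^sub>R ?D 1 + Im h *\<^sub>R ?D \<i>"
      using lin by (simp add: linear_add linear_scale)
    also have "\<dots> = dd_z f z * (of_real (Re h) + \<i> * of_real (Im h)) +
        dd_zbar f z * (of_real (Re h) - \<i> * of_real (Im h))"
      by (simp add: dd_z_def dd_zbar_def scaleR_conv_of_real field_simps)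
    also have "\<dots> = dd_z f z * h + dd_zbar f z * cnj h"
      by (simp add: complex_eq[symmetric] complex_eq_iff)
    finally show ?thesis .
  qed
  then have "?D = (\<lambda>h. dd_z f z * h + dd_zbar f z * cnj h)" by (rule ext)
  with D show ?thesis by (simp add: has_wirtinger_def)
qed

lemma C_inf_frechet:
  assumes "C_inf f" shows "C_inf (\<lambda>z. frechet_derivative f (at z) v)"
  using assms unfolding C_inf_def by (metis C_k.simps(2))

lemma C_inf_cmult: "C_inf f \<Longrightarrow> C_inf (\<lambda>z. c * f z)"
  by (intro C_inf_mult C_inf_const)

lemma C_inf_dd_z: "C_inf f \<Longrightarrow> C_inf (dd_z f)"
proof -
  assume "C_inf f"
  then have "C_inf (\<lambda>z. (1/2) * frechet_derivative f (at z) 1 + (-\<i>/2) * frechet_derivative f (at z) \<i>)"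
    by (intro C_inf_add C_inf_cmult C_inf_frechet)
  then show ?thesis by (simp add: dd_z_def[abs_def] diff_divide_distrib)
qed

lemma C_inf_dd_zbar: "C_inf f \<Longrightarrow> C_inf (dd_zbar f)"
proof -
  assume "C_inf f"
  then have "C_inf (\<lambda>z. (1/2) * frechet_derivative f (at z) 1 + (\<i>/2) * frechet_derivative f (at z) \<i>)"
    by (intro C_inf_add C_inf_cmult C_inf_frechet)
  then show ?thesis by (simp add: dd_zbar_def[abs_def] add_divide_distrib)
qed

lemma has_wirtinger_const: "has_wirtinger (\<lambda>_. c) 0 0 z"
  by (simp add: has_wirtinger_def)

lemma has_wirtinger_ident: "has_wirtinger (\<lambda>z. z) 1 0 z"
  by (simp add: has_wirtinger_def)

lemma has_wirtinger_add:
  assumes "has_wirtinger f a b z" "has_wirtinger g c d z"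
  shows "has_wirtinger (\<lambda>z. f z + g z) (a + c) (b + d) z"
  using has_derivative_add[OF assms[unfolded has_wirtinger_def]]
  by (simp add: has_wirtinger_def algebra_simps)

lemma has_wirtinger_mult:
  assumes "has_wirtinger f a b z" "has_wirtinger g c d z"
  shows "has_wirtinger (\<lambda>z. f z * g z) (f z * c + a * g z) (f z * d + b * g z) z"
  using has_derivative_mult[OF assms[unfolded has_wirtinger_def]]
  by (simp add: has_wirtinger_def algebra_simps)

lemma has_wirtinger_inverse:
  assumes "has_wirtinger f a b z" "f z \<noteq> 0"
  shows "has_wirtinger (\<lambda>z. inverse (f z)) (- a / (f z)\<^sup>2) (- b / (f z)\<^sup>2) z"
  using Deriv.has_derivative_inverse[OF assms(2) assms(1)[unfolded has_wirtinger_def]]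
  by (simp add: has_wirtinger_def divide_inverse power2_eq_square algebra_simps)

lemma has_wirtinger_cnj:
  assumes "has_wirtinger f a b z"
  shows "has_wirtinger (\<lambda>z. cnj (f z)) (cnj b) (cnj a) z"
  using bounded_linear.has_derivative[OF bounded_linear_cnj assms[unfolded has_wirtinger_def]]
  by (simp add: has_wirtinger_def add.commute)

lemma has_wirtinger_power:
  assumes "has_wirtinger f a b z"
  shows "has_wirtinger (\<lambda>z. f z ^ n) (of_nat n * f z ^ (n - 1) * a) (of_nat n * f z ^ (n - 1) * b) z"
proof (induction n)
  case 0
  then show ?case by (simp add: has_wirtinger_const)
next
  case (Suc n)
  from has_wirtinger_mult[OF assms Suc] show ?case
    by (cases n) (simp_all add: algebra_simps)
qed

lemma has_wirtinger_compose_inverse: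
  assumes "has_wirtinger f a b (inverse z)" "z \<noteq> 0"
  shows "has_wirtinger (\<lambda>z. f (inverse z)) (- a / z\<^sup>2) (- b / (cnj z)\<^sup>2) z"
proof -
  have "(inverse has_derivative (\<lambda>h. - (inverse z * h * inverse z))) (at z)"
    using assms(2) by (rule has_derivative_inverse')
  from has_derivative_compose[OF this assms(1)[unfolded has_wirtinger_def]] show ?thesis
    by (simp add: has_wirtinger_def divide_inverse power2_eq_square algebra_simps)
qed

lemma has_wirtinger_transform:
  assumes "has_wirtinger f a b z" "open S" "z \<in> S" "\<And>u. u \<in> S \<Longrightarrow> f u = g u"
  shows "has_wirtinger g a b z"
  using has_derivative_transform_within_open[OF assms(1)[unfolded has_wirtinger_def] assms(2-4)]
  by (simp add: has_wirtinger_def)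

section \<open>Integrals of derivatives over the plane\<close>

lemma lborel_complex:
  "distr (lborel \<Otimes>\<^sub>M lborel) borel (\<lambda>(x, y). Complex x y) = (lborel :: complex measure)"
proof (rule lborel_eqI[symmetric])
  have [measurable]: "(\<lambda>(x, y). Complex x y) \<in> borel_measurable (lborel \<Otimes>\<^sub>M lborel)"
    unfolding Complex_eq split_beta by measurable
  fix l u :: complex assume le: "\<And>b. b \<in> Basis \<Longrightarrow> l \<bullet> b \<le> u \<bullet> b"
  have lu: "Re l \<le> Re u" "Im l \<le> Im u"
    using le[of 1] le[of \<i>] by (simp_all add: Basis_complex_def inner_complex_def)
  have "(\<lambda>(x, y). Complex x y) -` box l u \<inter> space (lborel \<Otimes>\<^sub>M lborel) =
      {Re l<..<Re u} \<times> {Im l<..<Im u}"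
    by (auto simp: box_def Basis_complex_def inner_complex_def space_pair_measure)
  then have "emeasure (distr (lborel \<Otimes>\<^sub>M lborel) borel (\<lambda>(x, y). Complex x y)) (box l u) =
      emeasure (lborel \<Otimes>\<^sub>M lborel) ({Re l<..<Re u} \<times> {Im l<..<Im u})"
    by (subst emeasure_distr) auto
  also have "\<dots> = ennreal (Re u - Re l) * ennreal (Im u - Im l)"
    using lu by (subst lborel.emeasure_pair_measure_Times) auto
  also have "\<dots> = (\<Prod>b\<in>Basis. (u - l) \<bullet> b)"
    using lu by (simp add: Basis_complex_def inner_complex_def ennreal_mult)
  finally show "emeasure (distr (lborel \<Otimes>\<^sub>M lborel) borel (\<lambda>(x, y). Complex x y)) (box l u) =
      ennreal (\<Prod>b\<in>Basis. (u - l) \<bullet> b)" .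
qed simp

lemma measurable_Complex [measurable]: "(\<lambda>(x, y). Complex x y) \<in> borel_measurable (lborel \<Otimes>\<^sub>M lborel)"
  unfolding Complex_eq split_beta by measurable

lemma integral_complex_iterated:
  fixes f :: "complex \<Rightarrow> complex"
  assumes f: "integrable lborel f"
  shows "(\<integral>z. f z \<partial>lborel) = (\<integral>x. (\<integral>y. f (Complex x y) \<partial>lborel) \<partial>lborel)"
    and "integrable lborel (\<lambda>x. \<integral>y. f (Complex x y) \<partial>lborel)"
    and "(\<integral>z. f z \<partial>lborel) = (\<integral>y. (\<integral>x. f (Complex x y) \<partial>lborel) \<partial>lborel)"
    and "integrable lborel (\<lambda>y. \<integral>x. f (Complex x y) \<partial>lborel)"
proof -
  have [measurable]: "f \<in> borel_measurable borel" using borel_measurable_integrable[OF f] by simp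
  have int: "integrable (lborel \<Otimes>\<^sub>M lborel) (\<lambda>(x, y). f (Complex x y))"
    using f unfolding lborel_complex[symmetric]
    by (subst (asm) integrable_distr_eq) (auto simp: case_prod_unfold)
  have eq: "(\<integral>z. f z \<partial>lborel) = (\<integral>p. (case p of (x, y) \<Rightarrow> f (Complex x y)) \<partial>(lborel \<Otimes>\<^sub>M lborel))"
    by (subst lborel_complex[symmetric], subst integral_distr) (auto simp: case_prod_unfold)
  show "(\<integral>z. f z \<partial>lborel) = (\<integral>x. (\<integral>y. f (Complex x y) \<partial>lborel) \<partial>lborel)"
    unfolding eq using lborel_pair.integral_fst[OF int] by simp
  show "(\<integral>z. f z \<partial>lborel) = (\<integral>y. (\<integral>x. f (Complex x y) \<partial>lborel) \<partial>lborel)"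
    unfolding eq using lborel_pair.integral_snd[OF int] by simp
  show "integrable lborel (\<lambda>x. \<integral>y. f (Complex x y) \<partial>lborel)"
    using lborel_pair.integrable_fst[OF int] by simp
  show "integrable lborel (\<lambda>y. \<integral>x. f (Complex x y) \<partial>lborel)"
    using lborel_pair.integrable_snd[OF int] by simp
qed

text \<open>The finite exceptional set is for the points where a line meets the unit circle, across which
  the metrics are only continuous.\<close>

lemma lebesgue_FTC_finite:
  fixes f f' :: "real \<Rightarrow> complex"
  assumes "R \<ge> 0" "finite S" "continuous_on UNIV f"
    and "\<And>x. x \<notin> S \<Longrightarrow> (f has_vector_derivative f' x) (at x)"
    and [measurable]: "f' \<in> borel_measurable borel" and bd: "\<And>x. cmod (f' x) \<le> B"
  shows "(\<integral>x. indicator {-R..R} x *\<^sub>R f' x \<partial>lborel) = f R - f (-R)"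
proof -
  have "(f' has_integral (f R - f (-R))) {-R..R}"
    by (rule fundamental_theorem_of_calculus_interior_strong[of S])
       (use assms in \<open>auto intro: continuous_on_subset\<close>)
  moreover have "set_integrable lborel {-R..R} f'"
    unfolding set_integrable_def
  proof (rule Bochner_Integration.integrable_bound[where f = "\<lambda>x. B * indicator {-R..R} x"])
    show "AE x in lborel. norm (indicator {-R..R} x *\<^sub>R f' x) \<le> norm (B * indicator {-R..R} x)"
      using bd order_trans[OF norm_ge_zero bd] by (auto simp: indicator_def)
    show "integrable lborel (\<lambda>x. B * indicator {-R..R} x)"
      by (intro integrable_mult_right integrable_real_indicator) (use assms(1) in auto)
  qed auto
  then have "(\<integral>x. indicator {-R..R} x *\<^sub>R f' x \<partial>lborel) = integral {-R..R} f'"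
    using set_borel_integral_eq_integral(2)[of "{-R..R}" f'] by (simp add: set_lebesgue_integral_def)
  ultimately show ?thesis by (simp add: integral_unique)
qed

lemma finite_unit_circle_slice: "finite {x. cmod (Complex x y) = 1}" "finite {x. cmod (Complex y x) = 1}"
proof -
  have "x = sqrt (1 - y\<^sup>2) \<or> x = - sqrt (1 - y\<^sup>2)" if "x\<^sup>2 + y\<^sup>2 = 1" for x
  proof -
    have "sqrt (1 - y\<^sup>2) = \<bar>x\<bar>" using that by (simp add: eq_diff_eq[symmetric] flip: real_sqrt_abs)
    then show ?thesis by auto
  qed
  then have sub: "{x. x\<^sup>2 + y\<^sup>2 = 1} \<subseteq> {sqrt (1 - y\<^sup>2), - sqrt (1 - y\<^sup>2)}" by blast
  have eq: "{x. cmod (Complex x y) = 1} = {x. x\<^sup>2 + y\<^sup>2 = 1}" "{x. cmod (Complex y x) = 1} = {x. x\<^sup>2 + y\<^sup>2 = 1}"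
    by (auto simp: cmod_def add.commute)
  show "finite {x. cmod (Complex x y) = 1}" "finite {x. cmod (Complex y x) = 1}"
    unfolding eq using sub by (rule finite_subset; simp)+
qed

lemma has_wirtinger_horizontal:
  assumes "has_wirtinger G a b (Complex x y)"
  shows "((\<lambda>x. G (Complex x y)) has_vector_derivative (a + b)) (at x)"
proof -
  have "((\<lambda>x. Complex x y) has_derivative (\<lambda>h. of_real h)) (at x)"
    unfolding Complex_eq by (auto intro!: derivative_eq_intros)
  from has_derivative_compose[OF this assms[unfolded has_wirtinger_def]] show ?thesis
    by (simp add: has_vector_derivative_def scaleR_conv_of_real algebra_simps)
qed

lemma has_wirtinger_vertical:
  assumes "has_wirtinger G a b (Complex x y)"
  shows "((\<lambda>y. G (Complex x y)) has_vector_derivative (\<i> * (a - b))) (at y)"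
proof -
  have "((\<lambda>y. Complex x y) has_derivative (\<lambda>h. \<i> * of_real h)) (at y)"
    unfolding Complex_eq by (auto intro!: derivative_eq_intros)
  from has_derivative_compose[OF this assms[unfolded has_wirtinger_def]] show ?thesis
    by (simp add: has_vector_derivative_def scaleR_conv_of_real algebra_simps)
qed

lemma integrable_square:
  fixes f :: "complex \<Rightarrow> complex"
  assumes [measurable]: "f \<in> borel_measurable borel" and bd: "\<And>z. cmod (f z) \<le> B"
  shows "integrable lborel (\<lambda>z. indicator (cbox (Complex (-R) (-R)) (Complex R R)) z *\<^sub>R f z)"
proof (rule Bochner_Integration.integrable_bound
    [where f = "\<lambda>z. B * indicator (cbox (Complex (-R) (-R)) (Complex R R)) z"])
  show "AE z in lborel. norm (indicator (cbox (Complex (-R) (-R)) (Complex R R)) z *\<^sub>R f z)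
      \<le> norm (B * indicator (cbox (Complex (-R) (-R)) (Complex R R)) z)"
    using bd order_trans[OF norm_ge_zero bd] by (auto simp: indicator_def)
  show "integrable lborel (\<lambda>z. B * indicator (cbox (Complex (-R) (-R)) (Complex R R)) z)"
    by (intro integrable_mult_right integrable_real_indicator emeasure_bounded_finite bounded_cbox) simp
qed simp

lemma indicator_square:
  "indicator (cbox (Complex (-R) (-R)) (Complex R R)) (Complex x y) =
    (indicator {-R..R} x * indicator {-R..R} y :: real)"
  by (auto simp: indicator_def in_cbox_complex_iff)

lemma norm_integral_strip:
  fixes F :: "real \<Rightarrow> complex"
  assumes "integrable lborel (\<lambda>y. indicator {-R..R} y *\<^sub>R F y)" "R \<ge> 0"
    and "\<And>y. y \<in> {-R..R} \<Longrightarrow> cmod (F y) \<le> e" "e \<ge> 0"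
  shows "cmod (\<integral>y. indicator {-R..R} y *\<^sub>R F y \<partial>lborel) \<le> 2 * R * e"
proof -
  have "cmod (\<integral>y. indicator {-R..R} y *\<^sub>R F y \<partial>lborel) \<le> (\<integral>y. e * indicator {-R..R} y \<partial>lborel)"
  proof (rule Bochner_Integration.integral_norm_bound_integral[OF assms(1)])
    show "integrable lborel (\<lambda>y. e * indicator {-R..R} y)"
      by (intro integrable_mult_right integrable_real_indicator) (use assms(2) in auto)
  qed (use assms in \<open>auto simp: indicator_def\<close>)
  then show ?thesis using assms(2) by (simp add: mult_ac)
qed

lemma cmod_half_diff: "\<lbrakk>cmod x \<le> e; cmod y \<le> e\<rbrakk> \<Longrightarrow> cmod ((x - \<i> * y) / 2) \<le> e"
  using norm_triangle_ineq4[of x "\<i> * y"] by (simp add: norm_divide norm_mult)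

text \<open>Integrate over the square with half side \<open>R\<close>. On each horizontal and each vertical line the
  fundamental theorem of calculus holds, because the line meets the unit circle in at most two
  points and \<open>G\<close> is continuous there. This leaves boundary terms of order
  \<open>R * (C / R\<^sup>2)\<close>, which vanish as \<open>R\<close> grows.\<close>

lemma integral_dz_eq_0:
  fixes G a b :: "complex \<Rightarrow> complex"
  assumes cont: "continuous_on UNIV G"
    and deriv: "\<And>z. cmod z \<noteq> 1 \<Longrightarrow> has_wirtinger G (a z) (b z) z"
    and [measurable]: "a \<in> borel_measurable borel" "b \<in> borel_measurable borel"
    and a: "\<And>z. cmod (a z) \<le> K / max 1 (cmod z) ^ 4" and b: "\<And>z. cmod (b z) \<le> K"
    and G: "\<And>z. cmod (G z) \<le> C / max 1 (cmod z) ^ 2"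
  shows "integrable lborel a" "(\<integral>z. a z \<partial>lborel) = 0"
proof -
  have K: "K \<ge> 0" using order_trans[OF norm_ge_zero b] .
  have C: "C \<ge> 0" using order_trans[OF norm_ge_zero G[of 0]] by simp
  have pow: "K / max 1 (cmod z) ^ 4 \<le> K" for z
    using K by (simp add: divide_le_eq mult_left_le_one_le mult_le_cancel_left1 one_le_power)
  have aK: "cmod (a z) \<le> K" for z using a pow order_trans by blast
  show int_a: "integrable lborel a"
  proof (rule Bochner_Integration.integrable_bound)
    show "integrable lborel (\<lambda>z. K * (1 / max 1 (cmod z) ^ 4))"
      by (intro integrable_mult_right integrable_max_pow4)
    show "AE z in lborel. norm (a z) \<le> norm (K * (1 / max 1 (cmod z) ^ 4))"
      using a K by simp
  qed simp
  have GR: "cmod (G z) \<le> C / R\<^sup>2" if "R \<ge> 1" "cmod z \<ge> R" for z R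
  proof -
    have "C / max 1 (cmod z) ^ 2 \<le> C / R\<^sup>2"
      by (rule frac_le[OF C order_refl]) (use that in \<open>auto intro!: power_mono\<close>)
    with G[of z] show ?thesis by linarith
  qed
  have sq: "cmod (\<integral>z. indicator (cbox (Complex (-R) (-R)) (Complex R R)) z *\<^sub>R a z \<partial>lborel) \<le> 4 * C / R"
    if R: "R \<ge> 1" for R
  proof -
    let ?S = "cbox (Complex (-R) (-R)) (Complex R R)"
    define gx gy where "gx z = a z + b z" and "gy z = \<i> * (a z - b z)" for z
    have [measurable]: "gx \<in> borel_measurable borel" "gy \<in> borel_measurable borel"
      unfolding gx_def gy_def by measurable
    have bx: "cmod (gx z) \<le> 2 * K" and by_: "cmod (gy z) \<le> 2 * K" for z
      using aK[of z] b[of z] norm_triangle_ineq[of "a z" "b z"] norm_triangle_ineq4[of "a z" "b z"]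
      by (simp_all add: gx_def gy_def norm_mult)
    have [measurable]: "(\<lambda>x. Complex x y) \<in> borel_measurable borel"
        "(\<lambda>x. Complex y x) \<in> borel_measurable borel" for y
      unfolding Complex_eq by measurable
    have GRx: "cmod (G (Complex R y)) \<le> C / R\<^sup>2" "cmod (G (Complex (-R) y)) \<le> C / R\<^sup>2"
      "cmod (G (Complex y R)) \<le> C / R\<^sup>2" "cmod (G (Complex y (-R))) \<le> C / R\<^sup>2" for y
      using R abs_Re_le_cmod[of "Complex R y"] abs_Re_le_cmod[of "Complex (-R) y"]
        abs_Im_le_cmod[of "Complex y R"] abs_Im_le_cmod[of "Complex y (-R)"]
      by (auto intro!: GR)
    have cG: "continuous_on UNIV (\<lambda>x. G (Complex x y))" "continuous_on UNIV (\<lambda>x. G (Complex y x))" for y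
      unfolding Complex_eq by (intro continuous_on_compose2[OF cont] continuous_intros; simp)+
    have hor: "(\<integral>x. indicator {-R..R} x *\<^sub>R gx (Complex x y) \<partial>lborel) = G (Complex R y) - G (Complex (-R) y)" for y
      by (rule lebesgue_FTC_finite[where f = "\<lambda>x. G (Complex x y)", OF _ finite_unit_circle_slice(1) cG(1)])
         (use R bx deriv in \<open>auto simp: gx_def intro!: has_wirtinger_horizontal\<close>)
    have ver: "(\<integral>y. indicator {-R..R} y *\<^sub>R gy (Complex x y) \<partial>lborel) = G (Complex x R) - G (Complex x (-R))" for x
      by (rule lebesgue_FTC_finite[where f = "\<lambda>y. G (Complex x y)", OF _ finite_unit_circle_slice(2) cG(2)])
         (use R by_ deriv in \<open>auto simp: gy_def intro!: has_wirtinger_vertical\<close>)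
    have hb: "cmod (G (Complex R y) - G (Complex (-R) y)) \<le> 2 * C / R\<^sup>2" for y
      using norm_triangle_ineq4[of "G (Complex R y)" "G (Complex (-R) y)"] GRx[of y] by simp
    have vb: "cmod (G (Complex y R) - G (Complex y (-R))) \<le> 2 * C / R\<^sup>2" for y
      using norm_triangle_ineq4[of "G (Complex y R)" "G (Complex y (-R))"] GRx[of y] by simp
    have Ix: "integrable lborel (\<lambda>z. indicator ?S z *\<^sub>R gx z)"
     and Iy: "integrable lborel (\<lambda>z. indicator ?S z *\<^sub>R gy z)"
      by (rule integrable_square[OF _ bx] integrable_square[OF _ by_], simp)+
    have eqx: "(\<integral>x. indicator ?S (Complex x y) *\<^sub>R gx (Complex x y) \<partial>lborel) =
        indicator {-R..R} y *\<^sub>R (G (Complex R y) - G (Complex (-R) y))" for y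
      unfolding hor[symmetric] integral_scaleR_right[symmetric]
      by (simp add: indicator_square mult.commute)
    have eqy: "(\<integral>y. indicator ?S (Complex x y) *\<^sub>R gy (Complex x y) \<partial>lborel) =
        indicator {-R..R} x *\<^sub>R (G (Complex x R) - G (Complex x (-R)))" for x
      unfolding ver[symmetric] integral_scaleR_right[symmetric]
      by (simp add: indicator_square)
    have Re: "2 * R * (2 * C / R\<^sup>2) = 4 * C / R" using R by (simp add: power2_eq_square)
    have e0: "0 \<le> 2 * C / R\<^sup>2" using C by simp
    have R0: "0 \<le> R" using R by simp
    have "cmod (\<integral>z. indicator ?S z *\<^sub>R gx z \<partial>lborel) \<le> 4 * C / R"
      using norm_integral_strip[OF integral_complex_iterated(4)[OF Ix, unfolded eqx] R0 hb e0]
      unfolding integral_complex_iterated(3)[OF Ix] eqx Re .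
    moreover have "cmod (\<integral>z. indicator ?S z *\<^sub>R gy z \<partial>lborel) \<le> 4 * C / R"
      using norm_integral_strip[OF integral_complex_iterated(2)[OF Iy, unfolded eqy] R0 vb e0]
      unfolding integral_complex_iterated(1)[OF Iy] eqy Re .
    moreover have "(\<integral>z. indicator ?S z *\<^sub>R a z \<partial>lborel) =
        ((\<integral>z. indicator ?S z *\<^sub>R gx z \<partial>lborel) - \<i> * (\<integral>z. indicator ?S z *\<^sub>R gy z \<partial>lborel)) / 2"
    proof -
      have "(\<integral>z. indicator ?S z *\<^sub>R a z \<partial>lborel) =
          (\<integral>z. (indicator ?S z *\<^sub>R gx z - \<i> * (indicator ?S z *\<^sub>R gy z)) / 2 \<partial>lborel)"
        by (intro Bochner_Integration.integral_cong refl)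
           (simp add: gx_def gy_def scaleR_conv_of_real field_simps)
      then show ?thesis
        by (simp only: integral_divide_zero integral_mult_right_zero
            Bochner_Integration.integral_diff[OF Ix integrable_mult_right[OF Iy]])
    qed
    ultimately show ?thesis by (simp only: cmod_half_diff)
  qed
  let ?S = "\<lambda>n::nat. cbox (Complex (- real (Suc n)) (- real (Suc n))) (Complex (real (Suc n)) (real (Suc n)))"
  have lim: "(\<lambda>n. \<integral>z. indicator (?S n) z *\<^sub>R a z \<partial>lborel) \<longlonglongrightarrow> (\<integral>z. a z \<partial>lborel)"
  proof (rule integral_dominated_convergence[where w = "\<lambda>z. cmod (a z)"])
    show "AE z in lborel. (\<lambda>n. indicator (?S n) z *\<^sub>R a z) \<longlonglongrightarrow> a z"
    proof (intro AE_I2 tendsto_eventually)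
      fix z
      obtain N where N: "cmod z \<le> real N" using real_arch_simple by blast
      have "z \<in> ?S n" if "n \<ge> N" for n
      proof -
        have "cmod z \<le> real (Suc n)" using N that by linarith
        then show ?thesis using abs_Re_le_cmod[of z] abs_Im_le_cmod[of z]
          by (auto simp: in_cbox_complex_iff)
      qed
      then show "\<forall>\<^sub>F n in sequentially. indicator (?S n) z *\<^sub>R a z = a z"
        by (auto simp: eventually_sequentially intro!: exI[of _ N])
    qed
    show "AE z in lborel. norm (indicator (?S n) z *\<^sub>R a z) \<le> cmod (a z)" for n
      by (auto simp: indicator_def)
  qed (use int_a in auto)
  have "(\<lambda>n. \<integral>z. indicator (?S n) z *\<^sub>R a z \<partial>lborel) \<longlonglongrightarrow> 0"
  proof (rule Lim_null_comparison)
    show "\<forall>\<^sub>F n in sequentially. norm (\<integral>z. indicator (?S n) z *\<^sub>R a z \<partial>lborel) \<le> 4 * C * inverse (real (Suc n))"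
      using sq by (intro always_eventually allI) (metis divide_inverse le_add1 of_nat_1 of_nat_le_iff plus_1_eq_Suc)
    show "(\<lambda>n. 4 * C * inverse (real (Suc n))) \<longlonglongrightarrow> 0"
      by (intro tendsto_mult_right_zero LIMSEQ_inverse_real_of_nat)
  qed
  with lim show "(\<integral>z. a z \<partial>lborel) = 0" using LIMSEQ_unique by blast
qed

section \<open>Change of chart\<close>

lemma has_wirtinger_sum:
  assumes "finite A" "\<And>k. k \<in> A \<Longrightarrow> has_wirtinger (f k) (a k) (b k) z"
  shows "has_wirtinger (\<lambda>z. \<Sum>k\<in>A. f k z) (\<Sum>k\<in>A. a k) (\<Sum>k\<in>A. b k) z"
  using assms by (induction A) (simp_all add: has_wirtinger_const has_wirtinger_add)

lemma C_inf_ident: "C_inf (\<lambda>z. z)"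
  by (intro C_inf_bounded_linear bounded_linear_ident)

lemma C_inf_cnj: "C_inf cnj"
  by (intro C_inf_bounded_linear bounded_linear_cnj)

lemma C_inf_cnj_comp:
  assumes "C_inf f" shows "C_inf (\<lambda>z. cnj (f z))"
proof -
  have "C_k n (\<lambda>z. cnj (f z))" if "C_k n f" for n
    using that
  proof (induction n arbitrary: f)
    case 0
    then show ?case by (auto intro: continuous_intros)
  next
    case (Suc n)
    then have D: "(f has_derivative frechet_derivative f (at z)) (at z)" for z
      by (auto simp: frechet_derivative_works)
    have D': "((\<lambda>z. cnj (f z)) has_derivative (\<lambda>v. cnj (frechet_derivative f (at z) v))) (at z)" for z
      by (rule bounded_linear.has_derivative[OF bounded_linear_cnj D])
    then have "frechet_derivative (\<lambda>z. cnj (f z)) (at z) v = cnj (frechet_derivative f (at z) v)" for z v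
      using frechet_derivative_at by metis
    with Suc D' show ?case by (auto simp: differentiable_def)
  qed
  with assms show ?thesis by (simp add: C_inf_def)
qed

lemma smooth_section_charts:
  assumes "\<xi> \<in> smooth_sections m"
  shows "is_section m \<xi>" "C_inf (\<lambda>z. \<xi> (1, z))" "C_inf (\<lambda>w. \<xi> (w, 1))"
  using assms by (auto simp: smooth_sections_def)

text \<open>For \<open>u(z) = z ^ m * v(1/z)\<close> only the last factor depends on \<open>cnj z\<close>.\<close>

lemma chart_dd_zbar:
  assumes \<xi>: "\<xi> \<in> smooth_sections m" and z: "z \<noteq> 0"
  shows "dd_zbar (\<lambda>z. \<xi> (1, z)) z =
    - (z ^ m * (inverse (cnj z))\<^sup>2 * dd_zbar (\<lambda>w. \<xi> (w, 1)) (inverse z))"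
proof (rule has_wirtinger_imp_eq(2))
  note c = smooth_section_charts[OF \<xi>]
  have "has_wirtinger (\<lambda>z. z ^ m * \<xi> (inverse z, 1))
      (z ^ m * (- dd_z (\<lambda>w. \<xi> (w, 1)) (inverse z) / z\<^sup>2) + (of_nat m * z ^ (m - 1) * 1) * \<xi> (inverse z, 1))
      (z ^ m * (- dd_zbar (\<lambda>w. \<xi> (w, 1)) (inverse z) / (cnj z)\<^sup>2) + (of_nat m * z ^ (m - 1) * 0) * \<xi> (inverse z, 1)) z"
    by (intro has_wirtinger_mult has_wirtinger_power has_wirtinger_ident
        has_wirtinger_compose_inverse[where f = "\<lambda>w. \<xi> (w, 1)"] C_inf_has_wirtinger c z)
  then have "has_wirtinger (\<lambda>z. \<xi> (1, z))
      (z ^ m * (- dd_z (\<lambda>w. \<xi> (w, 1)) (inverse z) / z\<^sup>2) + (of_nat m * z ^ (m - 1) * 1) * \<xi> (inverse z, 1))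
      (z ^ m * (- dd_zbar (\<lambda>w. \<xi> (w, 1)) (inverse z) / (cnj z)\<^sup>2) + (of_nat m * z ^ (m - 1) * 0) * \<xi> (inverse z, 1)) z"
    by (rule has_wirtinger_transform[of _ _ _ _ "- {0}"]) (use z section_chart[OF c(1)] in auto)
  then show "has_wirtinger (\<lambda>z. \<xi> (1, z))
      (z ^ m * (- dd_z (\<lambda>w. \<xi> (w, 1)) (inverse z) / z\<^sup>2) + (of_nat m * z ^ (m - 1) * 1) * \<xi> (inverse z, 1))
      (- (z ^ m * (inverse (cnj z))\<^sup>2 * dd_zbar (\<lambda>w. \<xi> (w, 1)) (inverse z))) z"
    by (simp add: divide_inverse mult_ac power_inverse)
qed

lemma chart_dd_z_dd_zbar:
  assumes \<xi>: "\<xi> \<in> smooth_sections m" and z: "z \<noteq> 0"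
  defines "p \<equiv> dd_zbar (\<lambda>w. \<xi> (w, 1))"
  shows "dd_z (dd_zbar (\<lambda>z. \<xi> (1, z))) z =
    z ^ m * (inverse (cnj z))\<^sup>2 * ((inverse z)\<^sup>2 * dd_z p (inverse z) - of_nat m * inverse z * p (inverse z))"
proof (rule has_wirtinger_imp_eq(1))
  note c = smooth_section_charts[OF \<xi>]
  have p: "C_inf p" unfolding p_def by (intro C_inf_dd_zbar c)
  have zm: "of_nat m * z ^ (m - 1) = of_nat m * inverse z * z ^ m"
    using z by (cases m) simp_all
  have "has_wirtinger (\<lambda>z. inverse (cnj z)) (- 0 / (cnj z)\<^sup>2) (- 1 / (cnj z)\<^sup>2) z"
    using has_wirtinger_cnj[OF has_wirtinger_ident, of z] z by (intro has_wirtinger_inverse) simp_all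
  from has_wirtinger_power[OF this, of 2]
  have "has_wirtinger (\<lambda>z. (inverse (cnj z))\<^sup>2) 0 (- 2 * inverse (cnj z) * (1 / (cnj z)\<^sup>2)) z" by simp
  then have "has_wirtinger (\<lambda>z. (-1) * ((z ^ m * (inverse (cnj z))\<^sup>2) * p (inverse z)))
     ((-1) * ((z ^ m * (inverse (cnj z))\<^sup>2) * (- dd_z p (inverse z) / z\<^sup>2) +
        (z ^ m * 0 + (of_nat m * z ^ (m - 1) * 1) * (inverse (cnj z))\<^sup>2) * p (inverse z)) +
        0 * ((z ^ m * (inverse (cnj z))\<^sup>2) * p (inverse z)))
     ((-1) * ((z ^ m * (inverse (cnj z))\<^sup>2) * (- dd_zbar p (inverse z) / (cnj z)\<^sup>2) +
        (z ^ m * (- 2 * inverse (cnj z) * (1 / (cnj z)\<^sup>2)) + (of_nat m * z ^ (m - 1) * 0) * (inverse (cnj z))\<^sup>2) * p (inverse z)) +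
        0 * ((z ^ m * (inverse (cnj z))\<^sup>2) * p (inverse z))) z" (is "has_wirtinger _ ?a ?b z")
    by (intro has_wirtinger_mult has_wirtinger_power has_wirtinger_ident has_wirtinger_const
        has_wirtinger_compose_inverse[where f = p] C_inf_has_wirtinger p z)
  then have "has_wirtinger (dd_zbar (\<lambda>z. \<xi> (1, z))) ?a ?b z"
    by (rule has_wirtinger_transform[of _ _ _ _ "- {0}"])
       (use z chart_dd_zbar[OF \<xi>] in \<open>auto simp: p_def\<close>)
  moreover have "?a = z ^ m * (inverse (cnj z))\<^sup>2 *
      ((inverse z)\<^sup>2 * dd_z p (inverse z) - of_nat m * inverse z * p (inverse z))"
    unfolding zm by (simp add: divide_inverse algebra_simps power_inverse)
  ultimately show "has_wirtinger (dd_zbar (\<lambda>z. \<xi> (1, z))) (z ^ m * (inverse (cnj z))\<^sup>2 *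
      ((inverse z)\<^sup>2 * dd_z p (inverse z) - of_nat m * inverse z * p (inverse z))) ?b z"
    by (simp only:)
qed

section \<open>The Laplacian as a piecewise smooth section\<close>

text \<open>The canonical metrics are flat on each of the two discs bounded by the unit circle, so there
  the Laplacian is \<open>- \<partial>\<^sup>2/\<partial>z \<partial>(cnj z)\<close> in the trivialization of the chart
  centred at \<open>0\<close>, respectively at \<open>\<infinity>\<close>. Either expression extends to a section over the
  whole line; \<open>flat_lap0\<close> is the extension of the first, \<open>flat_lap1\<close> of the second.\<close>

definition flat_lap0 :: "nat \<Rightarrow> csection \<Rightarrow> csection" where
  "flat_lap0 m \<xi> x = (if fst x = 0 then 0
     else - (fst x ^ m * dd_z (dd_zbar (\<lambda>z. \<xi> (1, z))) (snd x / fst x)))"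

definition flat_lap1 :: "nat \<Rightarrow> csection \<Rightarrow> csection" where
  "flat_lap1 m \<xi> = flat_lap0 m (\<xi> \<circ> prod.swap) \<circ> prod.swap"

definition lap :: "nat \<Rightarrow> csection \<Rightarrow> csection" where
  "lap m \<xi> x = (if cmod (snd x) < cmod (fst x) then flat_lap0 m \<xi> x
     else if cmod (fst x) < cmod (snd x) then flat_lap1 m \<xi> x else 0)"

lemma is_section_swap: "is_section m \<xi> \<Longrightarrow> is_section m (\<xi> \<circ> prod.swap)"
  unfolding is_section_def by (auto simp: scale_pair_def prod.swap_def zero_prod_def)

lemma smooth_sections_swap: "\<xi> \<in> smooth_sections m \<Longrightarrow> \<xi> \<circ> prod.swap \<in> smooth_sections m"
  by (auto simp: smooth_sections_def is_section_swap)

text \<open>At the other pole the section is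
  \<open>(cnj w)\<^sup>2 * (m * w * p - w\<^sup>2 * \<partial>p/\<partial>w)\<close> with \<open>p\<close> the derivative of the section in
  \<open>cnj w\<close>. This vanishes at \<open>w = 0\<close>, which is the value chosen in the definition.\<close>

lemma flat_lap0_smooth:
  assumes \<xi>: "\<xi> \<in> smooth_sections m"
  shows "flat_lap0 m \<xi> \<in> smooth_sections m"
proof -
  note c = smooth_section_charts[OF \<xi>]
  let ?p = "dd_zbar (\<lambda>w. \<xi> (w, 1))"
  have p: "C_inf ?p" "C_inf (dd_z ?p)" by (intro C_inf_dd_zbar C_inf_dd_z c)+
  have "is_section m (flat_lap0 m \<xi>)"
    by (auto simp: is_section_def flat_lap0_def scale_pair_def power_mult_distrib)
  moreover have "(\<lambda>z. flat_lap0 m \<xi> (1, z)) = (\<lambda>z. (-1) * dd_z (dd_zbar (\<lambda>z. \<xi> (1, z))) z)"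
    by (simp add: flat_lap0_def)
  then have "C_inf (\<lambda>z. flat_lap0 m \<xi> (1, z))"
    using c by (simp only: C_inf_cmult C_inf_dd_zbar C_inf_dd_z)
  moreover have "flat_lap0 m \<xi> (w, 1) =
      (cnj w)\<^sup>2 * (of_nat m * (w * ?p w) + (-1) * (w\<^sup>2 * dd_z ?p w))" for w
  proof (cases "w = 0")
    case False
    then have "flat_lap0 m \<xi> (w, 1) = - (w ^ m * dd_z (dd_zbar (\<lambda>z. \<xi> (1, z))) (inverse w))"
      by (simp add: flat_lap0_def divide_inverse)
    moreover have "w ^ m * (inverse w ^ m * X) = X" for X
      using False by (simp add: power_inverse)
    ultimately show ?thesis
      using False by (simp add: chart_dd_z_dd_zbar[OF \<xi>] mult.assoc) (simp add: algebra_simps)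
  qed (simp add: flat_lap0_def)
  then have "C_inf (\<lambda>w. flat_lap0 m \<xi> (w, 1))"
    by (simp only:) (intro C_inf_mult C_inf_add C_inf_power C_inf_const C_inf_ident C_inf_cnj p)
  ultimately show ?thesis by (simp add: smooth_sections_def)
qed

lemma flat_lap1_smooth: "\<xi> \<in> smooth_sections m \<Longrightarrow> flat_lap1 m \<xi> \<in> smooth_sections m"
  unfolding flat_lap1_def by (intro smooth_sections_swap flat_lap0_smooth)

lemma flat_lap1_affine:
  "z \<noteq> 0 \<Longrightarrow> flat_lap1 m \<xi> (1, z) = - (z ^ m * dd_z (dd_zbar (\<lambda>w. \<xi> (w, 1))) (inverse z))"
  by (simp add: flat_lap1_def flat_lap0_def divide_inverse)

lemma is_section_lap: "is_section m (lap m \<xi>)"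
proof -
  have "is_section m (flat_lap0 m \<zeta>)" for \<zeta>
    by (auto simp: is_section_def flat_lap0_def scale_pair_def power_mult_distrib)
  then have "is_section m (flat_lap0 m \<xi>)" "is_section m (flat_lap1 m \<xi>)"
    unfolding flat_lap1_def by (auto intro: is_section_swap)
  then show ?thesis
    by (auto simp: is_section_def lap_def scale_pair_def norm_mult)
qed

lemma lap_affine:
  "lap m \<xi> (1, z) = (if cmod z < 1 then flat_lap0 m \<xi> (1, z)
     else if 1 < cmod z then flat_lap1 m \<xi> (1, z) else 0)"
  by (simp add: lap_def)

text \<open>In the affine coordinate this is \<open>1 / (1 + |z| ^ (2 n))\<close>. It is smooth on the whole line, so
  it replaces bump functions, and it converges to the indicator function of the unit disc off
  the unit circle.\<close>

definition cutoff :: "nat \<Rightarrow> csection" where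
  "cutoff n x = (fst x * cnj (fst x)) ^ n *
     inverse ((fst x * cnj (fst x)) ^ n + (snd x * cnj (snd x)) ^ n)"

lemma cutoff_scale: "c \<noteq> 0 \<Longrightarrow> cutoff n (scale_pair c x) = cutoff n x"
proof -
  assume c: "c \<noteq> 0"
  have "(fst (scale_pair c x) * cnj (fst (scale_pair c x))) ^ n = (c * cnj c) ^ n * (fst x * cnj (fst x)) ^ n"
    "(snd (scale_pair c x) * cnj (snd (scale_pair c x))) ^ n = (c * cnj c) ^ n * (snd x * cnj (snd x)) ^ n"
    by (simp_all add: scale_pair_def power_mult_distrib mult_ac)
  then show ?thesis using c
    by (simp add: cutoff_def flip: distrib_left)
qed

lemma cutoff_denominator_ne_0: "1 + (z * cnj z) ^ n \<noteq> 0" "(z * cnj z) ^ n + 1 \<noteq> 0"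
proof -
  have "1 + (z * cnj z) ^ n = of_real (1 + ((cmod z)\<^sup>2) ^ n)"
    by (simp only: complex_norm_square[symmetric] of_real_add of_real_power of_real_1)
  moreover have "1 + ((cmod z)\<^sup>2) ^ n \<noteq> 0"
    using zero_le_power[of "(cmod z)\<^sup>2" n] by (smt (verit) zero_le_power2)
  ultimately show "1 + (z * cnj z) ^ n \<noteq> 0" by (simp only: of_real_eq_0_iff not_False_eq_True)
  then show "(z * cnj z) ^ n + 1 \<noteq> 0" by (simp add: add.commute)
qed

lemma cutoff_smooth: "C_inf (\<lambda>z. cutoff n (1, z))" "C_inf (\<lambda>w. cutoff n (w, 1))"
  unfolding cutoff_def fst_conv snd_conv
  using cutoff_denominator_ne_0
  by (simp_all) (intro C_inf_mult C_inf_inverse C_inf_add C_inf_power C_inf_const C_inf_ident C_inf_cnj; simp)+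

lemma cutoff_affine: "cutoff n (1, z) = of_real (inverse (1 + ((cmod z)\<^sup>2) ^ n))"
  unfolding cutoff_def fst_conv snd_conv complex_norm_square[symmetric]
  by simp

lemma smooth_sections_mult:
  assumes "\<xi> \<in> smooth_sections m" "C_inf (\<lambda>z. \<phi> (1, z))" "C_inf (\<lambda>w. \<phi> (w, 1))"
    and "\<And>c x. c \<noteq> 0 \<Longrightarrow> \<phi> (scale_pair c x) = \<phi> x"
  shows "(\<lambda>x. \<phi> x * \<xi> x) \<in> smooth_sections m"
  using assms by (simp add: smooth_sections_def is_section_def C_inf_mult)

text \<open>The image of a smooth section jumps across the unit circle. Interpolating between the two
  smooth sections \<open>flat_lap0\<close> and \<open>flat_lap1\<close> with the functions \<open>cutoff n\<close> gives smooth
  sections that stay bounded and converge off the circle, hence converge in \<open>L\<^sup>2\<close>.\<close>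

lemma lap_L2_closure:
  assumes \<xi>: "\<xi> \<in> smooth_sections m"
  shows "lap m \<xi> \<in> L2_closure m"
proof -
  interpret finite_measure omega_inf by (rule finite_measure_omega_inf)
  let ?A = "flat_lap0 m \<xi>" and ?B = "flat_lap1 m \<xi>"
  note A = flat_lap0_smooth[OF \<xi>] and B = flat_lap1_smooth[OF \<xi>]
  have [measurable]: "unit_coord m ?A \<in> borel_measurable borel" "unit_coord m ?B \<in> borel_measurable borel"
    using smooth_sections_L2[OF A] smooth_sections_L2[OF B]
    by (auto simp: L2_sections_iff square_integrable_def cong: measurable_cong_sets)
  obtain CA CB where C: "\<And>z. cmod (unit_coord m ?A z) \<le> CA" "\<And>z. cmod (unit_coord m ?B z) \<le> CB"
    using smooth_section_bounded[OF A] smooth_section_bounded[OF B] by metis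
  have C0: "CA \<ge> 0" "CB \<ge> 0" using order_trans[OF norm_ge_zero C(1)] order_trans[OF norm_ge_zero C(2)] .
  have lapn: "unit_coord m (lap m \<xi>) z = (if cmod z < 1 then unit_coord m ?A z else if 1 < cmod z then unit_coord m ?B z else 0)" for z
    by (simp add: unit_coord_def lap_affine)
  have [measurable]: "unit_coord m (lap m \<xi>) \<in> borel_measurable borel"
    unfolding lapn[abs_def] by measurable
  have bound: "cmod (unit_coord m (lap m \<xi>) z) \<le> CA + CB" for z
    using C(1)[of z] C(2)[of z] C0 by (auto simp: lapn)
  have L2: "lap m \<xi> \<in> L2_sections m"
    unfolding L2_sections_iff
    by (intro conjI is_section_lap square_integrable_bounded[OF _ bound]) simp
  define s where "s n = (\<lambda>x. cutoff n x * ?A x + (1 + (-1) * cutoff n x) * ?B x)" for n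
  have s: "s n \<in> smooth_sections m" for n
    unfolding s_def
    by (intro smooth_sections_add smooth_sections_mult A B C_inf_add C_inf_const C_inf_cmult cutoff_smooth)
       (simp_all add: cutoff_scale)
  define r where "r n z = inverse (1 + ((cmod z)\<^sup>2) ^ n)" for n z
  have r: "0 \<le> r n z" "r n z \<le> 1" for n z
    by (simp_all add: r_def inverse_le_1_iff)
  have sn: "unit_coord m (s n) z = of_real (r n z) * unit_coord m ?A z + of_real (1 - r n z) * unit_coord m ?B z" for n z
    by (simp add: unit_coord_def s_def cutoff_affine r_def add_divide_distrib)
  have sn_bd: "cmod (unit_coord m (s n) z) \<le> CA + CB" for n z
  proof -
    have "cmod (unit_coord m (s n) z) \<le> r n z * cmod (unit_coord m ?A z) + (1 - r n z) * cmod (unit_coord m ?B z)"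
      unfolding sn using r[of n z]
      by (intro order_trans[OF norm_triangle_ineq]) (simp add: norm_mult del: of_real_diff)
    also have "\<dots> \<le> 1 * CA + 1 * CB"
      using r[of n z] C C0 by (intro add_mono mult_mono) auto
    finally show ?thesis by simp
  qed
  have [measurable]: "unit_coord m (s n) \<in> borel_measurable borel" for n
    unfolding sn[abs_def] r_def by measurable
  have conv: "AE z in omega_inf. (\<lambda>n. (cmod (unit_coord m (lap m \<xi>) z - unit_coord m (s n) z))\<^sup>2) \<longlonglongrightarrow> 0"
    unfolding AE_omega_inf using AE_not_circle
  proof eventually_elim
    case (elim z)
    consider "cmod z < 1" | "cmod z > 1" using elim by linarith
    then have "(\<lambda>n. unit_coord m (s n) z) \<longlonglongrightarrow> unit_coord m (lap m \<xi>) z"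
    proof cases
      case 1
      then have "(cmod z)\<^sup>2 < 1" by (simp add: power_less_one_iff)
      then have lim0: "(\<lambda>n. ((cmod z)\<^sup>2) ^ n) \<longlonglongrightarrow> 0" by (intro LIMSEQ_realpow_zero) auto
      have "(\<lambda>n. r n z) \<longlonglongrightarrow> inverse (1 + 0)"
        unfolding r_def by (intro tendsto_inverse tendsto_add tendsto_const lim0) simp
      then have "(\<lambda>n. unit_coord m (s n) z) \<longlonglongrightarrow> of_real (inverse (1 + 0)) * unit_coord m ?A z + of_real (1 - inverse (1 + 0)) * unit_coord m ?B z"
        unfolding sn by (intro tendsto_intros)
      then show ?thesis using 1 by (simp add: lapn)
    next
      case 2
      then have "1 < (cmod z)\<^sup>2" by (simp add: one_less_power)
      then have lim: "(\<lambda>n. inverse (((cmod z)\<^sup>2) ^ n)) \<longlonglongrightarrow> 0"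
        by (rule LIMSEQ_inverse_realpow_zero)
      have "r n z \<le> inverse (((cmod z)\<^sup>2) ^ n)" for n
        unfolding r_def by (intro le_imp_inverse_le zero_less_power) (use 2 in auto)
      then have "(\<lambda>n. r n z) \<longlonglongrightarrow> 0"
        by (rule real_tendsto_sandwich[OF always_eventually[OF allI] always_eventually[OF allI] tendsto_const lim, rotated])
           (rule r(1))
      then have "(\<lambda>n. unit_coord m (s n) z) \<longlonglongrightarrow> of_real 0 * unit_coord m ?A z + of_real (1 - 0) * unit_coord m ?B z"
        unfolding sn by (intro tendsto_intros)
      then show ?thesis using 2 by (simp add: lapn)
    qed
    then have "(\<lambda>n. (cmod (unit_coord m (lap m \<xi>) z - unit_coord m (s n) z))\<^sup>2) \<longlonglongrightarrow>
        (cmod (unit_coord m (lap m \<xi>) z - unit_coord m (lap m \<xi>) z))\<^sup>2"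
      by (intro tendsto_intros)
    then show ?case by simp
  qed
  have "(\<lambda>n. \<integral>z. (cmod (unit_coord m (lap m \<xi>) z - unit_coord m (s n) z))\<^sup>2 \<partial>omega_inf) \<longlonglongrightarrow> (\<integral>z. 0 \<partial>omega_inf)"
  proof (rule integral_dominated_convergence[where w = "\<lambda>_. (2 * (CA + CB))\<^sup>2"])
    show "AE z in omega_inf. norm ((cmod (unit_coord m (lap m \<xi>) z - unit_coord m (s n) z))\<^sup>2) \<le> (2 * (CA + CB))\<^sup>2" for n
    proof (rule AE_I2)
      fix z
      have "cmod (unit_coord m (lap m \<xi>) z - unit_coord m (s n) z) \<le> 2 * (CA + CB)"
        using norm_triangle_ineq4[of "unit_coord m (lap m \<xi>) z" "unit_coord m (s n) z"] bound[of z] sn_bd[of n z] by simp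
      then show "norm ((cmod (unit_coord m (lap m \<xi>) z - unit_coord m (s n) z))\<^sup>2) \<le> (2 * (CA + CB))\<^sup>2"
        by (simp add: power_mono)
    qed
  qed (use conv in \<open>simp_all cong: measurable_cong_sets\<close>)
  with L2 s show ?thesis by (auto simp: L2_closure_def)
qed

lemma lap_add:
  assumes "\<xi> \<in> smooth_sections m" "\<eta> \<in> smooth_sections m"
  shows "lap m (\<lambda>x. \<xi> x + \<eta> x) x = lap m \<xi> x + lap m \<eta> x"
proof -
  have lin: "dd_z (dd_zbar (\<lambda>z. f z + g z)) z = dd_z (dd_zbar f) z + dd_z (dd_zbar g) z"
    if "C_inf f" "C_inf g" for f g z
  proof -
    have "dd_zbar (\<lambda>z. f z + g z) = (\<lambda>z. dd_zbar f z + dd_zbar g z)"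
      by (intro ext has_wirtinger_imp_eq(2)[OF has_wirtinger_add[OF C_inf_has_wirtinger C_inf_has_wirtinger]] that)
    then show ?thesis
      by (simp only:)
         (intro has_wirtinger_imp_eq(1)[OF has_wirtinger_add[OF C_inf_has_wirtinger C_inf_has_wirtinger]]
           C_inf_dd_zbar that)
  qed
  show ?thesis
    using smooth_section_charts[OF assms(1)] smooth_section_charts[OF assms(2)]
    by (simp add: lap_def flat_lap1_def flat_lap0_def lin algebra_simps)
qed

lemma lap_scale:
  assumes "\<xi> \<in> smooth_sections m"
  shows "lap m (\<lambda>x. c * \<xi> x) x = c * lap m \<xi> x"
proof -
  have wc: "has_wirtinger (\<lambda>z. c * f z) (c * dd_z f z) (c * dd_zbar f z) z" if "C_inf f" for f z
    using has_wirtinger_mult[OF has_wirtinger_const C_inf_has_wirtinger[OF that], of c z] by simp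
  have lin: "dd_z (dd_zbar (\<lambda>z. c * f z)) z = c * dd_z (dd_zbar f) z" if f: "C_inf f" for f z
  proof -
    have "dd_zbar (\<lambda>z. c * f z) = (\<lambda>z. c * dd_zbar f z)"
      by (intro ext has_wirtinger_imp_eq(2)[OF wc] f)
    then show ?thesis
      by (simp only:) (intro has_wirtinger_imp_eq(1)[OF wc] C_inf_dd_zbar f)
  qed
  show ?thesis
    using smooth_section_charts[OF assms(1)]
    by (simp add: lap_def flat_lap1_def flat_lap0_def lin algebra_simps)
qed

section \<open>Stokes' theorem on the projective line\<close>

lemma C_inf_bounded_disc:
  assumes "C_inf f" obtains B where "\<And>w. cmod w \<le> 1 \<Longrightarrow> cmod (f w) \<le> B"
proof -
  have "bounded (f ` cball 0 1)"
    by (intro compact_imp_bounded compact_continuous_image C_inf_continuous assms compact_cball)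
  then obtain B where "\<forall>w\<in>cball 0 1. cmod (f w) \<le> B" by (auto simp: bounded_iff)
  then show ?thesis by (intro that[of B]) auto
qed

text \<open>The coefficient of \<open>\<partial>\<alpha>\<close> in the affine coordinate, for a (0,1)-form \<open>\<alpha>\<close> that has the
  coefficient \<open>g0\<close> on the unit disc and the coefficient \<open>g1\<close>, with respect to
  \<open>w = 1/z\<close>, on the complementary disc.\<close>

definition form_dz :: "(complex \<Rightarrow> complex) \<Rightarrow> (complex \<Rightarrow> complex) \<Rightarrow> complex \<Rightarrow> complex" where
  "form_dz g0 g1 z = (if cmod z < 1 then dd_z g0 z
     else if 1 < cmod z then (inverse z)\<^sup>2 * (inverse (cnj z))\<^sup>2 * dd_z g1 (inverse z) else 0)"

text \<open>Stokes' theorem on the projective line for a continuous (0,1)-form that is smooth on each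
  of the two closed discs. The hypothesis \<open>glue\<close> is the continuity on the circle:
  \<open>d(cnj w) = - (cnj z) ^ - 2 * d(cnj z)\<close>. The same factor gives the decay at infinity that
  the vanishing on the plane requires.\<close>

lemma stokes_sphere:
  assumes g: "C_inf g0" "C_inf g1"
    and glue: "\<And>z. cmod z = 1 \<Longrightarrow> g0 z = - ((inverse (cnj z))\<^sup>2 * g1 (inverse z))"
  shows "integrable lborel (form_dz g0 g1)" "(\<integral>z. form_dz g0 g1 z \<partial>lborel) = 0"
proof -
  define G where "G z = (if cmod z \<le> 1 then g0 z else - ((inverse (cnj z))\<^sup>2 * g1 (inverse z)))" for z
  define b where "b z = (if cmod z < 1 then dd_zbar g0 z
      else if 1 < cmod z then (inverse (cnj z)) ^ 4 * dd_zbar g1 (inverse z) + 2 * (inverse (cnj z)) ^ 3 * g1 (inverse z)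
      else 0)" for z
  have d: "C_inf (dd_z g0)" "C_inf (dd_z g1)" "C_inf (dd_zbar g0)" "C_inf (dd_zbar g1)"
    by (intro C_inf_dd_z C_inf_dd_zbar g)+
  have [measurable]: "f \<in> borel_measurable borel" if "C_inf f" for f
    using that by (intro borel_measurable_continuous_onI C_inf_continuous)
  note [measurable] = this[OF g(1)] this[OF g(2)] this[OF d(1)] this[OF d(2)] this[OF d(3)] this[OF d(4)]
  obtain B1 where B1: "\<And>w. cmod w \<le> 1 \<Longrightarrow> cmod (g0 w) \<le> B1" by (rule C_inf_bounded_disc[OF g(1)]) blast
  obtain B2 where B2: "\<And>w. cmod w \<le> 1 \<Longrightarrow> cmod (g1 w) \<le> B2" by (rule C_inf_bounded_disc[OF g(2)]) blast
  obtain B3 where B3: "\<And>w. cmod w \<le> 1 \<Longrightarrow> cmod (dd_z g0 w) \<le> B3" by (rule C_inf_bounded_disc[OF d(1)]) blast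
  obtain B4 where B4: "\<And>w. cmod w \<le> 1 \<Longrightarrow> cmod (dd_z g1 w) \<le> B4" by (rule C_inf_bounded_disc[OF d(2)]) blast
  obtain B5 where B5: "\<And>w. cmod w \<le> 1 \<Longrightarrow> cmod (dd_zbar g0 w) \<le> B5" by (rule C_inf_bounded_disc[OF d(3)]) blast
  obtain B6 where B6: "\<And>w. cmod w \<le> 1 \<Longrightarrow> cmod (dd_zbar g1 w) \<le> B6" by (rule C_inf_bounded_disc[OF d(4)]) blast
  define K where "K = \<bar>B1\<bar> + 2 * \<bar>B2\<bar> + \<bar>B3\<bar> + \<bar>B4\<bar> + \<bar>B5\<bar> + \<bar>B6\<bar>"
  have inv: "cmod (inverse z) \<le> 1" if "1 \<le> cmod z" for z
    using that by (simp add: norm_inverse inverse_le_1_iff)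
  have K0: "K \<ge> 0" by (simp add: K_def)
  have pw: "1 / cmod z ^ n \<le> 1" if "1 \<le> cmod z" for z n
    using that by (simp add: one_le_power divide_le_eq)
  have cont: "continuous_on UNIV G"
  proof -
    have "continuous_on ({z. cmod z \<le> 1} \<union> {z. 1 \<le> cmod z}) G"
      unfolding G_def
    proof (rule continuous_on_cases)
      show "closed {z::complex. cmod z \<le> 1}" "closed {z::complex. 1 \<le> cmod z}"
        by (intro closed_Collect_le continuous_intros)+
      show "continuous_on {z. cmod z \<le> 1} g0" by (rule C_inf_continuous[OF g(1)])
      show "continuous_on {z. 1 \<le> cmod z} (\<lambda>z. - ((inverse (cnj z))\<^sup>2 * g1 (inverse z)))"
        by (intro continuous_intros continuous_on_compose2[OF C_inf_continuous[OF g(2)]]) auto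
    qed (use glue in auto)
    moreover have "{z. cmod z \<le> 1} \<union> {z::complex. 1 \<le> cmod z} = UNIV" by auto
    ultimately show ?thesis by simp
  qed
  have deriv: "has_wirtinger G (form_dz g0 g1 z) (b z) z" if "cmod z \<noteq> 1" for z
  proof (cases "cmod z < 1")
    case True
    have "has_wirtinger G (dd_z g0 z) (dd_zbar g0 z) z"
      by (rule has_wirtinger_transform[OF C_inf_has_wirtinger[OF g(1)], of "ball 0 1"])
         (use True in \<open>auto simp: G_def\<close>)
    with True show ?thesis by (simp add: form_dz_def b_def)
  next
    case False
    with that have z: "1 < cmod z" "z \<noteq> 0" by auto
    have "has_wirtinger (\<lambda>z. inverse (cnj z)) (- 0 / (cnj z)\<^sup>2) (- 1 / (cnj z)\<^sup>2) z"
      using has_wirtinger_cnj[OF has_wirtinger_ident, of z] z by (intro has_wirtinger_inverse) simp_all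
    from has_wirtinger_power[OF this, of 2]
    have "has_wirtinger (\<lambda>z. (inverse (cnj z))\<^sup>2) 0 (- 2 * inverse (cnj z) * (1 / (cnj z)\<^sup>2)) z" by simp
    then have "has_wirtinger (\<lambda>z. (-1) * ((inverse (cnj z))\<^sup>2 * g1 (inverse z)))
       ((-1) * ((inverse (cnj z))\<^sup>2 * (- dd_z g1 (inverse z) / z\<^sup>2) + 0 * g1 (inverse z)) + 0 * ((inverse (cnj z))\<^sup>2 * g1 (inverse z)))
       ((-1) * ((inverse (cnj z))\<^sup>2 * (- dd_zbar g1 (inverse z) / (cnj z)\<^sup>2) + (- 2 * inverse (cnj z) * (1 / (cnj z)\<^sup>2)) * g1 (inverse z))
         + 0 * ((inverse (cnj z))\<^sup>2 * g1 (inverse z))) z" (is "has_wirtinger _ ?a ?b z")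
      by (intro has_wirtinger_mult has_wirtinger_const has_wirtinger_compose_inverse[where f = g1]
          C_inf_has_wirtinger g z)
    then have "has_wirtinger G ?a ?b z"
      by (rule has_wirtinger_transform[of _ _ _ _ "{z. 1 < cmod z}"])
         (use z in \<open>auto simp: G_def intro!: open_Collect_less continuous_intros\<close>)
    moreover have "?a = form_dz g0 g1 z" using z by (simp add: form_dz_def divide_inverse power_inverse mult_ac)
    moreover have "?b = b z" using z
      by (simp add: b_def divide_inverse power_inverse power2_eq_square power3_eq_cube power4_eq_xxxx algebra_simps)
    ultimately show ?thesis by (simp only:)
  qed
  have [measurable]: "form_dz g0 g1 \<in> borel_measurable borel" "b \<in> borel_measurable borel"
    unfolding form_dz_def[abs_def] b_def[abs_def] by measurable
  have ba: "cmod (form_dz g0 g1 z) \<le> K / max 1 (cmod z) ^ 4" for z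
  proof (cases "cmod z \<le> 1")
    case True
    then have "cmod (form_dz g0 g1 z) \<le> K" using B3[of z] K0 by (auto simp: form_dz_def K_def)
    with True show ?thesis by (simp add: max_def)
  next
    case False
    then have "cmod (form_dz g0 g1 z) = cmod (dd_z g1 (inverse z)) / cmod z ^ 4"
      by (simp add: form_dz_def norm_mult norm_power norm_inverse divide_inverse power_inverse power2_eq_square power4_eq_xxxx)
    also have "\<dots> \<le> K / cmod z ^ 4"
      using B4[OF inv, of z] False by (intro divide_right_mono) (auto simp: K_def)
    finally show ?thesis using False by (simp add: max_def)
  qed
  have bb: "cmod (b z) \<le> K" for z
  proof (cases "cmod z \<le> 1")
    case True
    then show ?thesis using B5[of z] K0 by (auto simp: b_def K_def)
  next
    case False
    have "cmod (b z) \<le> cmod (dd_zbar g1 (inverse z)) * (1 / cmod z ^ 4) + 2 * cmod (g1 (inverse z)) * (1 / cmod z ^ 3)"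
      using False norm_triangle_ineq[of "(inverse (cnj z)) ^ 4 * dd_zbar g1 (inverse z)" "2 * (inverse (cnj z)) ^ 3 * g1 (inverse z)"]
      by (simp add: b_def norm_mult norm_power norm_inverse divide_inverse power_inverse mult_ac)
    also have "\<dots> \<le> \<bar>B6\<bar> * 1 + 2 * \<bar>B2\<bar> * 1"
      using B6[OF inv, of z] B2[OF inv, of z] False pw[of z]
      by (intro add_mono mult_mono) auto
    finally show ?thesis by (simp add: K_def)
  qed
  have bG: "cmod (G z) \<le> K / max 1 (cmod z) ^ 2" for z
  proof (cases "cmod z \<le> 1")
    case True
    then show ?thesis using B1[of z] by (auto simp: G_def K_def max_def)
  next
    case False
    then have "cmod (G z) = cmod (g1 (inverse z)) / cmod z ^ 2"
      by (simp add: G_def norm_mult norm_power norm_inverse divide_inverse power_inverse)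
    also have "\<dots> \<le> K / cmod z ^ 2"
      using B2[OF inv, of z] False by (intro divide_right_mono) (auto simp: K_def)
    finally show ?thesis using False by (simp add: max_def)
  qed
  from integral_dz_eq_0[OF cont deriv _ _ ba bb bG]
  show "integrable lborel (form_dz g0 g1)" "(\<integral>z. form_dz g0 g1 z \<partial>lborel) = 0" by simp_all
qed

section \<open>The Dirichlet form\<close>

text \<open>The density of the Dirichlet form, written as \<open>h\<^sub>m\<close> of the antiholomorphic derivatives in
  the chart of the disc in question.\<close>

definition energy_density :: "csection \<Rightarrow> csection \<Rightarrow> complex \<Rightarrow> complex" where
  "energy_density \<xi> \<eta> z =
    (if cmod z < 1 then dd_zbar (\<lambda>z. \<xi> (1, z)) z * cnj (dd_zbar (\<lambda>z. \<eta> (1, z)) z)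
     else if 1 < cmod z then (inverse z)\<^sup>2 * (inverse (cnj z))\<^sup>2 *
       (dd_zbar (\<lambda>w. \<xi> (w, 1)) (inverse z) * cnj (dd_zbar (\<lambda>w. \<eta> (w, 1)) (inverse z)))
     else 0)"

lemma energy_density_sym: "energy_density \<eta> \<xi> z = cnj (energy_density \<xi> \<eta> z)"
  by (simp add: energy_density_def mult_ac)

lemma of_real_cmod_sq: "(of_real (cmod z))\<^sup>2 = z * cnj z"
  using complex_norm_square[of z] by simp

lemma energy_density_self: "\<exists>r\<ge>0. energy_density \<xi> \<xi> z = of_real r"
proof -
  have *: "a * cnj a = of_real ((cmod a)\<^sup>2)" for a
    by (rule complex_norm_square[symmetric])
  have **: "(inverse z)\<^sup>2 * (inverse (cnj z))\<^sup>2 = of_real ((cmod ((inverse z)\<^sup>2))\<^sup>2)"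
    using *[of "(inverse z)\<^sup>2"] by simp
  let ?r = "if cmod z < 1 then (cmod (dd_zbar (\<lambda>z. \<xi> (1, z)) z))\<^sup>2
       else if 1 < cmod z then
         (cmod ((inverse z)\<^sup>2))\<^sup>2 * (cmod (dd_zbar (\<lambda>w. \<xi> (w, 1)) (inverse z)))\<^sup>2
       else 0"
  have "energy_density \<xi> \<xi> z = of_real ?r"
    unfolding energy_density_def * ** by simp
  moreover have "0 \<le> ?r" by simp
  ultimately show ?thesis by blast
qed

lemma dd_z_mult_cnj:
  assumes "C_inf p" "C_inf v"
  shows "dd_z (\<lambda>z. p z * cnj (v z)) z = dd_z p z * cnj (v z) + p z * cnj (dd_zbar v z)"
  using has_wirtinger_imp_eq(1)[OF has_wirtinger_mult[OF C_inf_has_wirtinger[OF assms(1)]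
      has_wirtinger_cnj[OF C_inf_has_wirtinger[OF assms(2)]]], of z]
  by (simp add: add.commute)

text \<open>Also when \<open>f\<close> is not integrable: then both integrals are \<open>0\<close> by convention.\<close>

lemma integral_diff_null:
  fixes f g :: "'a \<Rightarrow> complex"
  assumes "integrable M g" "integral\<^sup>L M g = 0"
  shows "(\<integral>x. f x - g x \<partial>M) = integral\<^sup>L M f"
proof (cases "integrable M f")
  case False
  have "\<not> integrable M (\<lambda>x. f x - g x)"
  proof
    assume "integrable M (\<lambda>x. f x - g x)"
    from Bochner_Integration.integrable_add[OF this assms(1)] False show False by simp
  qed
  with False show ?thesis by (simp add: not_integrable_integral_eq)
qed (use assms in simp)

text \<open>The (0,1)-form obtained by pairing the antiholomorphic derivative of \<open>\<xi>\<close> with \<open>\<eta>\<close> by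
  means of \<open>h\<^sub>m\<close> is continuous across the unit circle, since \<open>h\<^sub>m\<close> is. Its \<open>\<partial>\<close> is the
  difference of the Dirichlet density and the density of \<open>h\<^sub>m(lap \<xi>, \<eta>)\<close>, and it
  integrates to zero. So the jumps of \<open>lap \<xi>\<close> on the circle leave no boundary term.\<close>

lemma L2_inner_lap:
  assumes \<xi>: "\<xi> \<in> smooth_sections m" and \<eta>: "\<eta> \<in> smooth_sections m"
  shows "L2_inner m (lap m \<xi>) \<eta> = (\<integral>z. energy_density \<xi> \<eta> z \<partial>lborel) / of_real pi"
proof -
  note cx = smooth_section_charts[OF \<xi>] and ce = smooth_section_charts[OF \<eta>]
  define g0 where "g0 z = dd_zbar (\<lambda>z. \<xi> (1, z)) z * cnj (\<eta> (1, z))" for z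
  define g1 where "g1 w = dd_zbar (\<lambda>w. \<xi> (w, 1)) w * cnj (\<eta> (w, 1))" for w
  have g: "C_inf g0" "C_inf g1"
    unfolding g0_def g1_def by (intro C_inf_mult C_inf_cnj_comp C_inf_dd_zbar cx ce)+
  have glue: "g0 z = - ((inverse (cnj z))\<^sup>2 * g1 (inverse z))" if z: "cmod z = 1" for z
  proof -
    have z0: "z \<noteq> 0" using z by auto
    have zz: "z ^ m * cnj z ^ m = 1"
      using z complex_norm_square[of z] by (simp flip: power_mult_distrib)
    have "g0 z = - ((z ^ m * cnj z ^ m) * ((inverse (cnj z))\<^sup>2 * g1 (inverse z)))"
      by (simp add: g0_def g1_def chart_dd_zbar[OF \<xi> z0] section_chart[OF ce(1) z0] mult_ac)
    then show ?thesis by (simp add: zz)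
  qed
  have point: "unit_coord m (lap m \<xi>) z * cnj (unit_coord m \<eta> z) / (pi * max 1 (cmod z) ^ 4) =
      (energy_density \<xi> \<eta> z - form_dz g0 g1 z) / of_real pi" if z: "cmod z \<noteq> 1" for z
  proof (cases "cmod z < 1")
    case True
    have "form_dz g0 g1 z = dd_z (dd_zbar (\<lambda>z. \<xi> (1, z))) z * cnj (\<eta> (1, z))
        + dd_zbar (\<lambda>z. \<xi> (1, z)) z * cnj (dd_zbar (\<lambda>z. \<eta> (1, z)) z)"
      using True unfolding form_dz_def g0_def by (simp add: dd_z_mult_cnj C_inf_dd_zbar cx ce)
    then show ?thesis using True
      by (simp add: energy_density_def unit_coord_def lap_affine flat_lap0_def max_def)
  next
    case False
    with z have z1: "1 < cmod z" "z \<noteq> 0" by auto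
    have form: "form_dz g0 g1 z = (inverse z)\<^sup>2 * (inverse (cnj z))\<^sup>2 *
        (dd_z (dd_zbar (\<lambda>w. \<xi> (w, 1))) (inverse z) * cnj (\<eta> (inverse z, 1))
        + dd_zbar (\<lambda>w. \<xi> (w, 1)) (inverse z) * cnj (dd_zbar (\<lambda>w. \<eta> (w, 1)) (inverse z)))"
      using z1 unfolding form_dz_def g1_def by (simp add: dd_z_mult_cnj C_inf_dd_zbar cx ce)
    have zz: "of_real (cmod z ^ 4) = z\<^sup>2 * (cnj z)\<^sup>2"
      using complex_norm_square[of z] by (simp add: power4_eq_xxxx power2_eq_square)
    have zm: "of_real (cmod z ^ m) * of_real (cmod z ^ m) = z ^ m * cnj z ^ m"
    proof -
      have "of_real (cmod z ^ m) * of_real (cmod z ^ m) = ((of_real (cmod z))\<^sup>2 :: complex) ^ m"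
        by (simp add: power2_eq_square power_mult_distrib)
      then show ?thesis by (simp add: of_real_cmod_sq power_mult_distrib)
    qed
    have "unit_coord m (lap m \<xi>) z * cnj (unit_coord m \<eta> z) =
        - (dd_z (dd_zbar (\<lambda>w. \<xi> (w, 1))) (inverse z) * cnj (\<eta> (inverse z, 1))) *
        ((z ^ m * cnj z ^ m) / (of_real (cmod z ^ m) * of_real (cmod z ^ m)))"
      using z1 by (simp add: unit_coord_def lap_affine flat_lap1_affine section_chart[OF ce(1) z1(2)] max_def)
    also have "\<dots> = - (dd_z (dd_zbar (\<lambda>w. \<xi> (w, 1))) (inverse z) * cnj (\<eta> (inverse z, 1)))"
      unfolding zm using z1 by simp
    finally have *: "unit_coord m (lap m \<xi>) z * cnj (unit_coord m \<eta> z) =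
      - (dd_z (dd_zbar (\<lambda>w. \<xi> (w, 1))) (inverse z) * cnj (\<eta> (inverse z, 1)))" .
    have "max 1 (cmod z) = cmod z" using z1 by simp
    then have m4: "complex_of_real (pi * max 1 (cmod z) ^ 4) = of_real pi * (z\<^sup>2 * (cnj z)\<^sup>2)"
      by (simp only: of_real_mult zz)
    show ?thesis
      unfolding * m4 form using z1
      by (simp add: energy_density_def field_simps)
  qed
  have meas: "(\<lambda>z. unit_coord m (lap m \<xi>) z * cnj (unit_coord m \<eta> z)) \<in> borel_measurable borel"
    using borel_measurable_integrable[OF unit_coord_integrable[OF L2_closure_L2[OF lap_L2_closure[OF \<xi>]]
        smooth_sections_L2[OF \<eta>]]]
    by (simp cong: measurable_cong_sets)
  have em: "energy_density \<xi> \<eta> \<in> borel_measurable borel"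
  proof -
    have meas_C_inf: "f \<in> borel_measurable borel" if "C_inf f" for f
      using that by (intro borel_measurable_continuous_onI C_inf_continuous)
    have d: "C_inf (dd_zbar (\<lambda>z. \<xi> (1, z)))" "C_inf (dd_zbar (\<lambda>w. \<xi> (w, 1)))"
      "C_inf (dd_zbar (\<lambda>z. \<eta> (1, z)))" "C_inf (dd_zbar (\<lambda>w. \<eta> (w, 1)))"
      by (intro C_inf_dd_zbar cx ce)+
    note [measurable] = d[THEN meas_C_inf]
    show ?thesis unfolding energy_density_def[abs_def] by measurable
  qed
  note st = stokes_sphere[OF g glue]
  have fm: "form_dz g0 g1 \<in> borel_measurable borel"
    using borel_measurable_integrable[OF st(1)] by simp
  have "L2_inner m (lap m \<xi>) \<eta> =
      (\<integral>z. unit_coord m (lap m \<xi>) z * cnj (unit_coord m \<eta> z) / (pi * max 1 (cmod z) ^ 4) \<partial>lborel)"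
    unfolding L2_inner_eq by (rule integral_omega_inf[OF meas])
  also have "\<dots> = (\<integral>z. (energy_density \<xi> \<eta> z - form_dz g0 g1 z) / of_real pi \<partial>lborel)"
  proof (rule integral_cong_AE)
    show "AE z in lborel. unit_coord m (lap m \<xi>) z * cnj (unit_coord m \<eta> z) / (pi * max 1 (cmod z) ^ 4) =
        (energy_density \<xi> \<eta> z - form_dz g0 g1 z) / of_real pi"
      using AE_not_circle by eventually_elim (rule point)
  qed (use meas em fm in \<open>auto intro!: borel_measurable_divide borel_measurable_diff\<close>)
  also have "\<dots> = (\<integral>z. energy_density \<xi> \<eta> z \<partial>lborel) / of_real pi"
    by (simp add: integral_diff_null[OF st])
  finally show ?thesis .
qed

definition lap_graph :: "nat \<Rightarrow> (csection set \<times> csection set) set" where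
  "lap_graph m = (\<lambda>\<xi>. (ae_class m \<xi>, ae_class m (lap m \<xi>))) ` smooth_sections m"

lemma lap_symmetric:
  assumes \<xi>: "\<xi> \<in> smooth_sections m" and \<eta>: "\<eta> \<in> smooth_sections m"
  shows "L2_inner m (lap m \<xi>) \<eta> = L2_inner m \<xi> (lap m \<eta>)"
proof -
  have "L2_inner m \<xi> (lap m \<eta>) = cnj (L2_inner m (lap m \<eta>) \<xi>)"
    unfolding L2_inner_eq Bochner_Integration.integral_cnj[symmetric] by (simp add: mult.commute)
  also have "\<dots> = (\<integral>z. cnj (energy_density \<eta> \<xi> z) \<partial>lborel) / of_real pi"
    by (simp add: L2_inner_lap[OF \<eta> \<xi>])
  also have "\<dots> = L2_inner m (lap m \<xi>) \<eta>"
    by (simp only: L2_inner_lap[OF \<xi> \<eta>] energy_density_sym[symmetric])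
  finally show ?thesis by simp
qed

lemma lap_positive:
  assumes \<xi>: "\<xi> \<in> smooth_sections m"
  shows "0 \<le> Re (L2_inner m (lap m \<xi>) \<xi>)"
proof -
  obtain r where r: "\<And>z. r z \<ge> 0" "\<And>z. energy_density \<xi> \<xi> z = of_real (r z)"
    using energy_density_self[of \<xi>] by metis
  have "L2_inner m (lap m \<xi>) \<xi> = of_real ((\<integral>z. r z \<partial>lborel) / pi)"
    unfolding L2_inner_lap[OF \<xi> \<xi>] r(2) by simp
  then show ?thesis using r(1) by simp
qed

lemma positive_symmetric_lap: "positive_symmetric (Hilb m) (lap_graph m)"
proof -
  interpret complex_hilbert "Hilb m" by (rule Hilb_complex_hilbert)
  have L: "\<xi> \<in> L2_sections m" "lap m \<xi> \<in> L2_sections m" if "\<xi> \<in> smooth_sections m" for \<xi>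
    using that by (auto intro: smooth_sections_L2 L2_closure_L2 lap_L2_closure)
  show ?thesis
  proof
    show "lap_graph m \<subseteq> carr (Hilb m) \<times> carr (Hilb m)"
      by (auto simp: lap_graph_def carr_Hilb intro: smooth_sections_closure lap_L2_closure)
    have "(\<lambda>_. 0) \<in> smooth_sections m"
      by (simp add: smooth_sections_def is_section_def C_inf_const)
    then show "lap_graph m \<noteq> {}" by (auto simp: lap_graph_def)
    show "densely_defined (Hilb m) (lap_graph m)"
      unfolding densely_defined_def
    proof (intro ballI allI impI)
      fix X and e :: real assume X: "X \<in> carr (Hilb m)" and e: "e > 0"
      then obtain \<xi> where \<xi>: "X = ae_class m \<xi>" "\<xi> \<in> L2_closure m" by (auto simp: carr_Hilb)
      then obtain s where s: "\<And>n::nat. s n \<in> smooth_sections m"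
        "(\<lambda>n. \<integral>z. (cmod (unit_coord m \<xi> z - unit_coord m (s n) z))\<^sup>2 \<partial>omega_inf) \<longlonglongrightarrow> 0"
        by (auto simp: L2_closure_def)
      have "\<forall>\<^sub>F n in sequentially. (\<integral>z. (cmod (unit_coord m \<xi> z - unit_coord m (s n) z))\<^sup>2 \<partial>omega_inf) < e\<^sup>2"
        by (rule order_tendstoD(2)[OF s(2)]) (use e in simp)
      then obtain n where n: "(\<integral>z. (cmod (unit_coord m \<xi> z - unit_coord m (s n) z))\<^sup>2 \<partial>omega_inf) < e\<^sup>2"
        by (auto simp: eventually_sequentially)
      have "vdist (Hilb m) X (ae_class m (s n)) < e"
        unfolding vdist_def Let_def \<xi>(1) Hilb_nsq_diff[OF L2_closure_L2[OF \<xi>(2)] L(1)[OF s(1)]]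
        using n e by (intro real_less_lsqrt) auto
      moreover have "ae_class m (s n) \<in> Domain (lap_graph m)"
        using s(1)[of n] by (auto simp: lap_graph_def)
      ultimately show "\<exists>y\<in>Domain (lap_graph m). vdist (Hilb m) X y < e" by blast
    qed
  next
    fix X V assume "(X, V) \<in> lap_graph m"
    then obtain \<xi> where \<xi>: "\<xi> \<in> smooth_sections m" "X = ae_class m \<xi>" "V = ae_class m (lap m \<xi>)"
      by (auto simp: lap_graph_def)
    show "0 \<le> Re (inn (Hilb m) V X)"
      unfolding \<xi>(2,3) Hilb_inn[OF L(2,1)[OF \<xi>(1)]] by (rule lap_positive[OF \<xi>(1)])
    show "(vscale (Hilb m) c X, vscale (Hilb m) c V) \<in> lap_graph m" for c
      unfolding \<xi>(2,3) Hilb_scale[OF L(1)[OF \<xi>(1)]] Hilb_scale[OF L(2)[OF \<xi>(1)]] lap_graph_def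
      by (rule image_eqI[OF _ smooth_sections_scale[OF \<xi>(1), of c]]) (simp add: lap_scale[OF \<xi>(1), abs_def])
    fix Y W assume "(Y, W) \<in> lap_graph m"
    then obtain \<eta> where \<eta>: "\<eta> \<in> smooth_sections m" "Y = ae_class m \<eta>" "W = ae_class m (lap m \<eta>)"
      by (auto simp: lap_graph_def)
    show "inn (Hilb m) V Y = inn (Hilb m) X W"
      unfolding \<xi>(2,3) \<eta>(2,3) Hilb_inn[OF L(2)[OF \<xi>(1)] L(1)[OF \<eta>(1)]]
        Hilb_inn[OF L(1)[OF \<xi>(1)] L(2)[OF \<eta>(1)]]
      by (rule lap_symmetric[OF \<xi>(1) \<eta>(1)])
    show "(vadd (Hilb m) X Y, vadd (Hilb m) V W) \<in> lap_graph m"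
      unfolding \<xi>(2,3) \<eta>(2,3) Hilb_add[OF L(1)[OF \<xi>(1)] L(1)[OF \<eta>(1)]]
        Hilb_add[OF L(2)[OF \<xi>(1)] L(2)[OF \<eta>(1)]] lap_graph_def
      by (rule image_eqI[OF _ smooth_sections_add[OF \<xi>(1) \<eta>(1)]]) (simp add: lap_add[OF \<xi>(1) \<eta>(1), abs_def])
  qed
qed

section \<open>The Laplacian of a decomposed section\<close>

lemma affine_coord_hpoint: "affine_coord (hpoint (1, z)) = z"
proof -
  have "proportional (1, z) (1, z)"
    by (auto simp: proportional_def scale_pair_def zero_prod_def intro!: exI[of _ 1])
  then show ?thesis unfolding hpoint_def by (simp add: affine_coord.abs_eq)
qed

text \<open>The logarithmic derivative of the metric, the connection coefficient, is the only thing about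
  \<open>h\<^sub>m(z ^ k, z ^ k)\<close> that enters the Laplacian; it is additive in products.\<close>

definition has_log_dz :: "(complex \<Rightarrow> complex) \<Rightarrow> complex \<Rightarrow> complex \<Rightarrow> bool" where
  "has_log_dz f \<mu> z \<longleftrightarrow> f z \<noteq> 0 \<and> (\<exists>b. has_wirtinger f (f z * \<mu>) b z)"

lemma has_log_dz_ident: "z \<noteq> 0 \<Longrightarrow> has_log_dz (\<lambda>z. z) (1 / z) z"
  using has_wirtinger_ident[of z] by (auto simp: has_log_dz_def)

lemma has_log_dz_cnj: "z \<noteq> 0 \<Longrightarrow> has_log_dz cnj 0 z"
  using has_wirtinger_cnj[OF has_wirtinger_ident, of z] by (auto simp: has_log_dz_def)

lemma has_log_dz_mult:
  "\<lbrakk>has_log_dz f \<mu> z; has_log_dz g \<nu> z\<rbrakk> \<Longrightarrow> has_log_dz (\<lambda>z. f z * g z) (\<mu> + \<nu>) z"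
  unfolding has_log_dz_def
proof safe
  fix b c assume "has_wirtinger f (f z * \<mu>) b z" "has_wirtinger g (g z * \<nu>) c z"
  from has_wirtinger_mult[OF this]
  show "\<exists>b. has_wirtinger (\<lambda>z. f z * g z) (f z * g z * (\<mu> + \<nu>)) b z"
    by (auto simp: algebra_simps)
qed auto

lemma has_log_dz_power: "has_log_dz f \<mu> z \<Longrightarrow> has_log_dz (\<lambda>z. f z ^ n) (of_nat n * \<mu>) z"
proof (induction n)
  case 0
  then show ?case using has_wirtinger_const[of 1 z] by (auto simp: has_log_dz_def)
next
  case (Suc n)
  from has_log_dz_mult[OF Suc.prems Suc.IH[OF Suc.prems]] show ?case by (simp add: algebra_simps)
qed

lemma has_log_dz_inverse: "has_log_dz f \<mu> z \<Longrightarrow> has_log_dz (\<lambda>z. inverse (f z)) (- \<mu>) z"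
  unfolding has_log_dz_def
proof safe
  fix b assume f: "f z \<noteq> 0" "has_wirtinger f (f z * \<mu>) b z"
  from has_wirtinger_inverse[OF f(2,1)]
  have "has_wirtinger (\<lambda>z. inverse (f z)) (inverse (f z) * - \<mu>) (- b / (f z)\<^sup>2) z"
    using f(1) by (simp add: field_simps power2_eq_square)
  then show "\<exists>b. has_wirtinger (\<lambda>z. inverse (f z)) (inverse (f z) * - \<mu>) b z" by blast
qed auto

lemma has_log_dz_transform:
  assumes "has_log_dz f \<mu> z" "open S" "z \<in> S" "\<And>u. u \<in> S \<Longrightarrow> f u = g u"
  shows "has_log_dz g \<mu> z"
  using assms(1) has_wirtinger_transform[of f _ _ z S g] assms(2-4)
  unfolding has_log_dz_def by (metis (no_types))

lemma herm_mono_log_dz: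
  assumes z: "z \<noteq> 0" "cmod z \<noteq> 1"
  shows "has_log_dz (herm m (mono_section m k) (mono_section m k))
    (of_nat k / z - (if cmod z < 1 then 0 else of_nat m / z)) z"
proof (cases "cmod z < 1")
  case True
  have "has_log_dz (\<lambda>z. z ^ k * cnj z ^ k) (of_nat k * (1 / z) + of_nat k * 0) z"
    by (intro has_log_dz_mult has_log_dz_power has_log_dz_ident has_log_dz_cnj z)
  then have "has_log_dz (herm m (mono_section m k) (mono_section m k)) (of_nat k * (1 / z) + of_nat k * 0) z"
    by (rule has_log_dz_transform[of _ _ _ "ball 0 1"])
       (use True in \<open>auto simp: herm_def mono_section_def tensor_mono_def\<close>)
  with True show ?thesis by simp
next
  case False
  with z have z1: "1 < cmod z" by simp
  have "has_log_dz (\<lambda>z. (z ^ k * cnj z ^ k) * inverse ((z * cnj z) ^ m))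
      ((of_nat k * (1 / z) + of_nat k * 0) + - (of_nat m * (1 / z + 0))) z"
    by (intro has_log_dz_mult has_log_dz_power has_log_dz_inverse has_log_dz_ident has_log_dz_cnj z)
  then have "has_log_dz (herm m (mono_section m k) (mono_section m k))
      ((of_nat k * (1 / z) + of_nat k * 0) + - (of_nat m * (1 / z + 0))) z"
  proof (rule has_log_dz_transform[of _ _ _ "{z. 1 < cmod z}"])
    fix u :: complex assume "u \<in> {z. 1 < cmod z}"
    then have "max 1 (cmod u) = cmod u" by simp
    moreover have "of_real (cmod u ^ (2 * m)) = (u * cnj u) ^ m"
      by (simp add: power_mult of_real_cmod_sq)
    ultimately show "(u ^ k * cnj u ^ k) * inverse ((u * cnj u) ^ m) =
        herm m (mono_section m k) (mono_section m k) u"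
      by (simp only: herm_def) (simp add: mono_section_def tensor_mono_def divide_inverse)
  qed (use z1 in \<open>auto intro!: open_Collect_less continuous_intros\<close>)
  with False show ?thesis by simp
qed

text \<open>The part \<open>k / z\<close> of the connection coefficient is absorbed by the factor \<open>z ^ k\<close> of the
  section. What remains depends on the section \<open>f \<otimes> z ^ k\<close> only, so the summands of any
  decomposition can be added up.\<close>

lemma laplace_coeff_affine:
  fixes k :: nat
  assumes f: "smooth_function f" and z: "z \<noteq> 0" "cmod z \<noteq> 1"
  defines "w \<equiv> \<lambda>z. f (hpoint (1, z)) * z ^ k"
  shows "tensor_mono m k (laplace_coeff m k f) (1, z) = - of_real (max 1 (cmod z) ^ 4) *
     (dd_z (dd_zbar w) z - (if cmod z < 1 then 0 else of_nat m / z) * dd_zbar w z)"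
proof -
  define g where "g = (\<lambda>z. f (hpoint (1, z)))"
  define h where "h = herm m (mono_section m k) (mono_section m k)"
  define \<nu> where "\<nu> = (if cmod z < 1 then 0 else of_nat m / z)"
  have g: "C_inf g" using f by (simp add: smooth_function_def g_def)
  have "has_log_dz h (of_nat k / z - \<nu>) z"
    unfolding h_def \<nu>_def by (rule herm_mono_log_dz[OF z])
  then obtain b where h0: "h z \<noteq> 0" and hb: "has_wirtinger h (h z * (of_nat k / z - \<nu>)) b z"
    by (auto simp: has_log_dz_def)
  have "dd_z (\<lambda>u. h u * dd_zbar g u) z =
      h z * dd_z (dd_zbar g) z + h z * (of_nat k / z - \<nu>) * dd_zbar g z"
    by (rule has_wirtinger_imp_eq(1)[OF has_wirtinger_mult[OF hb C_inf_has_wirtinger[OF C_inf_dd_zbar[OF g]]]])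
  then have 1: "inverse (h z) * dd_z (\<lambda>u. h u * dd_zbar g u) z =
      dd_z (dd_zbar g) z + (of_nat k / z - \<nu>) * dd_zbar g z"
    using h0 by (simp add: field_simps)
  have zk: "has_wirtinger (\<lambda>z. z ^ k) (of_nat k * u ^ (k - 1)) 0 u" for u
    using has_wirtinger_power[OF has_wirtinger_ident, of k u] by simp
  have wbar: "dd_zbar w = (\<lambda>u. dd_zbar g u * u ^ k)"
  proof
    fix u
    show "dd_zbar w u = dd_zbar g u * u ^ k"
      using has_wirtinger_imp_eq(2)[OF has_wirtinger_mult[OF C_inf_has_wirtinger[OF g] zk], of u]
      by (simp add: w_def g_def)
  qed
  have A: "dd_z (dd_zbar w) z = dd_zbar g z * (of_nat k * z ^ (k - 1)) + dd_z (dd_zbar g) z * z ^ k"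
    unfolding wbar
    by (rule has_wirtinger_imp_eq(1)[OF has_wirtinger_mult[OF C_inf_has_wirtinger[OF C_inf_dd_zbar[OF g]] zk]])
  have B: "of_nat k * z ^ (k - 1) = z ^ k * (of_nat k / z)" using z by (cases k) auto
  have 2: "dd_z (dd_zbar w) z - \<nu> * dd_zbar w z =
      (dd_z (dd_zbar g) z + (of_nat k / z - \<nu>) * dd_zbar g z) * z ^ k"
    unfolding A[unfolded B] unfolding wbar by (simp add: algebra_simps)
  have "laplace_coeff m k f (hpoint (1, z)) =
      - of_real (max 1 (cmod z) ^ 4) * (inverse (h z) * dd_z (\<lambda>u. h u * dd_zbar g u) z)"
    using z by (simp add: laplace_coeff_def affine_coord_hpoint Let_def herm_T_def g_def h_def)
  then show ?thesis
    unfolding tensor_mono_def \<nu>_def[symmetric] 2 1 by (simp add: mult_ac)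
qed

text \<open>For any decomposition of \<open>\<xi>\<close> the image agrees with \<open>lap m \<xi>\<close> off the circle and the
  origin: inside the circle directly, outside it by the formulas for the change of chart.\<close>

lemma laplacian_subset: "laplacian m \<subseteq> lap_graph m"
proof
  fix p assume "p \<in> laplacian m"
  then obtain \<xi> \<eta> f where p: "p = (ae_class m \<xi>, ae_class m \<eta>)" and \<xi>: "\<xi> \<in> smooth_sections m"
    and f: "\<forall>k\<le>m. smooth_function (f k)"
    and dec: "\<forall>x. x \<noteq> 0 \<longrightarrow> \<xi> x = (\<Sum>k\<le>m. tensor_mono m k (f k) x)"
    and \<eta>: "\<eta> = (\<lambda>x. \<Sum>k\<le>m. tensor_mono m k (laplace_coeff m k (f k)) x)"
    unfolding laplacian_def by blast
  define w where "w k = (\<lambda>z. f k (hpoint (1, z)) * z ^ k)" for k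
  have w: "C_inf (w k)" if "k \<le> m" for k
    using f that unfolding w_def smooth_function_def
    by (intro C_inf_mult C_inf_power C_inf_ident) blast
  have U: "(\<lambda>z. \<xi> (1, z)) = (\<lambda>z. \<Sum>k\<le>m. w k z)"
  proof
    fix z :: complex
    have "(1, z) \<noteq> (0 :: complex \<times> complex)" by (simp add: zero_prod_def)
    with dec show "\<xi> (1, z) = (\<Sum>k\<le>m. w k z)" by (simp add: w_def tensor_mono_def)
  qed
  have Ubar: "dd_zbar (\<lambda>z. \<xi> (1, z)) = (\<lambda>z. \<Sum>k\<le>m. dd_zbar (w k) z)"
    unfolding U
    by (intro ext has_wirtinger_imp_eq(2)[OF has_wirtinger_sum[OF finite_atMost C_inf_has_wirtinger]] w) simp
  have Uzbar: "dd_z (dd_zbar (\<lambda>z. \<xi> (1, z))) z = (\<Sum>k\<le>m. dd_z (dd_zbar (w k)) z)" for z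
    unfolding Ubar
    by (intro has_wirtinger_imp_eq(1)[OF has_wirtinger_sum[OF finite_atMost C_inf_has_wirtinger]]
        C_inf_dd_zbar w) simp
  have eq: "\<eta> (1, z) = lap m \<xi> (1, z)" if z: "z \<noteq> 0" "cmod z \<noteq> 1" for z
  proof -
    define \<nu> where "\<nu> = (if cmod z < 1 then 0 else of_nat m / z)"
    have "\<eta> (1, z) = (\<Sum>k\<le>m. - of_real (max 1 (cmod z) ^ 4) * (dd_z (dd_zbar (w k)) z - \<nu> * dd_zbar (w k) z))"
      unfolding \<eta> w_def \<nu>_def using f by (intro sum.cong refl laplace_coeff_affine z) simp
    also have "\<dots> = - of_real (max 1 (cmod z) ^ 4) *
        (dd_z (dd_zbar (\<lambda>z. \<xi> (1, z))) z - \<nu> * dd_zbar (\<lambda>z. \<xi> (1, z)) z)"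
      unfolding Uzbar unfolding Ubar
      by (simp add: sum_distrib_left sum_subtractf right_diff_distrib sum_negf)
    also have "\<dots> = lap m \<xi> (1, z)"
    proof (cases "cmod z < 1")
      case True
      then show ?thesis by (simp add: \<nu>_def lap_affine flat_lap0_def max_def)
    next
      case False
      with z have z1: "1 < cmod z" by simp
      have "max 1 (cmod z) = cmod z" using z1 by simp
      moreover have "of_real (cmod z ^ 4) = z\<^sup>2 * (cnj z)\<^sup>2"
        using complex_norm_square[of z] by (simp add: power4_eq_xxxx power2_eq_square)
      ultimately have m4: "complex_of_real (max 1 (cmod z) ^ 4) = z\<^sup>2 * (cnj z)\<^sup>2" by simp
      show ?thesis
        unfolding m4 chart_dd_z_dd_zbar[OF \<xi> z(1)] chart_dd_zbar[OF \<xi> z(1)] \<nu>_def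
        using z1 z(1) by (simp add: lap_affine flat_lap1_affine field_simps)
    qed
    finally show ?thesis .
  qed
  have "AE z in lborel. z \<noteq> (0::complex)" by (rule AE_lborel_singleton)
  with AE_not_circle have "AE z in omega_inf. \<eta> (1, z) = lap m \<xi> (1, z)"
    unfolding AE_omega_inf by eventually_elim (rule eq)
  then have "ae_class m \<eta> = ae_class m (lap m \<xi>)" by (rule ae_class_eqI)
  with p \<xi> show "p \<in> lap_graph m" by (simp add: lap_graph_def)
qed

section \<open>The self-adjoint extension\<close>

theorem mainTheorem2:
  fixes m :: nat
  shows "\<exists>Q. maximal_self_adjoint (Hilb m) Q \<and> positive_operator (Hilb m) Q \<and>
             laplacian m \<subseteq> Q"
proof -
  interpret positive_symmetric "Hilb m" "lap_graph m" by (rule positive_symmetric_lap)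
  show ?thesis using friedrichs_extension laplacian_subset by blast
qed

end
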